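(* Let $d\ge2$ and $\alpha\in[1,\infty)$. For every set $E$ of finite restricted $\alpha$-Hermite perimeter in $\mathbb R^d$, there exists a function $u\in L^1(\mathbb R^d)$ such that $$\mathscr F_{u,\mathcal H_\alpha}(E)\le\mathscr F_{u,\mathcal H_\alpha}(F)$$ holds for every set $F$ of finite restricted $\alpha$-Hermite perimeter in $\mathbb R^d$, where $$\mathscr F_{u,\mathcal H_\alpha}(F):=\widetilde P_{\mathcal H_\alpha}(F)+\int_F u(x)\,dx .$$
   Context: For $i=1,\dots,d$ put $A^{\pm}_{i,\alpha}=\partial_{x_i}\pm\sqrt{\alpha-1}\,x_i|x|^{(\alpha-2)/2}$ (the second term acting by multiplication). For $\varphi=(\varphi_1,\dots,\varphi_{2d})\in C^1(\mathbb R^d;\mathbb R^{2d})$, $$\mathrm{div}_{\mathcal H_\alpha}\varphi=A^+_{d,\alpha}\varphi_1+\cdots+A^+_{1,\alpha}\varphi_d+A^-_{1,\alpha}\varphi_{d+1}+\cdots+A^-_{d,\alpha}\varphi_{2d}.$$ $\mathcal F_R(\mathbb R^d)$ is the class of $\varphi\in C^1_c(\mathbb R^d;\mathbb R^{2d})$ with $\sup_x(|\varphi_1(x)|^2+\cdots+|\varphi_{2d}(x)|^2)^{1/2}\le1$ and $$\int_{\mathbb R^d}\Big[\sum_{k=1}^d\sqrt{\alpha-1}\,x_k|x|^{(\alpha-2)/2}\varphi_{d-k+1}(x)-\sum_{k=1}^d\sqrt{\alpha-1}\,x_k|x|^{(\alpha-2)/2}\varphi_{d+k}(x)\Big]dx=0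 .$$ The restricted $\alpha$-Hermite perimeter of a (measurable) set $E\subseteq\mathbb R^d$ is $\widetilde P_{\mathcal H_\alpha}(E)=\sup_{\varphi\in\mathcal F_R(\mathbb R^d)}\int_E\mathrm{div}_{\mathcal H_\alpha}\varphi(x)\,dx$. *)

theory Defs
  imports "HOL-Analysis.Analysis"
begin

text \<open>
  The index type \<open>'d\<close> plays the role of \<open>{1..d}\<close>. Vectors in \<open>2d\<close>-space are indexed by
  \<open>'d + 'd\<close>: the component \<open>Inl k\<close> is the one usually numbered \<open>d - k + 1\<close> (it is paired with
  \<open>A_plus \<alpha> k\<close>), and \<open>Inr k\<close> is the one numbered \<open>d + k\<close> (it is paired with \<open>A_minus \<alpha> k\<close>).
\<close>

definition partial_deriv :: "'d::finite \<Rightarrow> (real^'d \<Rightarrow> real) \<Rightarrow> real^'d \<Rightarrow> real" where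
  "partial_deriv i f x = frechet_derivative f (at x) (axis i 1)"

text \<open>For \<open>\<alpha> < 2\<close> the power of the norm is singular at the origin; since \<open>0 powr a = 0\<close>, the
  potential takes the value \<open>0\<close> there, which for \<open>\<alpha> \<ge> 1\<close> is its continuous extension.\<close>

definition potential :: "real \<Rightarrow> 'd::finite \<Rightarrow> real^'d \<Rightarrow> real" where
  "potential \<alpha> i x = sqrt (\<alpha> - 1) * x $ i * norm x powr ((\<alpha> - 2) / 2)"

definition A_plus :: "real \<Rightarrow> 'd::finite \<Rightarrow> (real^'d \<Rightarrow> real) \<Rightarrow> real^'d \<Rightarrow> real" where
  "A_plus \<alpha> i f x = partial_deriv i f x + potential \<alpha> i x * f x"

definition A_minus :: "real \<Rightarrow> 'd::finite \<Rightarrow> (real^'d \<Rightarrow> real) \<Rightarrow> real^'d \<Rightarrow> real" where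
  "A_minus \<alpha> i f x = partial_deriv i f x - potential \<alpha> i x * f x"

definition hermite_div :: "real \<Rightarrow> (real^'d::finite \<Rightarrow> real^('d + 'd)) \<Rightarrow> real^'d \<Rightarrow> real" where
  "hermite_div \<alpha> \<phi> x =
     (\<Sum>i\<in>UNIV. A_plus \<alpha> i (\<lambda>y. \<phi> y $ Inl i) x) + (\<Sum>i\<in>UNIV. A_minus \<alpha> i (\<lambda>y. \<phi> y $ Inr i) x)"

definition C1_compact_support :: "('a::euclidean_space \<Rightarrow> 'b::euclidean_space) \<Rightarrow> bool" where
  "C1_compact_support \<phi> \<longleftrightarrow>
     (\<exists>\<phi>' :: 'a \<Rightarrow> 'a \<Rightarrow>\<^sub>L 'b.
        (\<forall>x. (\<phi> has_derivative blinfun_apply (\<phi>' x)) (at x)) \<and> continuous_on UNIV \<phi>') \<and>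
     compact (closure {x. \<phi> x \<noteq> 0})"

definition restricted_fields :: "real \<Rightarrow> (real^'d::finite \<Rightarrow> real^('d + 'd)) set" where
  "restricted_fields \<alpha> = {\<phi>. C1_compact_support \<phi> \<and> (\<forall>x. norm (\<phi> x) \<le> 1) \<and>
     (LINT x|lebesgue. (\<Sum>k\<in>UNIV. potential \<alpha> k x * \<phi> x $ Inl k)
                     - (\<Sum>k\<in>UNIV. potential \<alpha> k x * \<phi> x $ Inr k)) = 0}"

definition restricted_perimeter :: "real \<Rightarrow> (real^'d::finite) set \<Rightarrow> ereal" where
  "restricted_perimeter \<alpha> E =
     (SUP \<phi>\<in>restricted_fields \<alpha>. ereal (LINT x:E|lebesgue. hermite_div \<alpha> \<phi> x))"

definition finite_restricted_perimeter :: "real \<Rightarrow> (real^'d::finite) set \<Rightarrow> bool" where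
  "finite_restricted_perimeter \<alpha> E \<longleftrightarrow> E \<in> sets lebesgue \<and> restricted_perimeter \<alpha> E < \<infinity>"

definition hermite_functional ::
    "real \<Rightarrow> (real^'d::finite \<Rightarrow> real) \<Rightarrow> (real^'d) set \<Rightarrow> ereal" where
  "hermite_functional \<alpha> u F = restricted_perimeter \<alpha> F + ereal (LINT x:F|lebesgue. u x)"

end

theory Submission
  imports Defs
begin

text \<open>
  Write \<open>P\<close> for the restricted perimeter. Existence of \<open>u\<close> uses only four properties of \<open>P\<close>: it is
  nonnegative, it does not change under complements, it is lower semicontinuous under almost
  everywhere convergence of indicator functions, and it is submodular,
  \<open>P (A \<union> B) + P (A \<inter> B) \<le> P A + P B\<close>. Fix an integrable \<open>h > 0\<close> and let \<open>m\<close> be the measure with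
  density \<open>h\<close>. For each \<open>n\<close> the functional \<open>P G + 2^n * m (E - G)\<close> has a minimizer \<open>F n\<close> among the sets
  \<open>G \<subseteq> E\<close>: submodularity makes the upper limit set of a fast minimizing sequence a minimizer, which
  replaces a compactness argument (\<open>minimizer_exists\<close>). The \<open>F n\<close> can be taken increasing, and they exhaust \<open>E\<close>
  because \<open>m (E - F n) \<le> P E / 2^n\<close>. Let \<open>v\<close> be \<open>2^n * h\<close> on the shell \<open>F n - F (n - 1)\<close>. Comparing
  consecutive minimizers bounds \<open>\<integral> v\<close> by a telescoping sum, and adding the shells to a set \<open>G \<subseteq> E\<close> one
  after the other gives \<open>P E \<le> P G + \<integral>\<^bsub>E - G\<^esub> v\<close> (\<open>inner_curvature\<close>). The complement of \<open>E\<close> has such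
  a function \<open>w\<close> too, and \<open>u = - v\<close> on \<open>E\<close>, \<open>u = w\<close> outside \<open>E\<close> has the required property
  (\<open>variational_curvature\<close>).

  Nonnegativity, complements and semicontinuity are immediate from the definition of \<open>P\<close> as a supremum.
  Submodularity is the analytic part. Consider first the supremum \<open>J A\<close> over all fields of norm at
  most one, without the integral constraint. Given test fields \<open>\<phi>\<^sub>1\<close> for \<open>A \<union> B\<close> and \<open>\<phi>\<^sub>2\<close> for \<open>A \<inter> B\<close>,
  one tests \<open>A\<close> with a field that equals \<open>\<phi>\<^sub>1\<close> where the indicator of \<open>A\<close> is the larger of the two and
  \<open>\<phi>\<^sub>2\<close> where it is the smaller, and \<open>B\<close> with the opposite choice. To make this a \<open>C\<^sup>1\<close> field, the
  indicators are mollified and the switch is a smooth sign of their difference; convex combinations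
  of fields remain admissible, and the error made by the smooth sign is a divergence plus a small
  term of order zero (\<open>switched_field\<close>). Mollification hardly increases \<open>J\<close>, since the first order part of the
  operator commutes with translations and the potential is uniformly continuous on compact sets
  (\<open>mollified_bound\<close>). Besides submodularity of \<open>J\<close> (\<open>field_submodular\<close>) the same construction gives
  \<open>J (A - B) + J (B - A) \<le> J A + J B\<close> (\<open>field_posimodular\<close>).

  Finally \<open>P A\<close> is \<open>J A\<close> or \<open>J (- A)\<close>. For a constrained field the fluxes through \<open>A\<close> and \<open>- A\<close> are opposite,
  so \<open>P\<close> is bounded by both. If \<open>\<alpha> = 1\<close>, the potential vanishes, every field satisfies the constraint, and
  \<open>P = J\<close>. If \<open>\<alpha> > 1\<close> and \<open>- A\<close> has infinite measure, then the defect of a field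
  in the constraint can be repaired by a tiny multiple of a field that lives almost entirely in \<open>- A\<close>
  and has a huge integral against the potential (\<open>large_drift_field\<close>); hence \<open>P A = J A\<close>. One of \<open>A\<close>, \<open>- A\<close> has
  infinite measure, and the four resulting combinations for two sets are covered by the two inequalities for \<open>J\<close>
  (\<open>restricted_flux_submodular\<close>).
\<close>

section \<open>Integrable curvatures for submodular set functions\<close>

text \<open>
  \<open>\<D>\<close> stands for the sets of finite perimeter, and \<open>h\<close> is the density of the finite measure that
  penalizes deviation from a given set. Semicontinuity is stated for upper bounds \<open>c n\<close> instead of
  a lower limit, so that it also yields membership of the limit in \<open>\<D>\<close>.
\<close>

locale submodular_perimeter =
  fixes M :: "'a measure" and \<D> :: "'a set set" and P :: "'a set \<Rightarrow> real"
    and h :: "'a \<Rightarrow> real"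
  assumes sets_\<D>: "A \<in> \<D> \<Longrightarrow> A \<in> sets M"
    and empty_\<D>: "{} \<in> \<D>"
    and P_nonneg: "A \<in> \<D> \<Longrightarrow> 0 \<le> P A"
    and Un_\<D>: "A \<in> \<D> \<Longrightarrow> B \<in> \<D> \<Longrightarrow> A \<union> B \<in> \<D>"
    and Int_\<D>: "A \<in> \<D> \<Longrightarrow> B \<in> \<D> \<Longrightarrow> A \<inter> B \<in> \<D>"
    and submodular: "A \<in> \<D> \<Longrightarrow> B \<in> \<D> \<Longrightarrow> P (A \<union> B) + P (A \<inter> B) \<le> P A + P B"
    and Compl_\<D>: "A \<in> \<D> \<Longrightarrow> space M - A \<in> \<D>"
    and P_Compl: "A \<in> \<D> \<Longrightarrow> P (space M - A) = P A"
    and P_lsc: "(\<And>n::nat. S n \<in> \<D>) \<Longrightarrow> B \<in> sets M \<Longrightarrow>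
        (AE x in M. (\<lambda>n. indicat_real (S n) x) \<longlonglongrightarrow> indicat_real B x) \<Longrightarrow>
        (\<And>n. P (S n) \<le> c n) \<Longrightarrow> c \<longlonglongrightarrow> l \<Longrightarrow> B \<in> \<D> \<and> P B \<le> l"
    and h_pos: "0 < h x"
    and h_integrable: "integrable M h"
begin

definition mass :: "'a set \<Rightarrow> real" where
  "mass A = (LINT x:A|M. h x)"

lemma mass_integrable: "A \<in> sets M \<Longrightarrow> set_integrable M A h"
  unfolding set_integrable_def by (rule integrable_mult_indicator[OF _ h_integrable])

lemma mass_Un_disjoint: "A \<in> sets M \<Longrightarrow> B \<in> sets M \<Longrightarrow> A \<inter> B = {} \<Longrightarrow> mass (A \<union> B) = mass A + mass B"
  unfolding mass_def by (intro set_integral_Un mass_integrable)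

lemma mass_nonneg: "0 \<le> mass A"
  unfolding mass_def set_lebesgue_integral_def
  by (intro integral_nonneg_AE) (auto simp: indicator_def less_imp_le[OF h_pos])

lemma mass_split: "A \<in> sets M \<Longrightarrow> B \<in> sets M \<Longrightarrow> mass A = mass (A \<inter> B) + mass (A - B)"
  using mass_Un_disjoint[of "A \<inter> B" "A - B"] by (simp add: Int_Diff_Un Diff_Int_distrib Int_Diff)

lemma mass_mono: "A \<in> sets M \<Longrightarrow> B \<in> sets M \<Longrightarrow> A \<subseteq> B \<Longrightarrow> mass A \<le> mass B"
  using mass_split[of B A] mass_nonneg[of "B - A"] by (simp add: Int_absorb1)

lemma mass_tendsto:
  assumes "\<And>n::nat. A n \<in> sets M" "B \<in> sets M"
    and "AE x in M. (\<lambda>n. indicat_real (A n) x) \<longlonglongrightarrow> indicat_real B x"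
  shows "(\<lambda>n. mass (A n)) \<longlonglongrightarrow> mass B"
  unfolding mass_def set_lebesgue_integral_def
proof (rule integral_dominated_convergence[where w=h])
  show "AE x in M. (\<lambda>i. indicat_real (A i) x *\<^sub>R h x) \<longlonglongrightarrow> indicat_real B x *\<^sub>R h x"
    using assms(3) by eventually_elim (auto intro: tendsto_intros)
  show "AE x in M. norm (indicat_real (A i) x *\<^sub>R h x) \<le> h x" for i
    by (auto simp: indicator_def less_imp_le[OF h_pos])
  have [measurable]: "h \<in> borel_measurable M" using h_integrable by auto
  note [measurable] = assms(1,2)
  show "(\<lambda>x. indicat_real B x *\<^sub>R h x) \<in> borel_measurable M" by measurable
  show "\<And>i. (\<lambda>x. indicat_real (A i) x *\<^sub>R h x) \<in> borel_measurable M" by measurable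
qed (rule h_integrable)

definition penalized :: "real \<Rightarrow> 'a set \<Rightarrow> 'a set \<Rightarrow> real" where
  "penalized l E G = P G + l * mass (E - G)"

definition is_minimizer :: "real \<Rightarrow> 'a set \<Rightarrow> 'a set \<Rightarrow> bool" where
  "is_minimizer l E F \<longleftrightarrow> F \<in> \<D> \<and> F \<subseteq> E \<and>
     (\<forall>G\<in>\<D>. G \<subseteq> E \<longrightarrow> penalized l E F \<le> penalized l E G)"

text \<open>
  The penalty \<open>G \<mapsto> mass (E - G)\<close> is modular, so it does not disturb the submodularity of \<open>P\<close>.
\<close>

lemma penalized_submodular:
  assumes "E \<in> \<D>" "A \<in> \<D>" "B \<in> \<D>" "A \<subseteq> E" "B \<subseteq> E"
  shows "penalized l E (A \<union> B) + penalized l E (A \<inter> B) \<le> penalized l E A + penalized l E B"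
proof -
  note s = sets_\<D>[OF assms(1)] sets_\<D>[OF assms(2)] sets_\<D>[OF assms(3)]
  have "E - A \<inter> B = (E - A) \<union> (A - B)" "E - B = (E - (A \<union> B)) \<union> (A - B)"
    using assms(4,5) by auto
  moreover have "mass ((E - A) \<union> (A - B)) = mass (E - A) + mass (A - B)"
    by (rule mass_Un_disjoint) (use s in auto)
  moreover have "mass ((E - (A \<union> B)) \<union> (A - B)) = mass (E - (A \<union> B)) + mass (A - B)"
    by (rule mass_Un_disjoint) (use s in auto)
  ultimately have "l * mass (E - (A \<union> B)) + l * mass (E - A \<inter> B) = l * mass (E - A) + l * mass (E - B)"
    by (simp add: algebra_simps)
  with submodular[OF assms(2,3)] show ?thesis
    by (simp add: penalized_def)
qed

lemma penalized_lsc: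
  assumes E: "E \<in> \<D>" and A: "\<And>n::nat. A n \<in> \<D>" and B: "B \<in> sets M"
    and lim: "\<And>x. (\<lambda>n. indicat_real (A n) x) \<longlonglongrightarrow> indicat_real B x"
    and le: "\<And>n. penalized l E (A n) \<le> c n" and c: "c \<longlonglongrightarrow> b"
  shows "B \<in> \<D>" "penalized l E B \<le> b"
proof -
  have "(\<lambda>n. mass (E - A n)) \<longlonglongrightarrow> mass (E - B)"
  proof (rule mass_tendsto)
    have eq: "indicat_real (E - C) x = indicat_real E x - indicat_real E x * indicat_real C x" for C x
      by (auto simp: indicator_def)
    show "AE x in M. (\<lambda>n. indicat_real (E - A n) x) \<longlonglongrightarrow> indicat_real (E - B) x"
      unfolding eq by (intro AE_I2 tendsto_intros lim)
  qed (use E A B sets_\<D> in auto)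
  then have "(\<lambda>n. c n - l * mass (E - A n)) \<longlonglongrightarrow> b - l * mass (E - B)"
    by (intro tendsto_intros c)
  moreover have "P (A n) \<le> c n - l * mass (E - A n)" for n
    using le[of n] by (simp add: penalized_def)
  ultimately have "B \<in> \<D> \<and> P B \<le> b - l * mass (E - B)"
    by (intro P_lsc[OF A B _ _ _]) (use lim in auto)
  then show "B \<in> \<D>" "penalized l E B \<le> b" by (auto simp: penalized_def)
qed

text \<open>
  Choose \<open>G n\<close> whose value exceeds the infimum \<open>I\<close> by at most \<open>(1/2)^n\<close>. As intersections have value
  at least \<open>I\<close>, submodularity shows that the excess of a union is at most the sum of the excesses.
  Hence the tail unions \<open>W m\<close> have excess at most \<open>2 * (1/2)^m\<close>, and their decreasing limit has none.
\<close>

lemma minimizer_exists: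
  assumes E: "E \<in> \<D>" and l: "0 \<le> l"
  shows "\<exists>F. is_minimizer l E F"
proof -
  define S where "S = {G \<in> \<D>. G \<subseteq> E}"
  define I where "I = (INF G\<in>S. penalized l E G)"
  have bdd: "bdd_below (penalized l E ` S)"
    by (rule bdd_belowI[of _ 0]) (auto simp: S_def penalized_def l P_nonneg mass_nonneg)
  have I_le: "I \<le> penalized l E G" if "G \<in> S" for G
    unfolding I_def by (rule cINF_lower[OF bdd that])
  have S: "S \<noteq> {}" using empty_\<D> by (auto simp: S_def)
  have "\<exists>G\<in>S. penalized l E G < I + (1/2)^n" for n
    using cINF_less_iff[OF S bdd, of "I + (1/2)^n"] by (simp add: I_def)
  then obtain G where G: "G n \<in> S" "penalized l E (G n) < I + (1/2)^n" for n
    by metis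
  then have G\<D>: "G n \<in> \<D>" "G n \<subseteq> E" for n by (auto simp: S_def)
  define U where "U m k = (\<Union>n\<in>{m..m+k}. G n)" for m k
  have U_Suc: "U m (Suc k) = U m k \<union> G (Suc (m + k))" for m k
    by (auto simp: U_def atLeastAtMostSuc_conv)
  \<comment> \<open>The subtracted power is what makes the geometric sum of the excesses close up under induction.\<close>
  have U: "U m k \<in> S \<and> penalized l E (U m k) \<le> I + 2 * (1/2)^m - (1/2)^(m+k)" for m k
  proof (induction k)
    case 0
    then show ?case using G(1)[of m] G(2)[of m] by (simp add: U_def)
  next
    case (Suc k)
    then have *: "U m k \<in> \<D>" "U m k \<subseteq> E" by (auto simp: S_def)
    then have "U m k \<inter> G (Suc (m + k)) \<in> S"
      using G\<D> by (auto simp: S_def intro: Int_\<D>)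
    from I_le[OF this] penalized_submodular[OF E *(1) G\<D>(1)[of "Suc (m+k)"] *(2) G\<D>(2), of l]
      Suc G(2)[of "Suc (m + k)"]
    have "penalized l E (U m (Suc k)) \<le> I + 2 * (1/2)^m - (1/2)^(m+k) + (1/2)^(Suc (m+k))"
      by (simp add: U_Suc)
    then show ?case using * G\<D> by (auto simp: S_def U_Suc intro: Un_\<D>)
  qed
  define W where "W m = (\<Union>n\<in>{m..}. G n)" for m
  have sets_G: "G n \<in> sets M" for n using G\<D> sets_\<D> by auto
  have sets_W: "W m \<in> sets M" for m
    unfolding W_def using sets_G by auto
  have W: "W m \<in> \<D> \<and> penalized l E (W m) \<le> I + 2 * (1/2)^m" for m
  proof -
    have "incseq (U m)" by (rule incseq_SucI) (simp add: U_Suc)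
    moreover have "(\<Union>k. U m k) = W m"
      unfolding U_def W_def
      by (auto simp: Bex_def) (metis le_add_diff_inverse order_refl)
    ultimately have lim: "(\<lambda>k. indicat_real (U m k) x) \<longlonglongrightarrow> indicat_real (W m) x" for x
      using LIMSEQ_indicator_incseq[of "U m" x] by simp
    have le: "penalized l E (U m k) \<le> I + 2 * (1/2)^m" for k
      using U[of m k] by (smt (verit) zero_le_power divide_nonneg_nonneg)
    show ?thesis
      using penalized_lsc[OF E _ sets_W lim le tendsto_const] U by (auto simp: S_def)
  qed
  have lim: "(\<lambda>m. indicat_real (W m) x) \<longlonglongrightarrow> indicat_real (\<Inter>m. W m) x" for x
  proof (rule LIMSEQ_indicator_decseq)
    show "decseq W" unfolding W_def decseq_def by (intro allI impI UN_mono) auto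
  qed
  have c: "(\<lambda>m. I + 2 * (1/2::real)^m) \<longlonglongrightarrow> I"
    by (rule tendsto_eq_intros LIMSEQ_power_zero refl | simp)+
  have *: "(\<Inter>m. W m) \<in> \<D>" "penalized l E (\<Inter>m. W m) \<le> I"
    by (rule penalized_lsc[OF E _ _ lim _ c]; use W sets_W in auto)+
  have "W 0 \<subseteq> E" unfolding W_def using G\<D>(2) by (intro UN_least)
  then have "(\<Inter>m. W m) \<subseteq> E" by blast
  then show ?thesis
    using * I_le by (force simp: is_minimizer_def S_def)
qed

text \<open>
  Enlarging \<open>F \<inter> H\<close> to \<open>F\<close> does not raise the functional with the smaller parameter \<open>l\<close>, and raising
  the parameter only favours the larger set. Submodularity then turns this into a comparison
  of \<open>F \<union> H\<close> with \<open>H\<close>.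
\<close>

lemma minimizer_Un:
  assumes E: "E \<in> \<D>" and lm: "l \<le> m" and F: "is_minimizer l E F" and H: "is_minimizer m E H"
  shows "is_minimizer m E (F \<union> H)"
proof -
  have F': "F \<in> \<D>" "F \<subseteq> E" and H': "H \<in> \<D>" "H \<subseteq> E"
    using F H by (auto simp: is_minimizer_def)
  have sets: "E \<in> sets M" "F \<in> sets M" "H \<in> sets M" using E F' H' sets_\<D> by auto
  have "penalized l E F \<le> penalized l E (F \<inter> H)"
    using F F' H' Int_\<D>[of F H] by (auto simp: is_minimizer_def)
  moreover have "l * (mass (E - F \<inter> H) - mass (E - F)) \<le> m * (mass (E - F \<inter> H) - mass (E - F))"
    by (intro mult_right_mono lm) (use mass_mono[of "E - F" "E - F \<inter> H"] sets in auto)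
  ultimately have "penalized m E F \<le> penalized m E (F \<inter> H)"
    by (simp add: penalized_def algebra_simps)
  then have "penalized m E (F \<union> H) \<le> penalized m E H"
    using penalized_submodular[OF E F'(1) H'(1) F'(2) H'(2), of m] by simp
  then show ?thesis
    using H F' H' by (force simp: is_minimizer_def intro: Un_\<D>)
qed

lemma minimizer_chain:
  assumes E: "E \<in> \<D>"
  shows "\<exists>F :: nat \<Rightarrow> 'a set. (\<forall>n. is_minimizer (2^n) E (F n)) \<and> incseq F"
proof -
  have "\<exists>F. \<forall>n. is_minimizer (2^n) E (F n) \<and> F n \<subseteq> F (Suc n)"
  proof (rule dependent_nat_choice)
    show "\<exists>F. is_minimizer (2^0) E F" by (rule minimizer_exists[OF E]) simp
  next
    fix F n assume F: "is_minimizer (2^n) E F"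
    obtain H where H: "is_minimizer (2^Suc n) E H" using minimizer_exists[OF E, of "2^Suc n"] by auto
    have "is_minimizer (2^Suc n) E (F \<union> H)"
      by (rule minimizer_Un[OF E _ F H]) simp
    then show "\<exists>H. is_minimizer (2^Suc n) E H \<and> F \<subseteq> H" by blast
  qed
  then show ?thesis by (metis incseq_SucI)
qed

text \<open>
  The function \<open>v\<close> is \<open>2^n * h\<close> on the shell \<open>D n\<close> between consecutive minimizers. Testing the
  minimality of \<open>F n\<close> with \<open>F (Suc n)\<close> bounds the integral of \<open>v\<close> over a shell by twice an increment
  of \<open>P\<close> along the chain; this is the reason why the parameters grow geometrically and no faster.
\<close>

lemma inner_curvature:
  assumes E: "E \<in> \<D>"
  shows "\<exists>v. integrable M v \<and> (\<forall>G\<in>\<D>. G \<subseteq> E \<longrightarrow> P E \<le> P G + (LINT x:(E - G)|M. v x))"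
proof -
  obtain F where min: "is_minimizer (2^n) E (F n)" and inc: "incseq F" for n
    using minimizer_chain[OF E] by auto
  have F: "F n \<in> \<D>" "F n \<subseteq> E" for n using min by (auto simp: is_minimizer_def)
  note setsE [measurable] = sets_\<D>[OF E]
  have sF [measurable]: "F n \<in> sets M" for n using F sets_\<D> by auto
  have hm [measurable]: "h \<in> borel_measurable M" using h_integrable by auto
  define D where "D n = (case n of 0 \<Rightarrow> F 0 | Suc k \<Rightarrow> F (Suc k) - F k)" for n
  have sD [measurable]: "D n \<in> sets M" for n by (cases n) (auto simp: D_def)
  have DF: "x \<in> D n \<longleftrightarrow> x \<in> F n \<and> (\<forall>k<n. x \<notin> F k)" for x n
    by (cases n) (use incseqD[OF inc] in \<open>auto simp: D_def less_Suc_eq_le\<close>)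
  have compare: "P (F n) + 2^n * mass (E - F n) \<le> P G + 2^n * mass (E - G)"
    if "G \<in> \<D>" "G \<subseteq> E" for G n
    using min that by (auto simp: is_minimizer_def penalized_def)
  have PFE: "P (F n) + 2^n * mass (E - F n) \<le> P E" for n
    using compare[OF E order_refl, of n] by (simp add: mass_def set_lebesgue_integral_def)
  have step: "2 ^ n * mass (D (Suc n)) \<le> P (F (Suc n)) - P (F n)" for n
  proof -
    have "E - F n = D (Suc n) \<union> (E - F (Suc n))"
      using F incseq_SucD[OF inc, of n] by (auto simp: D_def)
    then have "mass (E - F n) = mass (D (Suc n)) + mass (E - F (Suc n))"
      by (simp add: mass_Un_disjoint D_def Diff_Int_distrib2 disjoint_iff)
    then show ?thesis using compare[OF F, of n "Suc n"] by (simp add: algebra_simps)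
  qed
  have partial: "(\<Sum>n<N. 2^(Suc n) * mass (D (Suc n))) \<le> 2 * P E" for N
  proof -
    have "(\<Sum>n<N. 2^(Suc n) * mass (D (Suc n))) \<le> (\<Sum>n<N. 2 * (P (F (Suc n)) - P (F n)))"
    proof (rule sum_mono)
      show "2^(Suc n) * mass (D (Suc n)) \<le> 2 * (P (F (Suc n)) - P (F n))" for n
        using step[of n] by simp
    qed
    also have "\<dots> = 2 * (P (F N) - P (F 0))"
      using sum_lessThan_telescope[of "\<lambda>n. 2 * P (F n)" N] by (simp add: right_diff_distrib)
    also have "\<dots> \<le> 2 * P E"
      using PFE[of N] P_nonneg[OF F(1), of 0] mass_nonneg[of "E - F N"]
      by (smt (verit) mult_nonneg_nonneg zero_le_power)
    finally show ?thesis .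
  qed
  have summ: "summable (\<lambda>n. 2^n * mass (D n))"
    unfolding summable_Suc_iff[of "\<lambda>n. 2^n * mass (D n)", symmetric]
    by (rule bounded_imp_summable[of _ "2 * P E"])
      (use partial in \<open>auto simp: mass_nonneg lessThan_Suc_atMost[symmetric] simp del: sum.lessThan_Suc\<close>)
  define v0 where "v0 n x = indicat_real (D n) x * (2^n * h x)" for n x
  define v where "v x = (\<Sum>n. v0 n x)" for x
  have v0_int: "integrable M (v0 n)" for n
    unfolding v0_def using integrable_mult_indicator[OF sD, of "\<lambda>x. 2^n * h x" n] h_integrable by simp
  have v0_nonneg: "0 \<le> v0 n x" for n x by (auto simp: v0_def less_imp_le[OF h_pos])
  have int_v0: "integral\<^sup>L M (v0 n) = 2^n * mass (D n)" for n
    unfolding v0_def mass_def set_lebesgue_integral_def integral_mult_right_zero[symmetric]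
    by (intro Bochner_Integration.integral_cong) auto
  have v0_fin: "\<exists>N. \<forall>n. n \<noteq> N \<longrightarrow> v0 n x = 0" for x
  proof (cases "\<exists>n. x \<in> D n")
    case True
    then obtain N where "x \<in> D N" by auto
    then have "\<forall>n. n \<noteq> N \<longrightarrow> x \<notin> D n" by (auto simp: DF) (meson linorder_neqE_nat)
    then show ?thesis by (intro exI[of _ N]) (simp add: v0_def)
  qed (auto simp: v0_def)
  have v0_summ: "summable (\<lambda>n. v0 n x)" for x
  proof -
    obtain N where "\<forall>n. n \<noteq> N \<longrightarrow> v0 n x = 0" using v0_fin by blast
    then show ?thesis by (intro summable_finite[of "{N}"]) auto
  qed
  have v_int: "integrable M v"
    unfolding v_def
  proof (rule integrable_suminf)
    show "AE x in M. summable (\<lambda>n. norm (v0 n x))" using v0_summ v0_nonneg by simp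
    show "summable (\<lambda>n. LINT x|M. norm (v0 n x))" using v0_nonneg by (simp add: int_v0 summ)
  qed (rule v0_int)
  have E_null: "AE x in M. x \<in> E \<longrightarrow> x \<in> (\<Union>n. F n)"
  proof -
    let ?N = "E - (\<Union>n. F n)"
    have "mass ?N \<le> P E * (1/2)^n" for n
    proof -
      have "mass ?N \<le> mass (E - F n)" by (rule mass_mono) auto
      also have "2^n * mass (E - F n) \<le> P E" using PFE[of n] P_nonneg[OF F(1), of n] by simp
      then have "mass (E - F n) \<le> P E * (1/2)^n" by (simp add: field_simps power_one_over)
      finally show ?thesis .
    qed
    moreover have "(\<lambda>n. P E * (1/2)^n) \<longlonglongrightarrow> P E * 0"
      by (intro tendsto_intros LIMSEQ_power_zero) simp
    ultimately have "mass ?N \<le> 0" by (intro LIMSEQ_le_const) auto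
    then have "mass ?N = 0" using mass_nonneg[of ?N] by simp
    then have "AE x in M. indicat_real ?N x *\<^sub>R h x = 0"
      unfolding mass_def set_lebesgue_integral_def
      by (subst (asm) integral_nonneg_eq_0_iff_AE)
        (use integrable_mult_indicator[OF _ h_integrable, of ?N] in \<open>auto simp: less_imp_le[OF h_pos]\<close>)
    then show ?thesis
      by eventually_elim (use h_pos in \<open>auto simp: indicator_def less_le split: if_splits\<close>)
  qed
  have main: "P E \<le> P G + (LINT x:(E - G)|M. v x)" if G: "G \<in> \<D>" "G \<subseteq> E" for G
  proof -
    note sG [measurable] = sets_\<D>[OF G(1)]
    have GF: "G \<union> F n \<in> \<D>" for n using G F by (auto intro: Un_\<D>)
    \<comment> \<open>Adding a minimizer to a subset of \<open>E\<close> raises the perimeter by at most the penalty of the new points.\<close>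
    have exchange: "P (A \<union> F n) \<le> P A + 2^n * mass (F n - A)" if A: "A \<in> \<D>" "A \<subseteq> E" for A n
    proof -
      have [measurable]: "A \<in> sets M" using sets_\<D> A by auto
      have "mass (E - A \<inter> F n) = mass (E - F n) + mass (F n - A)"
        using F(2)[of n] A(2) by (subst mass_Un_disjoint[symmetric]) (auto intro!: arg_cong[of _ _ mass])
      then have "P (F n) \<le> P (A \<inter> F n) + 2^n * mass (F n - A)"
        using compare[of "A \<inter> F n" n] A F by (auto simp: algebra_simps intro: Int_\<D>)
      then show ?thesis using submodular[OF A(1) F(1)[of n]] by simp
    qed
    have ind: "P (G \<union> F n) \<le> P G + (\<Sum>i\<le>n. 2^i * mass (D i - G))" for n
    proof (induction n)
      case 0
      then show ?case using exchange[OF G, of 0] by (simp add: D_def)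
    next
      case (Suc n)
      have "G \<union> F n \<union> F (Suc n) = G \<union> F (Suc n)" "F (Suc n) - (G \<union> F n) = D (Suc n) - G"
        using incseq_SucD[OF inc, of n] by (auto simp: D_def)
      then show ?case using exchange[OF GF, of n "Suc n"] F(2)[of n] G(2) Suc by simp
    qed
    have vG: "set_integrable M (E - G) v"
      unfolding set_integrable_def by (rule integrable_mult_indicator[OF _ v_int]) auto
    have sum_le: "(\<Sum>i\<le>n. 2^i * mass (D i - G)) \<le> (LINT x:(E - G)|M. v x)" for n
    proof -
      have eq: "2^i * mass (D i - G) = (LINT x|M. indicat_real (E - G) x *\<^sub>R v0 i x)" for i
        unfolding mass_def set_lebesgue_integral_def integral_mult_right_zero[symmetric]
        using F(2)[of i]
        by (intro Bochner_Integration.integral_cong) (auto simp: v0_def indicator_def DF)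
      have "(\<Sum>i\<le>n. 2^i * mass (D i - G)) = (LINT x|M. (\<Sum>i\<le>n. indicat_real (E - G) x *\<^sub>R v0 i x))"
        unfolding eq
        by (intro Bochner_Integration.integral_sum[symmetric] integrable_mult_indicator v0_int) measurable
      also have "\<dots> \<le> (LINT x|M. indicat_real (E - G) x *\<^sub>R v x)"
      proof (rule integral_mono)
        show "integrable M (\<lambda>x. \<Sum>i\<le>n. indicat_real (E - G) x *\<^sub>R v0 i x)"
          by (intro Bochner_Integration.integrable_sum integrable_mult_indicator v0_int) measurable
        show "integrable M (\<lambda>x. indicat_real (E - G) x *\<^sub>R v x)"
          using vG by (simp add: set_integrable_def)
        show "(\<Sum>i\<le>n. indicat_real (E - G) x *\<^sub>R v0 i x) \<le> indicat_real (E - G) x *\<^sub>R v x" for x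
          unfolding scaleR_sum_right[symmetric] v_def
          by (intro scaleR_left_mono sum_le_suminf v0_summ) (auto simp: v0_nonneg)
      qed
      finally show ?thesis by (simp add: set_lebesgue_integral_def)
    qed
    have lim: "AE x in M. (\<lambda>n. indicat_real (G \<union> F n) x) \<longlonglongrightarrow> indicat_real E x"
      using E_null
    proof eventually_elim
      case (elim x)
      have "(\<lambda>n. indicat_real (G \<union> F n) x) \<longlonglongrightarrow> indicat_real (\<Union>n. G \<union> F n) x"
        by (rule LIMSEQ_indicator_incseq) (use incseqD[OF inc] in \<open>auto simp: incseq_def\<close>)
      moreover have "indicat_real (\<Union>n. G \<union> F n) x = indicat_real E x"
        using elim G(2) F(2) by (auto simp: indicator_def)
      ultimately show ?case by simp
    qed
    have "P (G \<union> F n) \<le> P G + (LINT x:(E - G)|M. v x)" for n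
      using ind[of n] sum_le[of n] by linarith
    from P_lsc[OF GF setsE lim this tendsto_const] show ?thesis by simp
  qed
  show ?thesis using v_int main by blast
qed

text \<open>
  The inequality for a general \<open>F\<close> is the sum of the inner inequality of \<open>E\<close> at \<open>E \<inter> F\<close> and that
  of the complement at the complement of \<open>E \<union> F\<close>, combined by submodularity.
\<close>

lemma variational_curvature:
  assumes E: "E \<in> \<D>"
  shows "\<exists>u. integrable M u \<and> (\<forall>F\<in>\<D>. P E + (LINT x:E|M. u x) \<le> P F + (LINT x:F|M. u x))"
proof -
  let ?C = "space M - E"
  obtain v where v: "integrable M v" "\<And>G. G \<in> \<D> \<Longrightarrow> G \<subseteq> E \<Longrightarrow> P E \<le> P G + (LINT x:(E - G)|M. v x)"
    using inner_curvature[OF E] by auto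
  obtain w where w: "integrable M w"
    "\<And>G. G \<in> \<D> \<Longrightarrow> G \<subseteq> ?C \<Longrightarrow> P ?C \<le> P G + (LINT x:(?C - G)|M. w x)"
    using inner_curvature[OF Compl_\<D>[OF E]] by auto
  note [measurable] = sets_\<D>[OF E]
  have [measurable]: "v \<in> borel_measurable M" "w \<in> borel_measurable M" using v w by auto
  define u where "u x = indicat_real ?C x * w x - indicat_real E x * v x" for x
  have u: "integrable M u"
    unfolding u_def using integrable_mult_indicator[of ?C M w] integrable_mult_indicator[of E M v] v w
    by (intro Bochner_Integration.integrable_diff) auto
  have "P E + (LINT x:E|M. u x) \<le> P F + (LINT x:F|M. u x)" if F: "F \<in> \<D>" for F
  proof -
    note [measurable] = sets_\<D>[OF F]
    have si: "set_integrable M A f" if "A \<in> sets M" "integrable M f" for A and f :: "'a \<Rightarrow> real"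
      unfolding set_integrable_def by (rule integrable_mult_indicator[OF that])
    have "(LINT x:F|M. u x) = (LINT x:F\<inter>E|M. u x) + (LINT x:F-E|M. u x)"
      using set_integral_Un[of "F \<inter> E" "F - E" M u] si[OF _ u] by (simp add: Int_Diff_Un disjoint_iff)
    moreover have "(LINT x:E|M. u x) = (LINT x:F\<inter>E|M. u x) + (LINT x:E-F|M. u x)"
      using set_integral_Un[of "E \<inter> F" "E - F" M u] si[OF _ u] by (simp add: Int_Diff_Un Int_commute disjoint_iff)
    moreover have "(LINT x:E-F|M. u x) = - (LINT x:E-F|M. v x)"
      unfolding set_lebesgue_integral_def Bochner_Integration.integral_minus[symmetric]
      by (intro Bochner_Integration.integral_cong) (auto simp: u_def indicator_def)
    moreover have "(LINT x:F-E|M. u x) = (LINT x:F-E|M. w x)"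
      unfolding set_lebesgue_integral_def
      by (intro Bochner_Integration.integral_cong) (auto simp: u_def indicator_def)
    moreover have "P E \<le> P (E \<inter> F) + (LINT x:E-F|M. v x)"
      using v(2)[OF Int_\<D>[OF E F]] by (simp add: Diff_Int)
    moreover have "P E \<le> P (E \<union> F) + (LINT x:F-E|M. w x)"
    proof -
      have "?C - (space M - (E \<union> F)) = F - E" using sets.sets_into_space[OF sets_\<D>[OF F]] by auto
      then show ?thesis
        using w(2)[OF Compl_\<D>[OF Un_\<D>[OF E F]]] P_Compl[OF E] P_Compl[OF Un_\<D>[OF E F]] by auto
    qed
    ultimately show ?thesis using submodular[OF E F] by linarith
  qed
  then show ?thesis using u by blast
qed

end

section \<open>Compactly supported functions\<close>

lemma integrable_continuous_compact_support:
  fixes g :: "'a::euclidean_space \<Rightarrow> 'b::{banach, second_countable_topology}"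
  assumes "continuous_on UNIV g" "\<And>x. R < norm x \<Longrightarrow> g x = 0"
  shows "integrable lborel g"
proof -
  have "integrable lborel (\<lambda>x. indicator (cball 0 R) x *\<^sub>R g x)"
    by (rule borel_integrable_compact) (auto intro: continuous_on_subset[OF assms(1)])
  moreover have "(\<lambda>x. indicator (cball 0 R) x *\<^sub>R g x) = g"
    using assms(2) by (force simp: indicator_def)
  ultimately show ?thesis by simp
qed

lemma bounded_continuous_compact_support:
  fixes g :: "'a::euclidean_space \<Rightarrow> 'b::real_normed_vector"
  assumes "continuous_on UNIV g" "\<And>x. R < norm x \<Longrightarrow> g x = 0"
  shows "\<exists>B>0. \<forall>x. norm (g x) \<le> B"
proof -
  have "bounded (g ` cball 0 R)"
    by (intro compact_imp_bounded compact_continuous_image) (auto intro: continuous_on_subset[OF assms(1)])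
  then obtain B where "\<forall>y\<in>g ` cball 0 R. norm y \<le> B" unfolding bounded_iff by blast
  then have B: "\<And>x. norm x \<le> R \<Longrightarrow> norm (g x) \<le> B" by simp
  have "norm (g x) \<le> max B 1" for x
    by (cases "norm x \<le> R") (use B[of x] assms(2)[of x] in auto)
  then show ?thesis by (intro exI[of _ "max B 1"]) auto
qed

lemma integrable_indicator_cball: "integrable lborel (indicat_real (cball (0::'a::euclidean_space) r))"
  by (intro integrable_real_indicator emeasure_lborel_cball_finite) simp

lemma integral_lborel_shift:
  fixes f :: "'a::euclidean_space \<Rightarrow> 'b::{banach, second_countable_topology}"
  assumes [measurable]: "f \<in> borel_measurable borel"
  shows "(LINT x|lborel. f (x + z)) = (LINT x|lborel. f x)"
proof -
  have "(LINT x|distr lborel borel ((+) z). f x) = (LINT x|lborel. f (z + x))"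
    by (rule integral_distr) auto
  then show ?thesis by (simp add: lborel_distr_plus add.commute)
qed

lemma lborel_distr_reflect: "distr lborel borel uminus = (lborel :: 'a::euclidean_space measure)"
  by (subst (2) lborel_affine[of "-1" "0::'a"]) (auto simp: density_1 one_ennreal_def[symmetric])

lemma integral_lborel_reflect:
  fixes f :: "'a::euclidean_space \<Rightarrow> 'b::{banach, second_countable_topology}"
  assumes [measurable]: "f \<in> borel_measurable borel"
  shows "(LINT x|lborel. f (z - x)) = (LINT x|lborel. f x)"
proof -
  have "(LINT x|distr lborel borel uminus. f (x + z)) = (LINT x|lborel. f (- x + z))"
    by (rule integral_distr) auto
  then show ?thesis using integral_lborel_shift[of f z] by (simp add: lborel_distr_reflect)
qed

lemma integrable_lborel_shift:
  fixes f :: "'a::euclidean_space \<Rightarrow> 'b::{banach, second_countable_topology}"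
  assumes "integrable lborel f"
  shows "integrable lborel (\<lambda>x. f (x + z))"
proof -
  have "integrable (distr lborel borel ((+) z)) f" using assms by (simp add: lborel_distr_plus)
  then have "integrable lborel (\<lambda>x. f (z + x))"
    by (rule integrable_distr[rotated]) auto
  then show ?thesis by (simp add: add.commute)
qed

lemma derivative_zero_outside:
  fixes f :: "'a::real_normed_vector \<Rightarrow> 'b::real_normed_vector"
  assumes "(f has_derivative D) (at x)" "R < norm x" "\<And>y. R < norm y \<Longrightarrow> f y = 0"
  shows "D v = 0"
proof -
  have "open {y::'a. R < norm y}" by (intro open_Collect_less continuous_intros)
  moreover have "((\<lambda>_. 0) has_derivative (\<lambda>_. 0)) (at x)" by (rule has_derivative_const)
  ultimately have "(f has_derivative (\<lambda>_. 0)) (at x)"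
    by - (rule has_derivative_transform_within_open[of "\<lambda>_. 0" _ x UNIV], use assms(2,3) in auto)
  from has_derivative_unique[OF assms(1) this] show ?thesis by (simp add: fun_eq_iff)
qed

lemma has_real_derivative_along_line:
  fixes f :: "'a::real_normed_vector \<Rightarrow> real"
  assumes "(f has_derivative D) (at (x + t *\<^sub>R v))"
  shows "((\<lambda>s. f (x + s *\<^sub>R v)) has_real_derivative D v) (at t)"
proof -
  have "((\<lambda>s. x + s *\<^sub>R v) has_derivative (\<lambda>s. s *\<^sub>R v)) (at t)"
    by (auto intro!: derivative_eq_intros)
  then have "((\<lambda>s. f (x + s *\<^sub>R v)) has_derivative (\<lambda>s. D (s *\<^sub>R v))) (at t)"
    by (rule has_derivative_compose[of _ _ t UNIV, simplified]) (rule assms)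
  moreover have "(\<lambda>s. D (s *\<^sub>R v)) = (*) (D v)"
    using linear_cmul[OF has_derivative_linear[OF assms]] by (auto simp: mult.commute)
  ultimately show ?thesis by (simp add: has_field_derivative_def)
qed

text \<open>
  Difference quotients in direction \<open>v\<close> have integral zero by translation invariance, and they
  converge to the derivative boundedly on a fixed ball.
\<close>

lemma integral_derivative_zero:
  fixes f :: "'a::euclidean_space \<Rightarrow> real"
  assumes der: "\<And>x. (f has_derivative D x) (at x)"
    and cont: "continuous_on UNIV (\<lambda>x. D x v)"
    and supp: "\<And>x. R < norm x \<Longrightarrow> f x = 0"
  shows "(LINT x|lborel. D x v) = 0"
proof -
  have contf: "continuous_on UNIV f"
    by (intro continuous_at_imp_continuous_on ballI has_derivative_continuous[OF der])
  have f_int: "integrable lborel f" by (rule integrable_continuous_compact_support[OF contf supp])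
  have [measurable]: "f \<in> borel_measurable borel" using contf by (rule borel_measurable_continuous_onI)
  have suppD: "D x v = 0" if "R < norm x" for x
    by (rule derivative_zero_outside[OF der that supp])
  obtain B where B: "B > 0" "\<And>x. norm (D x v) \<le> B"
    using bounded_continuous_compact_support[OF cont suppD] by auto
  define q where "q n x = (f (x + (1 / Suc n) *\<^sub>R v) - f x) / (1 / Suc n)" for n :: nat and x
  have shift: "integrable lborel (\<lambda>x. f (x + z))" for z by (rule integrable_lborel_shift[OF f_int])
  have q0: "(LINT x|lborel. q n x) = 0" for n
    unfolding q_def integral_divide_zero
    by (simp add: Bochner_Integration.integral_diff[OF shift f_int] integral_lborel_shift)
  have line: "((\<lambda>s. f (x + s *\<^sub>R v)) has_real_derivative D (x + t *\<^sub>R v) v) (at t)" for x t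
    by (rule has_real_derivative_along_line[OF der])
  have qlim: "(\<lambda>n. q n x) \<longlonglongrightarrow> D x v" for x
  proof -
    have "((\<lambda>h. (f (x + h *\<^sub>R v) - f x) / h) \<longlongrightarrow> D x v) (at 0)"
      using line[of x 0] by (simp add: DERIV_def)
    moreover have "filterlim (\<lambda>n. 1 / real (Suc n)) (at 0) sequentially"
      unfolding filterlim_at using LIMSEQ_inverse_real_of_nat by (simp add: inverse_eq_divide)
    ultimately show ?thesis unfolding q_def by (rule filterlim_compose)
  qed
  have qbound: "norm (q n x) \<le> B * indicat_real (cball 0 (R + norm v)) x" for n x
  proof (cases "norm x \<le> R + norm v")
    case True
    have "\<exists>s. 0 < s \<and> s < 1 / Suc n \<and>
       f (x + (1 / Suc n) *\<^sub>R v) - f (x + 0 *\<^sub>R v) = (1 / Suc n - 0) * D (x + s *\<^sub>R v) v"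
    proof (rule MVT2)
      show "DERIV (\<lambda>s. f (x + s *\<^sub>R v)) s :> D (x + s *\<^sub>R v) v" for s by (rule line)
      show "0 < 1 / real (Suc n)" by simp
    qed
    then obtain s where "f (x + (1 / Suc n) *\<^sub>R v) - f x = (1 / Suc n) * D (x + s *\<^sub>R v) v" by auto
    then have "q n x = D (x + s *\<^sub>R v) v" by (simp add: q_def)
    then show ?thesis using B(2) True by simp
  next
    case False
    have "norm ((1 / Suc n) *\<^sub>R v) \<le> norm v"
      using mult_left_le_one_le[of "norm v" "1 / Suc n"] by simp
    then have "R < norm (x + (1 / Suc n) *\<^sub>R v)"
      using False norm_triangle_ineq4[of "x + (1 / Suc n) *\<^sub>R v" "(1 / Suc n) *\<^sub>R v"]
      by (simp only: add_diff_cancel_right')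
    moreover have "R < norm x" using False norm_ge_zero[of v] by linarith
    ultimately have "R < norm (x + (1 / Suc n) *\<^sub>R v)" "R < norm x" by auto
    then show ?thesis using supp B(1) by (simp add: q_def)
  qed
  have "(\<lambda>n. LINT x|lborel. q n x) \<longlonglongrightarrow> (LINT x|lborel. D x v)"
  proof (rule integral_dominated_convergence)
    show "integrable lborel (\<lambda>x. B * indicat_real (cball 0 (R + norm v)) x)"
      by (intro integrable_mult_right integrable_indicator_cball)
    show "(\<lambda>x. D x v) \<in> borel_measurable lborel" using cont by (simp add: borel_measurable_continuous_onI)
    show "\<And>n. q n \<in> borel_measurable lborel" unfolding q_def by measurable
  qed (use qlim qbound in auto)
  then show ?thesis by (simp add: q0 LIMSEQ_const_iff)
qed

text \<open>
  In finite dimension, continuity of the derivative as an operator-valued map reduces to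
  continuity in each direction.
\<close>

lemma C1_compact_supportI:
  fixes \<phi> :: "'a::euclidean_space \<Rightarrow> 'b::euclidean_space"
  assumes der: "\<And>x. (\<phi> has_derivative D x) (at x)"
    and cont: "\<And>v. continuous_on UNIV (\<lambda>x. D x v)"
    and supp: "\<And>x. R < norm x \<Longrightarrow> \<phi> x = 0"
  shows "C1_compact_support \<phi>"
proof -
  have D: "blinfun_apply (Blinfun (D x)) = D x" for x
    by (rule bounded_linear_Blinfun_apply[OF has_derivative_bounded_linear[OF der]])
  have "continuous_on UNIV (\<lambda>x. Blinfun (D x))"
    by (rule continuous_on_blinfun_componentwise) (simp add: D cont)
  moreover have "compact (closure {x. \<phi> x \<noteq> 0})"
    unfolding compact_closure
    by (rule bounded_subset[OF bounded_cball[of 0 R]]) (use supp in \<open>force simp: not_less[symmetric]\<close>)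
  ultimately show ?thesis
    unfolding C1_compact_support_def using der by (intro conjI exI[of _ "\<lambda>x. Blinfun (D x)"]) (auto simp: D)
qed

lemma C1_compact_supportE:
  fixes \<phi> :: "'a::euclidean_space \<Rightarrow> 'b::euclidean_space"
  assumes "C1_compact_support \<phi>"
  obtains D R where "\<And>x. (\<phi> has_derivative D x) (at x)" "\<And>v. continuous_on UNIV (\<lambda>x. D x v)"
    "0 < R" "\<And>x. R < norm x \<Longrightarrow> \<phi> x = 0"
proof -
  obtain \<phi>' :: "'a \<Rightarrow> 'a \<Rightarrow>\<^sub>L 'b" where \<phi>': "\<And>x. (\<phi> has_derivative blinfun_apply (\<phi>' x)) (at x)"
    "continuous_on UNIV \<phi>'" and "compact (closure {x. \<phi> x \<noteq> 0})"
    using assms unfolding C1_compact_support_def by blast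
  then have "bounded {x. \<phi> x \<noteq> 0}" by (simp add: compact_closure)
  then obtain R where R: "R > 0" "\<And>x. \<phi> x \<noteq> 0 \<Longrightarrow> norm x \<le> R" by (auto simp: bounded_pos)
  show thesis
  proof (rule that[of "\<lambda>x. blinfun_apply (\<phi>' x)" R])
    show "continuous_on UNIV (\<lambda>x. blinfun_apply (\<phi>' x) v)" for v
      by (intro continuous_intros \<phi>')
    show "\<phi> x = 0" if "R < norm x" for x using R(2)[of x] that by auto
  qed (use \<phi>' R in auto)
qed

lemma C1_compact_support_continuous:
  fixes \<phi> :: "'a::euclidean_space \<Rightarrow> 'b::euclidean_space"
  assumes "C1_compact_support \<phi>"
  shows "continuous_on UNIV \<phi>"
  using assms by (elim C1_compact_supportE)
    (intro continuous_at_imp_continuous_on ballI, rule has_derivative_continuous)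

section \<open>Mollified indicator functions\<close>

text \<open>
  The square makes this compactly supported kernel continuously differentiable, with the explicit
  second order remainder of \<open>bump_expansion\<close>.
\<close>

definition bump :: "real \<Rightarrow> 'a::euclidean_space \<Rightarrow> real" where
  "bump e z = (max 0 (e\<^sup>2 - z \<bullet> z))\<^sup>2"

definition bump_grad :: "real \<Rightarrow> 'a::euclidean_space \<Rightarrow> 'a" where
  "bump_grad e z = (- 4 * max 0 (e\<^sup>2 - z \<bullet> z)) *\<^sub>R z"

definition mollify :: "real \<Rightarrow> 'a::euclidean_space set \<Rightarrow> 'a \<Rightarrow> real" where
  "mollify e A x = (LINT y|lborel. indicat_real A y * bump e (x - y)) / (LINT z|lborel. bump e (z::'a))"

lemma bump_zero: "0 < e \<Longrightarrow> e \<le> norm z \<Longrightarrow> bump e z = 0"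
  and bump_grad_zero: "0 < e \<Longrightarrow> e \<le> norm z \<Longrightarrow> bump_grad e z = 0"
proof -
  assume "0 < e" "e \<le> norm z"
  then have "e\<^sup>2 \<le> z \<bullet> z" by (simp add: dot_square_norm power_mono)
  then show "bump e z = 0" "bump_grad e z = 0" by (auto simp: bump_def bump_grad_def max_def)
qed

lemma bump_nonneg: "0 \<le> bump e z" by (simp add: bump_def)

lemma bump_cont: "continuous_on UNIV (bump e)"
  unfolding bump_def by (intro continuous_intros)

lemma bump_grad_cont: "continuous_on UNIV (bump_grad e)"
  unfolding bump_grad_def by (intro continuous_intros)

lemma [measurable]: "bump e \<in> borel_measurable borel" "bump_grad e \<in> borel_measurable borel"
  by (auto intro: borel_measurable_continuous_onI bump_cont bump_grad_cont)

lemma bump_integrable: "0 < e \<Longrightarrow> integrable lborel (bump e)"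
  by (rule integrable_continuous_compact_support[OF bump_cont, of e]) (auto simp: bump_zero)

lemma bump_le: "0 < e \<Longrightarrow> bump e z \<le> (e\<^sup>2)\<^sup>2"
  unfolding bump_def by (intro power_mono) auto

lemma bump_integral_pos:
  assumes "0 < e"
  shows "0 < (LINT z|lborel. bump e (z::'a::euclidean_space))"
proof -
  have "(LINT z|lborel. bump e (z::'a)) \<noteq> 0"
  proof
    assume "(LINT z|lborel. bump e (z::'a)) = 0"
    then have "AE z::'a in lborel. bump e z = 0"
      by (subst (asm) integral_nonneg_eq_0_iff_AE) (auto simp: bump_integrable assms bump_nonneg)
    moreover have "bump e z \<noteq> 0" if "z \<in> ball 0 e" for z :: 'a
    proof -
      have "norm z ^ 2 < e ^ 2" using that by (intro power_strict_mono) auto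
      then show ?thesis by (simp add: bump_def dot_square_norm)
    qed
    ultimately have "AE z::'a in lborel. z \<notin> ball 0 e" by (auto elim: eventually_mono)
    then have "ball (0::'a) e \<in> null_sets lborel" by (subst AE_iff_null_sets) auto
    then have "ball (0::'a) e \<in> null_sets lebesgue" by (auto simp: null_sets_completionI)
    then have "negligible (ball (0::'a) e)" by (simp add: negligible_iff_null_sets)
    then show False using open_not_negligible[of "ball (0::'a) e"] assms by auto
  qed
  moreover have "0 \<le> (LINT z|lborel. bump e (z::'a))" by (simp add: bump_nonneg)
  ultimately show ?thesis by simp
qed

lemma positive_part_square_expansion:
  fixes s t :: real
  shows "\<bar>(max 0 s)\<^sup>2 - (max 0 t)\<^sup>2 - 2 * max 0 t * (s - t)\<bar> \<le> (s - t)\<^sup>2"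
proof -
  consider "0 \<le> s" "0 \<le> t" | "s \<le> 0" "t \<le> 0" | "0 \<le> s" "t \<le> 0" | "s \<le> 0" "0 \<le> t" by linarith
  then show ?thesis
  proof cases
    case 1
    have "s\<^sup>2 - t\<^sup>2 - 2 * t * (s - t) = (s - t)\<^sup>2" by (simp add: power2_eq_square algebra_simps)
    then show ?thesis using 1 by simp
  next
    case 2
    then show ?thesis by simp
  next
    case 3
    then have "s\<^sup>2 \<le> (s - t)\<^sup>2" by (intro power_mono) auto
    then show ?thesis using 3 by simp
  next
    case 4
    have "- t\<^sup>2 - 2 * t * (s - t) = t\<^sup>2 - 2 * (t * s)" by (simp add: power2_eq_square algebra_simps)
    moreover have "(s - t)\<^sup>2 = t\<^sup>2 - 2 * (t * s) + s\<^sup>2" by (simp add: power2_eq_square algebra_simps)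
    moreover have "t * s \<le> 0" using 4 by (simp add: mult_nonneg_nonpos)
    moreover have "0 \<le> t\<^sup>2" "0 \<le> s\<^sup>2" by auto
    ultimately have "\<bar>- t\<^sup>2 - 2 * t * (s - t)\<bar> \<le> (s - t)\<^sup>2" by linarith
    then show ?thesis using 4 by simp
  qed
qed

lemma bump_expansion:
  assumes e: "0 < e" and v: "norm v \<le> 1"
  shows "\<bar>bump e (z + v) - bump e z - bump_grad e z \<bullet> v\<bar>
    \<le> ((2 * e + 3)\<^sup>2 + 2 * e\<^sup>2) * (norm v)\<^sup>2 * indicator (cball 0 (e + 1)) z"
proof (cases "norm z \<le> e + 1")
  case False
  then have "e \<le> norm (z + v)" using norm_triangle_ineq4[of "z + v" v] v by simp
  then show ?thesis using False e by (simp add: bump_zero bump_grad_zero)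
next
  case True
  define s t where "s = e\<^sup>2 - (z + v) \<bullet> (z + v)" and "t = e\<^sup>2 - z \<bullet> z"
  have st: "s - t = - (2 * (z \<bullet> v) + v \<bullet> v)"
    by (simp add: s_def t_def inner_add_left inner_add_right inner_commute)
  have "\<bar>s - t\<bar> \<le> 2 * (norm z * norm v) + norm v * norm v"
    using Cauchy_Schwarz_ineq2[of z v] zero_le_square[of "norm v"]
    unfolding st dot_square_norm power2_eq_square by linarith
  also have "\<dots> = (2 * norm z + norm v) * norm v" by (simp add: algebra_simps)
  also have "\<dots> \<le> (2 * e + 3) * norm v"
    using True v by (intro mult_right_mono) auto
  finally have "\<bar>s - t\<bar>\<^sup>2 \<le> ((2 * e + 3) * norm v)\<^sup>2" by (intro power_mono) auto
  then have A: "(s - t)\<^sup>2 \<le> (2 * e + 3)\<^sup>2 * (norm v)\<^sup>2" by (simp add: power_mult_distrib)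
  have "max 0 t \<le> e\<^sup>2" by (simp add: t_def)
  then have B: "max 0 t * (v \<bullet> v) \<le> e\<^sup>2 * (norm v)\<^sup>2" "0 \<le> max 0 t * (v \<bullet> v)"
    by (simp_all add: dot_square_norm mult_right_mono)
  have "bump e (z + v) - bump e z - bump_grad e z \<bullet> v
      = ((max 0 s)\<^sup>2 - (max 0 t)\<^sup>2 - 2 * max 0 t * (s - t)) - 2 * (max 0 t * (v \<bullet> v))"
    unfolding st by (simp add: bump_def bump_grad_def s_def t_def algebra_simps)
  then have "\<bar>bump e (z + v) - bump e z - bump_grad e z \<bullet> v\<bar> \<le> (s - t)\<^sup>2 + 2 * (max 0 t * (v \<bullet> v))"
    using positive_part_square_expansion[of s t] B(2) by linarith
  also have "\<dots> \<le> ((2 * e + 3)\<^sup>2 + 2 * e\<^sup>2) * (norm v)\<^sup>2"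
    using A B(1) by (simp add: distrib_right)
  finally show ?thesis using True by simp
qed

lemma integrable_indicator_mult:
  fixes g :: "'a::euclidean_space \<Rightarrow> 'b::{banach, second_countable_topology}"
  assumes "integrable lborel g" "A \<in> sets borel"
  shows "integrable lborel (\<lambda>x. indicat_real A x *\<^sub>R g x)"
  using integrable_mult_indicator[of A lborel g] assms by simp

lemma integrable_lborel_reflect:
  fixes f :: "'a::euclidean_space \<Rightarrow> 'b::{banach, second_countable_topology}"
  assumes "integrable lborel f"
  shows "integrable lborel (\<lambda>x. f (z - x))"
proof -
  have "integrable (distr lborel borel uminus) (\<lambda>x. f (x + z))"
    using integrable_lborel_shift[OF assms] by (simp add: lborel_distr_reflect)
  then have "integrable lborel (\<lambda>x. f (- x + z))"
    by (rule integrable_distr[rotated]) auto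
  then show ?thesis by simp
qed

lemma bump_grad_integrable: "0 < e \<Longrightarrow> integrable lborel (bump_grad e)"
  by (rule integrable_continuous_compact_support[OF bump_grad_cont, of e]) (auto simp: bump_grad_zero)

lemma has_derivative_quadratic:
  fixes f :: "'a::real_inner \<Rightarrow> real"
  assumes "\<And>v. norm v \<le> 1 \<Longrightarrow> \<bar>f (x + v) - f x - G \<bullet> v\<bar> \<le> C * (norm v)\<^sup>2"
  shows "(f has_derivative (\<lambda>v. G \<bullet> v)) (at x)"
  unfolding has_derivative_at
proof (intro conjI bounded_linear_inner_right)
  have ev: "\<forall>\<^sub>F v::'a in at 0. norm v \<le> 1"
    unfolding eventually_at by (intro exI[of _ 1]) (auto simp: dist_norm)
  have lim: "((\<lambda>v::'a. C * norm v) \<longlongrightarrow> 0) (at 0)"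
    by (intro tendsto_mult_right_zero tendsto_norm_zero tendsto_ident_at)
  show "((\<lambda>v. norm (f (x + v) - f x - G \<bullet> v) / norm v) \<longlongrightarrow> 0) (at 0)"
  proof (rule tendsto_sandwich[OF _ _ tendsto_const lim])
    show "\<forall>\<^sub>F v in at 0. norm (f (x + v) - f x - G \<bullet> v) / norm v \<le> C * norm v"
      using ev
    proof eventually_elim
      case (elim v)
      show ?case
        using assms[OF elim] by (cases "v = 0") (auto simp: field_simps power2_eq_square)
    qed
  qed auto
qed

text \<open>
  The quadratic remainder of the kernel is uniform in its argument, so it can be integrated.
\<close>

lemma mollify_C1:
  fixes A :: "'a::euclidean_space set"
  assumes e: "0 < e" and A [measurable]: "A \<in> sets borel"
  shows "\<exists>G. (\<forall>x. (mollify e A has_derivative (\<lambda>v. G x \<bullet> v)) (at x)) \<and> continuous_on UNIV G"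
proof -
  define N where "N = (LINT z|lborel. bump e (z::'a))"
  have N: "N > 0" unfolding N_def by (rule bump_integral_pos[OF e])
  define G where "G x = (LINT y|lborel. indicat_real A y *\<^sub>R bump_grad e (x - y))" for x :: 'a
  define C where "C = (2 * e + 3)\<^sup>2 + 2 * e\<^sup>2"
  define V where "V = (LINT y|lborel. indicat_real (cball (0::'a) (e + 1)) y)"
  have int_b: "integrable lborel (\<lambda>y. indicat_real A y * bump e (x - y))" for x :: 'a
    using integrable_indicator_mult[OF integrable_lborel_reflect[OF bump_integrable[OF e]] A] by simp
  have int_g: "integrable lborel (\<lambda>y. indicat_real A y *\<^sub>R bump_grad e (x - y))" for x :: 'a
    by (rule integrable_indicator_mult[OF integrable_lborel_reflect[OF bump_grad_integrable[OF e]] A])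
  have est: "\<bar>mollify e A (x + v) - mollify e A x - (G x /\<^sub>R N) \<bullet> v\<bar> \<le> C * V / N * (norm v)\<^sup>2"
    if v: "norm v \<le> 1" for x v
  proof -
    let ?r = "\<lambda>y. indicat_real A y * (bump e (x + v - y) - bump e (x - y) - bump_grad e (x - y) \<bullet> v)"
    have int_gv: "integrable lborel (\<lambda>y. indicat_real A y * (bump_grad e (x - y) \<bullet> v))"
      using integrable_inner_left[OF int_g[of x], of v] by simp
    have int_bv: "integrable lborel (\<lambda>y. indicat_real A y * bump e (x + v - y))"
      by (rule int_b)
    have "G x \<bullet> v = (LINT y|lborel. indicat_real A y * (bump_grad e (x - y) \<bullet> v))"
      unfolding G_def using integral_inner_left[OF int_g[of x], of v] by simp
    moreover have "?r y = indicat_real A y * bump e (x + v - y) - indicat_real A y * bump e (x - y)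
         - indicat_real A y * (bump_grad e (x - y) \<bullet> v)" for y
      by (simp add: right_diff_distrib)
    ultimately have *: "(LINT y|lborel. ?r y) = N * mollify e A (x + v) - N * mollify e A x - G x \<bullet> v"
      and int_r: "integrable lborel ?r"
      using N int_b[of x] int_bv int_gv by (simp_all add: mollify_def N_def[symmetric] add_diff_eq)
    have eq: "(LINT y|lborel. ?r y) = N * (mollify e A (x + v) - mollify e A x - (G x /\<^sub>R N) \<bullet> v)"
      unfolding * using N by (simp add: right_diff_distrib)
    have "\<bar>LINT y|lborel. ?r y\<bar> \<le> (LINT y|lborel. \<bar>?r y\<bar>)" by (rule integral_abs_bound)
    also have "\<dots> \<le> (LINT y|lborel. C * (norm v)\<^sup>2 * indicator (cball 0 (e + 1)) (x - y))"
    proof (rule integral_mono)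
      show "integrable lborel (\<lambda>y. \<bar>?r y\<bar>)" using int_r by (rule integrable_abs)
      show "integrable lborel (\<lambda>y. C * (norm v)\<^sup>2 * indicat_real (cball 0 (e + 1)) (x - y))"
        by (intro integrable_mult_right integrable_lborel_reflect integrable_indicator_cball)
      show "\<bar>?r y\<bar> \<le> C * (norm v)\<^sup>2 * indicator (cball 0 (e + 1)) (x - y)" for y
        using bump_expansion[OF e v, of "x - y"]
        by (auto simp: C_def indicator_def diff_add_eq split: if_splits)
    qed
    also have "\<dots> = C * (norm v)\<^sup>2 * (LINT y|lborel. indicat_real (cball 0 (e + 1)) (x - y))"
      by (rule integral_mult_right_zero)
    also have "(LINT y|lborel. indicat_real (cball 0 (e + 1)) (x - y)) = V"
      unfolding V_def by (intro integral_lborel_reflect borel_measurable_indicator borel_closed closed_cball)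
    finally have "N * \<bar>mollify e A (x + v) - mollify e A x - (G x /\<^sub>R N) \<bullet> v\<bar> \<le> C * (norm v)\<^sup>2 * V"
      unfolding eq abs_mult using N by simp
    then show ?thesis using N by (simp add: pos_le_divide_eq mult.commute mult.left_commute)
  qed
  have "(mollify e A has_derivative (\<lambda>v. (G x /\<^sub>R N) \<bullet> v)) (at x)" for x
    by (rule has_derivative_quadratic[OF est])
  moreover have "continuous_on UNIV G"
    unfolding continuous_on_sequentially
  proof (intro ballI allI impI)
    fix X :: "nat \<Rightarrow> 'a" and a assume "(\<forall>n. X n \<in> UNIV) \<and> X \<longlonglongrightarrow> a"
    then have X: "X \<longlonglongrightarrow> a" by simp
    obtain b where b: "\<And>n. norm (X n) \<le> b"
      using Bseq_def[of X] convergent_imp_Bseq[of X] X by (auto simp: convergent_def)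
    obtain B where B: "B > 0" "\<And>x. norm (bump_grad e (x::'a)) \<le> B"
      using bounded_continuous_compact_support[OF bump_grad_cont bump_grad_zero[OF e less_imp_le]] by auto
    show "(G \<circ> X) \<longlonglongrightarrow> G a"
      unfolding o_def G_def
    proof (rule integral_dominated_convergence)
      show "integrable lborel (\<lambda>y. B * indicat_real (cball 0 (b + e)) y)"
        by (intro integrable_mult_right integrable_indicator_cball)
      show "AE y in lborel. (\<lambda>n. indicat_real A y *\<^sub>R bump_grad e (X n - y)) \<longlonglongrightarrow> indicat_real A y *\<^sub>R bump_grad e (a - y)"
        by (intro AE_I2 tendsto_intros continuous_on_tendsto_compose[OF bump_grad_cont] X) auto
      show "AE y in lborel. norm (indicat_real A y *\<^sub>R bump_grad e (X n - y)) \<le> B * indicat_real (cball 0 (b + e)) y" for n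
      proof (intro AE_I2)
        fix y
        show "norm (indicat_real A y *\<^sub>R bump_grad e (X n - y)) \<le> B * indicat_real (cball 0 (b + e)) y"
        proof (cases "norm y \<le> b + e")
          case True then show ?thesis using B by (auto simp: indicator_def)
        next
          case False
          then have "e \<le> norm (X n - y)" using norm_triangle_ineq2[of y "X n"] b[of n] by (simp add: norm_minus_commute)
          then show ?thesis using e B(1) by (simp add: bump_grad_zero)
        qed
      qed
    qed measurable
  qed
  then have "continuous_on UNIV (\<lambda>x. G x /\<^sub>R N)" by (intro continuous_intros)
  ultimately show ?thesis by (intro exI[of _ "\<lambda>x. G x /\<^sub>R N"]) auto
qed

lemma mollify_altdef:
  fixes A :: "'a::euclidean_space set"
  assumes [measurable]: "A \<in> sets borel"
  shows "mollify e A x = (LINT z|lborel. indicat_real A (x - z) * bump e z) / (LINT z|lborel. bump e (z::'a))"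
proof -
  have "(LINT z|lborel. (\<lambda>y. indicat_real A y * bump e (x - y)) (x - z)) = (LINT y|lborel. indicat_real A y * bump e (x - y))"
    by (rule integral_lborel_reflect) measurable
  then show ?thesis by (simp add: mollify_def)
qed

lemma integrable_indicator_reflect_bump:
  fixes A :: "'a::euclidean_space set"
  assumes "0 < e" and [measurable]: "A \<in> sets borel"
  shows "integrable lborel (\<lambda>z. indicat_real A (x - z) * bump e z)"
proof (rule Bochner_Integration.integrable_bound[OF bump_integrable[OF assms(1)]])
  show "AE z in lborel. norm (indicat_real A (x - z) * bump e z) \<le> norm (bump e z)"
    by (auto simp: indicator_def)
qed measurable

lemma mollify_nonneg: "0 < e \<Longrightarrow> 0 \<le> mollify e A x"
  unfolding mollify_def by (intro divide_nonneg_nonneg integral_nonneg mult_nonneg_nonneg)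
    (auto simp: bump_nonneg)

lemma mollify_le_1:
  fixes A :: "'a::euclidean_space set"
  assumes e: "0 < e" and A: "A \<in> sets borel"
  shows "mollify e A x \<le> 1"
proof -
  have "(LINT z|lborel. indicat_real A (x - z) * bump e z) \<le> (LINT z|lborel. bump e (z::'a))"
    by (intro integral_mono integrable_indicator_reflect_bump[OF e A] bump_integrable[OF e])
      (auto simp: indicator_def bump_nonneg)
  then show ?thesis using bump_integral_pos[OF e, where 'a='a] by (simp add: mollify_altdef[OF A])
qed

lemma mollify_zero_outside:
  assumes "0 < e" "\<And>y. y \<in> A \<Longrightarrow> norm y \<le> R" "R + e < norm x"
  shows "mollify e A x = 0"
proof -
  have "indicat_real A y * bump e (x - y) = 0" for y
  proof (cases "y \<in> A")
    case True
    then have "e \<le> norm (x - y)" using assms(2)[OF True] assms(3) norm_triangle_ineq2[of x y] by linarith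
    then show ?thesis using assms(1) by (simp add: bump_zero)
  qed simp
  then show ?thesis unfolding mollify_def by (simp only: integral_zero div_0)
qed

lemma mollify_continuous:
  fixes A :: "'a::euclidean_space set"
  assumes "0 < e" "A \<in> sets borel"
  shows "continuous_on UNIV (mollify e A)"
proof -
  obtain G where "\<And>x. (mollify e A has_derivative (\<lambda>v. G x \<bullet> v)) (at x)"
    using mollify_C1[OF assms] by blast
  then show ?thesis by (intro continuous_at_imp_continuous_on ballI) (rule has_derivative_continuous)
qed

text \<open>
  Interchanging the integrals turns a bound that is uniform over small shifts \<open>z\<close> into a bound for
  the average against the kernel. It is used both for mollified fluxes and for the \<open>L\<^sup>1\<close> distance
  between a set and its mollification.
\<close>

lemma average_le:
  fixes H :: "'a::euclidean_space \<Rightarrow> 'a \<Rightarrow> real"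
  assumes e: "0 < e" and H [measurable]: "(\<lambda>(x, z). H x z) \<in> borel_measurable (lborel \<Otimes>\<^sub>M lborel)"
    and B: "\<And>x z. \<bar>H x z\<bar> \<le> B" and supp: "\<And>x z. R < norm x \<Longrightarrow> H x z = 0"
    and le: "\<And>z. norm z \<le> e \<Longrightarrow> (LINT x|lborel. H x z) \<le> p"
  shows "integrable lborel (\<lambda>x. LINT z|lborel. H x z * bump e z)"
    and "(LINT x|lborel. (LINT z|lborel. H x z * bump e z)) \<le> p * (LINT z|lborel. bump e (z::'a))"
proof -
  let ?K = "cball (0::'a) R \<times> cball (0::'a) e"
  have K: "integrable (lborel \<Otimes>\<^sub>M lborel) (\<lambda>w. B * (e\<^sup>2)\<^sup>2 * indicat_real ?K w)"
    unfolding lborel_prod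
  proof (intro integrable_mult_right integrable_real_indicator)
    have "compact ?K" by (intro compact_Times compact_cball)
    then show "emeasure lborel ?K < \<infinity>" "?K \<in> sets lborel"
      by (rule emeasure_compact_finite) (simp add: closed_Times)
  qed
  have int: "integrable (lborel \<Otimes>\<^sub>M lborel) (\<lambda>(x, z). H x z * bump e z)"
  proof (rule Bochner_Integration.integrable_bound[OF K])
    show "(\<lambda>(x, z). H x z * bump e z) \<in> borel_measurable (lborel \<Otimes>\<^sub>M lborel)" by measurable
    show "AE w in lborel \<Otimes>\<^sub>M lborel. norm ((\<lambda>(x, z). H x z * bump e z) w)
        \<le> norm (B * (e\<^sup>2)\<^sup>2 * indicat_real ?K w)"
    proof (intro AE_I2, safe)
      fix x z
      have B0: "0 \<le> B" using B[of x z] by linarith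
      consider "R < norm x" | "e < norm z" | "(x, z) \<in> ?K" by fastforce
      then show "norm (H x z * bump e z) \<le> norm (B * (e\<^sup>2)\<^sup>2 * indicat_real ?K (x, z))"
      proof cases
        case 3
        have "\<bar>H x z\<bar> * \<bar>bump e z\<bar> \<le> B * (e\<^sup>2)\<^sup>2"
          using bump_le[OF e, of z] B0 B[of x z] by (intro mult_mono) (auto simp: bump_nonneg)
        then show ?thesis using 3 B0 by (simp add: abs_mult)
      qed (use e in \<open>simp_all add: supp bump_zero\<close>)
    qed
  qed
  show "integrable lborel (\<lambda>x. LINT z|lborel. H x z * bump e z)"
    using lborel_pair.integrable_fst[OF int] .
  have int2: "integrable lborel (\<lambda>z. LINT x|lborel. H x z * bump e z)"
    using lborel_pair.integrable_snd[OF int] .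
  have "(LINT x|lborel. (LINT z|lborel. H x z * bump e z)) = (LINT z|lborel. (LINT x|lborel. H x z * bump e z))"
    by (rule lborel_pair.Fubini_integral[OF int, symmetric])
  also have "\<dots> \<le> (LINT z|lborel. p * bump e (z::'a))"
  proof (rule integral_mono[OF int2])
    show "integrable lborel (\<lambda>z::'a. p * bump e z)" by (intro integrable_mult_right bump_integrable e)
    show "(LINT x|lborel. H x z * bump e z) \<le> p * bump e z" for z
    proof (cases "norm z \<le> e")
      case True
      then show ?thesis using le[OF True] by (simp add: mult_right_mono bump_nonneg)
    qed (use e in \<open>simp add: bump_zero\<close>)
  qed
  finally show "(LINT x|lborel. (LINT z|lborel. H x z * bump e z)) \<le> p * (LINT z|lborel. bump e (z::'a))" by simp
qed

lemma mollify_integral_le: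
  fixes A :: "'a::euclidean_space set" and g :: "'a \<Rightarrow> real"
  assumes e: "0 < e" and A [measurable]: "A \<in> sets borel"
    and g: "continuous_on UNIV g" and supp: "\<And>x. R < norm x \<Longrightarrow> g x = 0"
    and le: "\<And>z. norm z \<le> e \<Longrightarrow> (LINT x|lborel. indicat_real A (x - z) * g x) \<le> p"
  shows "(LINT x|lborel. mollify e A x * g x) \<le> p"
proof -
  obtain B where B: "\<And>x. norm (g x) \<le> B" using bounded_continuous_compact_support[OF g supp] by auto
  have [measurable]: "g \<in> borel_measurable borel" by (rule borel_measurable_continuous_onI[OF g])
  let ?N = "LINT z|lborel. bump e (z::'a)"
  have N: "0 < ?N" by (rule bump_integral_pos[OF e])
  have "mollify e A x * g x = (LINT z|lborel. indicat_real A (x - z) * g x * bump e z) / ?N" for x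
    using integral_mult_right_zero[of lborel "g x" "\<lambda>z. indicat_real A (x - z) * bump e z"]
    by (simp add: mollify_altdef[OF A] mult_ac)
  then have "(LINT x|lborel. mollify e A x * g x)
      = (LINT x|lborel. (LINT z|lborel. indicat_real A (x - z) * g x * bump e z)) / ?N"
    by simp
  also have "\<dots> \<le> (p * ?N) / ?N"
  proof (intro divide_right_mono average_le(2)[OF e, of _ B R])
    show "(\<lambda>(x, z). indicat_real A (x - z) * g x) \<in> borel_measurable (lborel \<Otimes>\<^sub>M lborel)"
      by measurable
    show "\<bar>indicat_real A (x - z) * g x\<bar> \<le> B" for x z
      using B[of x] abs_ge_zero[of "g x"] by (simp add: indicator_def del: abs_ge_zero)
  qed (use supp le N in auto)
  finally show ?thesis using N by simp
qed

text \<open>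
  Enclose the relevant part of \<open>A\<close> between a compact set \<open>K\<close> and an open set \<open>U\<close> that differ by little
  measure. For \<open>z\<close> smaller than the distance from \<open>K\<close> to the complement of \<open>U\<close>, the shift can change
  the indicator at \<open>x\<close> only if \<open>x\<close> or \<open>x - z\<close> lies in \<open>U - K\<close>.
\<close>

lemma indicator_translation_L1:
  fixes A :: "'a::euclidean_space set"
  assumes A [measurable]: "A \<in> sets borel" and \<eta>: "0 < \<eta>"
  shows "\<exists>\<delta>>0. \<forall>z. norm z \<le> \<delta> \<longrightarrow>
    (LINT x|lborel. indicat_real (cball 0 R) x * \<bar>indicat_real A (x - z) - indicat_real A x\<bar>) \<le> \<eta>"
proof -
  define A' where "A' = A \<inter> cball 0 (R + 1)"
  have A' [measurable]: "A' \<in> sets borel" unfolding A'_def by measurable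
  then have A'l: "A' \<in> sets lebesgue" by simp
  have \<eta>4: "0 < \<eta> / 4" using \<eta> by simp
  obtain U where U: "open U" "A' \<subseteq> U" "emeasure lebesgue (U - A') < ennreal (\<eta> / 4)"
    by (rule sets_lebesgue_outer_open[OF A'l \<eta>4]) (rule that)
  obtain K where K: "closed K" "K \<subseteq> A'" "emeasure lebesgue (A' - K) < ennreal (\<eta> / 4)"
    by (rule sets_lebesgue_inner_closed[OF A'l \<eta>4]) (rule that)
  have "bounded K" by (rule bounded_subset[OF bounded_cball[of 0 "R + 1"]]) (use K in \<open>auto simp: A'_def\<close>)
  then have "compact K" using K by (simp add: compact_eq_bounded_closed)
  then obtain d where d: "d > 0" "(\<Union>x\<in>K. ball x d) \<subseteq> U"
    using compact_subset_open_imp_ball_epsilon_subset[of K U] U K by blast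
  define S where "S = U - K"
  have S [measurable]: "S \<in> sets borel" unfolding S_def using U K by auto
  have S_eq: "S = (U - A') \<union> (A' - K)" unfolding S_def using U K by auto
  have "emeasure lborel S = emeasure lebesgue S" by simp
  also have "\<dots> = emeasure lebesgue ((U - A') \<union> (A' - K))" unfolding S_eq ..
  also have "\<dots> \<le> emeasure lebesgue (U - A') + emeasure lebesgue (A' - K)"
    using U K A'l by (intro emeasure_subadditive) auto
  also have "\<dots> \<le> ennreal (\<eta> / 4) + ennreal (\<eta> / 4)" using U K by (intro add_mono) auto
  also have "\<dots> = ennreal (\<eta> / 2)" using \<eta> by (subst ennreal_plus[symmetric]) auto
  finally have S_le: "emeasure lborel S \<le> ennreal (\<eta> / 2)" .
  then have S_fin: "emeasure lborel S < \<infinity>" by (rule order_le_less_trans) simp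
  have S_int: "integrable lborel (indicat_real S)" using S_fin by (intro integrable_real_indicator) auto
  have S_m: "(LINT x|lborel. indicat_real S x) \<le> \<eta> / 2"
  proof -
    have "measure lborel S \<le> \<eta> / 2"
      unfolding measure_def by (rule enn2real_leI) (use S_le \<eta> in auto)
    then show ?thesis by simp
  qed
  define \<delta> where "\<delta> = min 1 (d / 2)"
  have "(LINT x|lborel. indicat_real (cball 0 R) x * \<bar>indicat_real A (x - z) - indicat_real A x\<bar>) \<le> \<eta>"
    if z: "norm z \<le> \<delta>" for z
  proof -
    have z1: "norm z \<le> 1" "norm z < d" using z d(1) by (auto simp: \<delta>_def)
    have KU: "x + z \<in> U" "x - z \<in> U" if "x \<in> K" for x
    proof -
      have "x + z \<in> ball x d" "x - z \<in> ball x d" using z1(2) by (auto simp: dist_norm)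
      then show "x + z \<in> U" "x - z \<in> U" using d(2) that by blast+
    qed
    have S_shift: "integrable lborel (\<lambda>x. indicat_real S (x - z))"
      using integrable_lborel_shift[OF S_int, of "- z"] by simp
    have "(LINT x|lborel. indicat_real (cball 0 R) x * \<bar>indicat_real A (x - z) - indicat_real A x\<bar>)
        \<le> (LINT x|lborel. indicat_real S x + indicat_real S (x - z))"
    proof (rule integral_mono)
      show "integrable lborel (\<lambda>x. indicat_real (cball 0 R) x * \<bar>indicat_real A (x - z) - indicat_real A x\<bar>)"
        by (rule Bochner_Integration.integrable_bound[OF integrable_indicator_cball[of R]])
          (auto simp: indicator_def)
      show "integrable lborel (\<lambda>x. indicat_real S x + indicat_real S (x - z))"
        by (intro Bochner_Integration.integrable_add S_int S_shift)
      show "indicat_real (cball 0 R) x * \<bar>indicat_real A (x - z) - indicat_real A x\<bar>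
          \<le> indicat_real S x + indicat_real S (x - z)" for x
      proof (cases "norm x \<le> R")
        case True
        then have "norm (x - z) \<le> R + 1" using norm_triangle_ineq4[of x z] z1 by linarith
        then have "x \<in> A \<longleftrightarrow> x \<in> A'" "x - z \<in> A \<longleftrightarrow> x - z \<in> A'" using True by (auto simp: A'_def)
        moreover have "x \<in> S \<or> x - z \<in> S" if "x \<in> A'" "x - z \<notin> A'"
          using KU(2)[of x] that U K by (auto simp: S_def)
        moreover have "x \<in> S \<or> x - z \<in> S" if "x \<notin> A'" "x - z \<in> A'"
          using KU(1)[of "x - z"] that U K by (auto simp: S_def)
        ultimately show ?thesis by (auto simp: indicator_def)
      qed (simp add: indicator_def)
    qed
    also have "\<dots> = (LINT x|lborel. indicat_real S x) + (LINT x|lborel. indicat_real S (x - z))"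
      by (rule Bochner_Integration.integral_add[OF S_int S_shift])
    also have "(LINT x|lborel. indicat_real S (x - z)) = (LINT x|lborel. indicat_real S x)"
      using integral_lborel_shift[of "indicat_real S" "- z"] by simp
    finally show ?thesis using S_m by linarith
  qed
  moreover have "\<delta> > 0" using d by (simp add: \<delta>_def)
  ultimately show ?thesis by blast
qed

lemma mollify_L1:
  fixes A :: "'a::euclidean_space set"
  assumes A [measurable]: "A \<in> sets borel" and \<eta>: "0 < \<eta>"
  shows "\<exists>\<delta>>0. \<forall>e. 0 < e \<and> e \<le> \<delta> \<longrightarrow>
    (LINT x|lborel. indicat_real (cball 0 R) x * \<bar>mollify e A x - indicat_real A x\<bar>) \<le> \<eta>"
proof -
  obtain \<delta> where \<delta>: "\<delta> > 0" "\<And>z. norm z \<le> \<delta> \<Longrightarrow>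
    (LINT x|lborel. indicat_real (cball 0 R) x * \<bar>indicat_real A (x - z) - indicat_real A x\<bar>) \<le> \<eta>"
    using indicator_translation_L1[OF A \<eta>] by blast
  have "(LINT x|lborel. indicat_real (cball 0 R) x * \<bar>mollify e A x - indicat_real A x\<bar>) \<le> \<eta>"
    if e: "0 < e" "e \<le> \<delta>" for e
  proof -
    let ?N = "LINT z|lborel. bump e (z::'a)"
    have N: "0 < ?N" by (rule bump_integral_pos[OF e(1)])
    define H where "H x z = indicat_real (cball 0 R) x * \<bar>indicat_real A (x - z) - indicat_real A x\<bar>" for x z
    have [measurable]: "cball (0::'a) R \<in> sets borel" by simp
    have Hm [measurable]: "(\<lambda>(x, z). H x z) \<in> borel_measurable (lborel \<Otimes>\<^sub>M lborel)"
      unfolding H_def by measurable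
    note avg = average_le[OF e(1) Hm, of 1 R \<eta>]
    have avg1: "integrable lborel (\<lambda>x. LINT z|lborel. H x z * bump e z)"
      and avg2: "(LINT x|lborel. (LINT z|lborel. H x z * bump e z)) \<le> \<eta> * ?N"
      by (rule avg; use \<delta>(2) e(2) in \<open>auto simp: H_def indicator_def\<close>)+
    have [measurable]: "mollify e A \<in> borel_measurable borel"
      by (rule borel_measurable_continuous_onI[OF mollify_continuous[OF e(1) A]])
    have "(LINT x|lborel. indicat_real (cball 0 R) x * \<bar>mollify e A x - indicat_real A x\<bar>)
        \<le> (LINT x|lborel. (LINT z|lborel. H x z * bump e z) / ?N)"
    proof (rule integral_mono)
      show "integrable lborel (\<lambda>x. indicat_real (cball 0 R) x * \<bar>mollify e A x - indicat_real A x\<bar>)"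
      proof (rule Bochner_Integration.integrable_bound[OF integrable_indicator_cball[of R]])
        have "\<bar>mollify e A x - indicat_real A x\<bar> \<le> 1" for x
          using mollify_nonneg[OF e(1), of A x] mollify_le_1[OF e(1) A, of x] by (auto simp: indicator_def)
        then show "AE x in lborel. norm (indicat_real (cball 0 R) x * \<bar>mollify e A x - indicat_real A x\<bar>)
            \<le> norm (indicat_real (cball 0 R) x)"
          by (auto simp: indicator_def)
      qed measurable
      show "integrable lborel (\<lambda>x. (LINT z|lborel. H x z * bump e z) / ?N)"
        using avg1 by simp
      show "indicat_real (cball 0 R) x * \<bar>mollify e A x - indicat_real A x\<bar>
          \<le> (LINT z|lborel. H x z * bump e z) / ?N" for x
      proof -
        let ?i = "\<lambda>z. (indicat_real A (x - z) - indicat_real A x) * bump e z"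
        note int = integrable_indicator_reflect_bump[OF e(1) A, of x] bump_integrable[OF e(1)]
        have "(LINT z|lborel. ?i z) = (LINT z|lborel. indicat_real A (x - z) * bump e z) - indicat_real A x * ?N"
          unfolding left_diff_distrib using int by (subst Bochner_Integration.integral_diff) auto
        then have "mollify e A x - indicat_real A x = (LINT z|lborel. ?i z) / ?N"
          using N by (simp add: mollify_altdef[OF A] diff_divide_distrib)
        also have "\<bar>\<dots>\<bar> \<le> (LINT z|lborel. \<bar>?i z\<bar>) / ?N"
          using N integral_abs_bound[of lborel ?i] by (simp add: divide_right_mono)
        finally have "indicat_real (cball 0 R) x * \<bar>mollify e A x - indicat_real A x\<bar>
           \<le> indicat_real (cball 0 R) x * ((LINT z|lborel. \<bar>?i z\<bar>) / ?N)"
          by (rule mult_left_mono) simp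
        also have "\<dots> = (LINT z|lborel. H x z * bump e z) / ?N"
          by (simp add: H_def abs_mult bump_nonneg mult.assoc)
        finally show ?thesis .
      qed
    qed
    also have "\<dots> = (LINT x|lborel. (LINT z|lborel. H x z * bump e z)) / ?N" by simp
    also have "\<dots> \<le> (\<eta> * ?N) / ?N" by (intro divide_right_mono avg2) (use N in simp)
    finally show ?thesis using N by simp
  qed
  then show ?thesis using \<delta>(1) by blast
qed

section \<open>The Hermite divergence\<close>

text \<open>
  With these signs the terms of order zero of the Hermite divergence of \<open>\<phi>\<close>, and also the integrand of
  the constraint on admissible fields, are \<open>drift \<alpha> x \<bullet> \<phi> x\<close>.
\<close>

definition drift :: "real \<Rightarrow> real^'d::finite \<Rightarrow> real^('d + 'd)" where
  "drift \<alpha> x = (\<chi> j. case j of Inl k \<Rightarrow> potential \<alpha> k x | Inr k \<Rightarrow> - potential \<alpha> k x)"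

text \<open>
  The first order part of the Hermite divergence is the ordinary divergence of this sum.
\<close>

definition fold_halves :: "real^('d::finite + 'd) \<Rightarrow> real^'d" where
  "fold_halves p = (\<chi> i. p $ Inl i + p $ Inr i)"

text \<open>
  The argument is the total derivative of a field at a point.
\<close>

definition divergence :: "(real^'d::finite \<Rightarrow> real^('d + 'd)) \<Rightarrow> real" where
  "divergence D = (\<Sum>i\<in>UNIV. D (axis i 1) $ Inl i + D (axis i 1) $ Inr i)"

lemma drift_inner:
  "drift \<alpha> x \<bullet> p = (\<Sum>k\<in>UNIV. potential \<alpha> k x * p $ Inl k) - (\<Sum>k\<in>UNIV. potential \<alpha> k x * p $ Inr k)"
  unfolding inner_vec_def UNIV_Plus_UNIV[symmetric]
  by (subst sum.Plus) (auto simp: drift_def sum_negf)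

lemma hermite_div_eq:
  assumes "(\<phi> has_derivative D) (at x)"
  shows "hermite_div \<alpha> \<phi> x = divergence D + drift \<alpha> x \<bullet> \<phi> x"
proof -
  have "partial_deriv i (\<lambda>y. \<phi> y $ j) x = D (axis i 1) $ j" for i j
  proof -
    have "((\<lambda>y. \<phi> y $ j) has_derivative (\<lambda>v. D v $ j)) (at x)"
      by (rule bounded_linear.has_derivative[OF bounded_linear_vec_nth assms])
    then show ?thesis unfolding partial_deriv_def by (simp add: frechet_derivative_at[symmetric])
  qed
  then show ?thesis
    by (simp add: hermite_div_def A_plus_def A_minus_def divergence_def drift_inner sum.distrib sum_subtractf)
qed

text \<open>
  The only delicate point is the origin, where the potential is at most a multiple of the power
  \<open>\<alpha> / 2 > 0\<close> of the norm.
\<close>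

lemma potential_continuous:
  assumes \<alpha>: "1 \<le> \<alpha>"
  shows "continuous_on UNIV (potential \<alpha> i :: real^'d::finite \<Rightarrow> real)"
proof (intro continuous_at_imp_continuous_on ballI)
  fix x :: "real^'d"
  show "isCont (potential \<alpha> i) x"
  proof (cases "x = 0")
    case False
    then show ?thesis unfolding potential_def by (intro continuous_intros) auto
  next
    case True
    have "\<bar>potential \<alpha> i y\<bar> \<le> sqrt (\<alpha> - 1) * norm y powr (\<alpha> / 2)" for y :: "real^'d"
    proof -
      have "\<bar>potential \<alpha> i y\<bar> = sqrt (\<alpha> - 1) * (\<bar>y $ i\<bar> * norm y powr ((\<alpha> - 2) / 2))"
        using \<alpha> by (simp add: potential_def abs_mult)
      also have "\<dots> \<le> sqrt (\<alpha> - 1) * (norm y powr 1 * norm y powr ((\<alpha> - 2) / 2))"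
        using \<alpha> component_le_norm_cart[of y i] by (intro mult_left_mono mult_right_mono) auto
      also have "\<dots> = sqrt (\<alpha> - 1) * norm y powr (\<alpha> / 2)"
        unfolding powr_add[symmetric] by (simp add: field_simps)
      finally show ?thesis .
    qed
    moreover have "((\<lambda>y::real^'d. norm y powr (\<alpha> / 2)) \<longlongrightarrow> 0) (at 0)"
      by (rule tendsto_zero_powrI[OF tendsto_norm_zero[OF tendsto_ident_at] tendsto_const]) (use \<alpha> in auto)
    then have "((\<lambda>y::real^'d. sqrt (\<alpha> - 1) * norm y powr (\<alpha> / 2)) \<longlongrightarrow> 0) (at 0)"
      by (rule tendsto_mult_right_zero)
    ultimately have "(potential \<alpha> i \<longlongrightarrow> 0) (at (0::real^'d))"
      by (intro Lim_null_comparison[of "potential \<alpha> i"]) auto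
    then show ?thesis unfolding True by (simp add: isCont_def potential_def)
  qed
qed

lemma drift_continuous:
  assumes "1 \<le> \<alpha>"
  shows "continuous_on UNIV (drift \<alpha> :: real^'d::finite \<Rightarrow> _)"
  unfolding drift_def
proof (intro continuous_on_vec_lambda)
  show "continuous_on UNIV (\<lambda>x::real^'d. case j of Inl k \<Rightarrow> potential \<alpha> k x | Inr k \<Rightarrow> - potential \<alpha> k x)" for j
    by (cases j) (auto intro!: continuous_intros potential_continuous[OF assms])
qed

lemma hermite_div_regular:
  assumes "1 \<le> \<alpha>" "C1_compact_support \<phi>"
  shows "continuous_on UNIV (hermite_div \<alpha> \<phi>)"
    and "(\<And>x. R < norm x \<Longrightarrow> \<phi> x = 0) \<Longrightarrow> R < norm y \<Longrightarrow> hermite_div \<alpha> \<phi> y = 0"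
proof -
  obtain D where D: "\<And>x. (\<phi> has_derivative D x) (at x)" "\<And>v. continuous_on UNIV (\<lambda>x. D x v)"
    using assms(2) by (elim C1_compact_supportE) blast
  show "continuous_on UNIV (hermite_div \<alpha> \<phi>)"
    unfolding hermite_div_eq[OF D(1)] divergence_def
    by (intro continuous_intros D drift_continuous assms C1_compact_support_continuous)
  show "hermite_div \<alpha> \<phi> y = 0" if "\<And>x. R < norm x \<Longrightarrow> \<phi> x = 0" "R < norm y" for y
    using derivative_zero_outside[OF D(1) that(2,1)] that
    by (simp add: hermite_div_eq[OF D(1)] divergence_def)
qed

lemma hermite_div_integrable:
  assumes "1 \<le> \<alpha>" "C1_compact_support \<phi>"
  shows "integrable lborel (hermite_div \<alpha> \<phi>)" "integrable lborel (\<lambda>x. drift \<alpha> x \<bullet> \<phi> x)"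
proof -
  obtain R where R: "\<And>x. R < norm x \<Longrightarrow> \<phi> x = 0" using assms(2) by (elim C1_compact_supportE) blast
  show "integrable lborel (hermite_div \<alpha> \<phi>)"
    by (rule integrable_continuous_compact_support[OF hermite_div_regular(1)[OF assms] hermite_div_regular(2)[OF assms R]])
  show "integrable lborel (\<lambda>x. drift \<alpha> x \<bullet> \<phi> x)"
  proof (rule integrable_continuous_compact_support[where R=R])
    show "continuous_on UNIV (\<lambda>x. drift \<alpha> x \<bullet> \<phi> x)"
      by (intro continuous_on_inner drift_continuous C1_compact_support_continuous assms)
  qed (simp add: R)
qed

lemma C1_compact_support_scaleR:
  fixes \<phi> :: "'a::euclidean_space \<Rightarrow> 'b::euclidean_space"
  assumes "C1_compact_support \<phi>" and \<sigma>: "\<And>x. (\<sigma> has_derivative (\<lambda>v. G x \<bullet> v)) (at x)" and G: "continuous_on UNIV G"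
  shows "C1_compact_support (\<lambda>x. \<sigma> x *\<^sub>R \<phi> x)"
proof -
  obtain D R where D: "\<And>x. (\<phi> has_derivative D x) (at x)" "\<And>v. continuous_on UNIV (\<lambda>x. D x v)"
    and R: "\<And>x. R < norm x \<Longrightarrow> \<phi> x = 0"
    using assms(1) by (elim C1_compact_supportE) blast
  have c: "continuous_on UNIV \<sigma>" "continuous_on UNIV \<phi>"
    by (intro continuous_at_imp_continuous_on ballI has_derivative_continuous[OF \<sigma>] has_derivative_continuous[OF D(1)])+
  show ?thesis
  proof (rule C1_compact_supportI[where R=R])
    show "((\<lambda>x. \<sigma> x *\<^sub>R \<phi> x) has_derivative (\<lambda>v. \<sigma> x *\<^sub>R D x v + (G x \<bullet> v) *\<^sub>R \<phi> x)) (at x)" for x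
      by (intro has_derivative_scaleR \<sigma> D)
    show "continuous_on UNIV (\<lambda>x. \<sigma> x *\<^sub>R D x v + (G x \<bullet> v) *\<^sub>R \<phi> x)" for v
      by (intro continuous_intros c D G)
  qed (simp add: R)
qed

lemma hermite_div_scaleR:
  fixes \<phi> :: "real^'d::finite \<Rightarrow> real^('d + 'd)"
  assumes "C1_compact_support \<phi>" and \<sigma>: "\<And>x. (\<sigma> has_derivative (\<lambda>v. G x \<bullet> v)) (at x)"
  shows "hermite_div \<alpha> (\<lambda>x. \<sigma> x *\<^sub>R \<phi> x) x = \<sigma> x * hermite_div \<alpha> \<phi> x + G x \<bullet> fold_halves (\<phi> x)"
proof -
  obtain D where D: "\<And>x. (\<phi> has_derivative D x) (at x)"
    using assms(1) by (elim C1_compact_supportE) blast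
  have "((\<lambda>x. \<sigma> x *\<^sub>R \<phi> x) has_derivative (\<lambda>v. \<sigma> x *\<^sub>R D x v + (G x \<bullet> v) *\<^sub>R \<phi> x)) (at x)"
    by (intro has_derivative_scaleR \<sigma> D)
  moreover have "G x \<bullet> axis i 1 = G x $ i" for i by (simp add: inner_axis)
  moreover have "G x \<bullet> fold_halves (\<phi> x) = (\<Sum>i\<in>UNIV. G x $ i * (\<phi> x $ Inl i + \<phi> x $ Inr i))"
    by (simp add: fold_halves_def inner_vec_def)
  ultimately show ?thesis
    by (simp add: hermite_div_eq[of _ "\<lambda>v. \<sigma> x *\<^sub>R D x v + (G x \<bullet> v) *\<^sub>R \<phi> x"] hermite_div_eq[OF D]
        divergence_def sum.distrib sum_distrib_left algebra_simps)
qed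

lemma C1_compact_support_add:
  fixes \<phi> \<psi> :: "'a::euclidean_space \<Rightarrow> 'b::euclidean_space"
  assumes "C1_compact_support \<phi>" "C1_compact_support \<psi>"
  shows "C1_compact_support (\<lambda>x. a *\<^sub>R \<phi> x + b *\<^sub>R \<psi> x)"
proof -
  obtain D R where D: "\<And>x. (\<phi> has_derivative D x) (at x)" "\<And>v. continuous_on UNIV (\<lambda>x. D x v)"
    and R: "\<And>x. R < norm x \<Longrightarrow> \<phi> x = 0"
    using assms(1) by (elim C1_compact_supportE) blast
  obtain D' R' where D': "\<And>x. (\<psi> has_derivative D' x) (at x)" "\<And>v. continuous_on UNIV (\<lambda>x. D' x v)"
    and R': "\<And>x. R' < norm x \<Longrightarrow> \<psi> x = 0"
    using assms(2) by (elim C1_compact_supportE) blast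
  show ?thesis
  proof (rule C1_compact_supportI[where R="max R R'"])
    show "((\<lambda>x. a *\<^sub>R \<phi> x + b *\<^sub>R \<psi> x) has_derivative (\<lambda>v. a *\<^sub>R D x v + b *\<^sub>R D' x v)) (at x)" for x
      by (intro has_derivative_add has_derivative_scaleR_right D D')
    show "continuous_on UNIV (\<lambda>x. a *\<^sub>R D x v + b *\<^sub>R D' x v)" for v
      by (intro continuous_intros D D')
  qed (simp add: R R')
qed

lemma hermite_div_add:
  fixes \<phi> \<psi> :: "real^'d::finite \<Rightarrow> real^('d + 'd)"
  assumes "C1_compact_support \<phi>" "C1_compact_support \<psi>"
  shows "hermite_div \<alpha> (\<lambda>x. a *\<^sub>R \<phi> x + b *\<^sub>R \<psi> x) x = a * hermite_div \<alpha> \<phi> x + b * hermite_div \<alpha> \<psi> x"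
proof -
  obtain D where D: "\<And>x. (\<phi> has_derivative D x) (at x)" using assms(1) by (elim C1_compact_supportE) blast
  obtain D' where D': "\<And>x. (\<psi> has_derivative D' x) (at x)" using assms(2) by (elim C1_compact_supportE) blast
  have "((\<lambda>x. a *\<^sub>R \<phi> x + b *\<^sub>R \<psi> x) has_derivative (\<lambda>v. a *\<^sub>R D x v + b *\<^sub>R D' x v)) (at x)"
    by (intro has_derivative_add has_derivative_scaleR_right D D')
  from hermite_div_eq[OF this] show ?thesis
    by (simp add: hermite_div_eq[OF D] hermite_div_eq[OF D'] divergence_def inner_add_right
        sum.distrib sum_distrib_left algebra_simps)
qed

lemma has_derivative_translate:
  assumes "(\<phi> has_derivative D) (at (x + z))"
  shows "((\<lambda>x. \<phi> (x + z)) has_derivative D) (at x)"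
proof -
  have "((\<lambda>x. x + z) has_derivative (\<lambda>v. v)) (at x)" by (auto intro!: derivative_eq_intros)
  from has_derivative_compose[OF this assms] show ?thesis .
qed

lemma C1_compact_support_translate:
  fixes \<phi> :: "'a::euclidean_space \<Rightarrow> 'b::euclidean_space"
  assumes "C1_compact_support \<phi>"
  shows "C1_compact_support (\<lambda>x. \<phi> (x + z))"
proof -
  obtain D R where D: "\<And>x. (\<phi> has_derivative D x) (at x)" "\<And>v. continuous_on UNIV (\<lambda>x. D x v)"
    and R: "\<And>x. R < norm x \<Longrightarrow> \<phi> x = 0"
    using assms(1) by (elim C1_compact_supportE) blast
  show ?thesis
  proof (rule C1_compact_supportI[where R="R + norm z"])
    show "((\<lambda>x. \<phi> (x + z)) has_derivative D (x + z)) (at x)" for x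
      by (rule has_derivative_translate[OF D(1)])
    show "continuous_on UNIV (\<lambda>x. D (x + z) v)" for v
      by (rule continuous_on_compose2[OF D(2)]) (auto intro!: continuous_intros)
    show "\<phi> (x + z) = 0" if "R + norm z < norm x" for x
      using that norm_triangle_ineq4[of "x + z" z] by (intro R) simp
  qed
qed

lemma hermite_div_translate:
  fixes \<phi> :: "real^'d::finite \<Rightarrow> real^('d + 'd)"
  assumes "C1_compact_support \<phi>"
  shows "hermite_div \<alpha> \<phi> (x + z) = hermite_div \<alpha> (\<lambda>x. \<phi> (x + z)) x + (drift \<alpha> (x + z) - drift \<alpha> x) \<bullet> \<phi> (x + z)"
proof -
  obtain D where D: "\<And>x. (\<phi> has_derivative D x) (at x)" using assms(1) by (elim C1_compact_supportE) blast
  have "((\<lambda>x. \<phi> (x + z)) has_derivative D (x + z)) (at x)"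
    by (rule has_derivative_translate[OF D])
  from hermite_div_eq[OF this] show ?thesis
    by (simp add: hermite_div_eq[OF D] inner_diff_left)
qed

lemma integral_hermite_div:
  fixes \<phi> :: "real^'d::finite \<Rightarrow> real^('d + 'd)"
  assumes \<alpha>: "1 \<le> \<alpha>" and \<phi>: "C1_compact_support \<phi>"
  shows "(LINT x|lborel. hermite_div \<alpha> \<phi> x) = (LINT x|lborel. drift \<alpha> x \<bullet> \<phi> x)"
proof -
  obtain D R where D: "\<And>x. (\<phi> has_derivative D x) (at x)" "\<And>v. continuous_on UNIV (\<lambda>x. D x v)"
    and R: "\<And>x. R < norm x \<Longrightarrow> \<phi> x = 0"
    using \<phi> by (elim C1_compact_supportE) blast
  have Dj: "((\<lambda>y. \<phi> y $ j) has_derivative (\<lambda>v. D x v $ j)) (at x)" for x j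
    by (rule bounded_linear.has_derivative[OF bounded_linear_vec_nth D(1)])
  have cont: "continuous_on UNIV (\<lambda>x. D x v $ j)" for v j
    by (intro continuous_intros D)
  have zero: "(LINT x|lborel. D x v $ j) = 0" for v j
    by (rule integral_derivative_zero[OF Dj cont, of R]) (simp add: R)
  have int: "integrable lborel (\<lambda>x. D x v $ j)" for v j
    by (rule integrable_continuous_compact_support[OF cont, of R])
      (simp add: derivative_zero_outside[OF D(1) _ R])
  have "(LINT x|lborel. divergence (D x)) = 0"
    unfolding divergence_def by (simp add: Bochner_Integration.integral_sum int zero)
  moreover have "integrable lborel (\<lambda>x. divergence (D x))"
    unfolding divergence_def by (intro Bochner_Integration.integrable_sum Bochner_Integration.integrable_add int)
  ultimately show ?thesis
    by (simp add: hermite_div_eq[OF D(1)] Bochner_Integration.integral_add hermite_div_integrable(2)[OF assms])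
qed

section \<open>Switching between two fields\<close>

definition unit_fields :: "(real^'d::finite \<Rightarrow> real^('d + 'd)) set" where
  "unit_fields = {\<phi>. C1_compact_support \<phi> \<and> (\<forall>x. norm (\<phi> x) \<le> 1)}"

lemma unit_fields_combine:
  assumes "\<phi> \<in> unit_fields" "\<psi> \<in> unit_fields" "\<bar>a\<bar> + \<bar>b\<bar> \<le> 1"
  shows "(\<lambda>x. a *\<^sub>R \<phi> x + b *\<^sub>R \<psi> x) \<in> unit_fields"
proof -
  have "norm (a *\<^sub>R \<phi> x + b *\<^sub>R \<psi> x) \<le> 1" for x
  proof -
    have "norm (a *\<^sub>R \<phi> x + b *\<^sub>R \<psi> x) \<le> \<bar>a\<bar> * norm (\<phi> x) + \<bar>b\<bar> * norm (\<psi> x)"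
      using norm_triangle_ineq[of "a *\<^sub>R \<phi> x" "b *\<^sub>R \<psi> x"] by simp
    also have "\<dots> \<le> \<bar>a\<bar> * 1 + \<bar>b\<bar> * 1"
      using assms by (intro add_mono mult_left_mono) (auto simp: unit_fields_def)
    finally show ?thesis using assms(3) by simp
  qed
  then show ?thesis using assms by (auto simp: unit_fields_def intro: C1_compact_support_add)
qed

lemma unit_fields_uminus:
  assumes "\<phi> \<in> unit_fields"
  shows "(\<lambda>x. - \<phi> x) \<in> unit_fields" "hermite_div \<alpha> (\<lambda>x. - \<phi> x) x = - hermite_div \<alpha> \<phi> x"
  using unit_fields_combine[OF assms assms, of "-1" 0]
    hermite_div_add[of \<phi> \<phi> \<alpha> "-1" 0 x] assms by (auto simp: unit_fields_def)

lemma integrable_continuous_mult: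
  fixes g k :: "'a::euclidean_space \<Rightarrow> real"
  assumes "continuous_on UNIV k" "continuous_on UNIV g" "\<And>x. R < norm x \<Longrightarrow> g x = 0"
  shows "integrable lborel (\<lambda>x. k x * g x)"
  by (rule integrable_continuous_compact_support[where R=R])
    (auto intro!: continuous_intros assms(1,2) simp: assms(3))

text \<open>
  A shift of the set is the opposite shift of the field. The shifted field is still admissible, and its
  Hermite divergence differs from the shifted divergence only through the drift, which is uniformly
  continuous on the ball that contains the supports. The bound holds for all fields supported in a given
  ball at once, which matters because it is applied to fields that depend on the mollification.
\<close>

lemma mollified_bound:
  fixes A :: "(real^'d::finite) set"
  assumes \<alpha>: "1 \<le> \<alpha>" and A [measurable]: "A \<in> sets borel" and \<eta>: "0 < \<eta>"
    and le: "\<And>\<phi>. \<phi> \<in> unit_fields \<Longrightarrow> (LINT x|lborel. indicat_real A x * hermite_div \<alpha> \<phi> x) \<le> p"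
  shows "\<exists>\<delta>>0. \<forall>e \<phi>. 0 < e \<and> e \<le> \<delta> \<and> \<phi> \<in> unit_fields \<and> (\<forall>x. R < norm x \<longrightarrow> \<phi> x = 0) \<longrightarrow>
    (LINT x|lborel. mollify e A x * hermite_div \<alpha> \<phi> x) \<le> p + \<eta>"
proof -
  define V where "V = (LINT x|lborel. indicat_real (cball (0::real^'d) R) x)"
  have V: "0 \<le> V" unfolding V_def by simp
  \<comment> \<open>The oscillation of the drift is to contribute at most \<open>\<eta>\<close> over a ball of volume \<open>V\<close>.\<close>
  define \<kappa> where "\<kappa> = \<eta> / (1 + V)"
  have \<kappa>: "0 < \<kappa>" using \<eta> V by (simp add: \<kappa>_def)
  have \<kappa>V: "\<kappa> * V \<le> \<eta>" using \<eta> V by (simp add: \<kappa>_def field_simps)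
  have "uniformly_continuous_on (cball (0::real^'d) (R + 1)) (drift \<alpha>)"
    by (intro compact_uniformly_continuous continuous_on_subset[OF drift_continuous[OF \<alpha>]]) auto
  then obtain d where d: "d > 0" "\<And>x x'. x \<in> cball (0::real^'d) (R + 1) \<Longrightarrow> x' \<in> cball 0 (R + 1) \<Longrightarrow>
      dist x' x < d \<Longrightarrow> dist (drift \<alpha> x') (drift \<alpha> x) < \<kappa>"
    unfolding uniformly_continuous_on_def using \<kappa> by metis
  define \<delta> where "\<delta> = min 1 (d / 2)"
  have "(LINT x|lborel. mollify e A x * hermite_div \<alpha> \<phi> x) \<le> p + \<eta>"
    if e: "0 < e" "e \<le> \<delta>" and \<phi>: "\<phi> \<in> unit_fields" and R: "\<And>x. R < norm x \<Longrightarrow> \<phi> x = 0" for e \<phi>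
  proof -
    have \<phi>1: "C1_compact_support \<phi>" "\<And>x. norm (\<phi> x) \<le> 1" using \<phi> by (auto simp: unit_fields_def)
    note cont = hermite_div_regular(1)[OF \<alpha> \<phi>1(1)]
    have [measurable]: "hermite_div \<alpha> \<phi> \<in> borel_measurable borel" by (rule borel_measurable_continuous_onI[OF cont])
    show ?thesis
    proof (rule mollify_integral_le[OF e(1) A cont hermite_div_regular(2)[OF \<alpha> \<phi>1(1) R]])
      fix z :: "real^'d" assume z: "norm z \<le> e"
      let ?\<psi> = "\<lambda>x. \<phi> (x + z)"
      have \<psi>: "?\<psi> \<in> unit_fields"
        using C1_compact_support_translate[OF \<phi>1(1)] \<phi>1(2) by (auto simp: unit_fields_def)
      then have \<psi>1: "C1_compact_support ?\<psi>" by (simp add: unit_fields_def)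
      have i1: "integrable lborel (\<lambda>x. indicat_real A x * hermite_div \<alpha> ?\<psi> x)"
        using integrable_indicator_mult[OF hermite_div_integrable(1)[OF \<alpha> \<psi>1] A] by simp
      have i2: "integrable lborel (\<lambda>x. \<kappa> * indicat_real (cball 0 R) (x + z))"
        by (intro integrable_mult_right integrable_lborel_shift integrable_indicator_cball)
      have i3: "integrable lborel (\<lambda>x. indicat_real A x * hermite_div \<alpha> \<phi> (x + z))"
        using integrable_indicator_mult[OF integrable_lborel_shift[OF hermite_div_integrable(1)[OF \<alpha> \<phi>1(1)]] A] by simp
      have "(LINT x|lborel. indicat_real A (x - z) * hermite_div \<alpha> \<phi> x)
          = (LINT x|lborel. indicat_real A x * hermite_div \<alpha> \<phi> (x + z))"
        using integral_lborel_shift[of "\<lambda>x. indicat_real A (x - z) * hermite_div \<alpha> \<phi> x" z] by simp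
      also have "\<dots> \<le> (LINT x|lborel. indicat_real A x * hermite_div \<alpha> ?\<psi> x + \<kappa> * indicat_real (cball 0 R) (x + z))"
      proof (rule integral_mono[OF i3 Bochner_Integration.integrable_add[OF i1 i2]])
        fix x
        have "(drift \<alpha> (x + z) - drift \<alpha> x) \<bullet> \<phi> (x + z) \<le> \<kappa> * indicat_real (cball 0 R) (x + z)"
        proof (cases "norm (x + z) \<le> R")
          case True
          have z1: "norm z \<le> 1" "norm z < d" using z e d(1) by (auto simp: \<delta>_def)
          have "norm x \<le> R + 1" using norm_triangle_ineq4[of "x + z" z] True z1(1) by simp
          then have "dist (drift \<alpha> (x + z)) (drift \<alpha> x) < \<kappa>"
            using d(2)[of x "x + z"] True z1(2) by (simp add: dist_norm[of "x + z" x])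
          then have "norm (drift \<alpha> (x + z) - drift \<alpha> x) * norm (\<phi> (x + z)) \<le> \<kappa> * 1"
            using \<kappa> by (intro mult_mono \<phi>1(2)) (auto simp: dist_norm)
          then show ?thesis
            using norm_cauchy_schwarz[of "drift \<alpha> (x + z) - drift \<alpha> x" "\<phi> (x + z)"] True by simp
        qed (simp add: R)
        then show "indicat_real A x * hermite_div \<alpha> \<phi> (x + z)
            \<le> indicat_real A x * hermite_div \<alpha> ?\<psi> x + \<kappa> * indicat_real (cball 0 R) (x + z)"
          unfolding hermite_div_translate[OF \<phi>1(1)] using \<kappa> by (simp add: indicator_def)
      qed
      also have "\<dots> = (LINT x|lborel. indicat_real A x * hermite_div \<alpha> ?\<psi> x) + \<kappa> * (LINT x|lborel. indicat_real (cball 0 R) (x + z))"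
        using i1 i2 by (simp add: Bochner_Integration.integral_add)
      also have "(LINT x|lborel. indicat_real (cball 0 R) (x + z)) = V"
        unfolding V_def by (intro integral_lborel_shift borel_measurable_indicator borel_closed closed_cball)
      finally show "(LINT x|lborel. indicat_real A (x - z) * hermite_div \<alpha> \<phi> x) \<le> p + \<eta>"
        using le[OF \<psi>] \<kappa>V by linarith
    qed
  qed
  moreover have "\<delta> > 0" using d by (simp add: \<delta>_def)
  ultimately show ?thesis by blast
qed

text \<open>
  The second function \<open>w\<close> satisfies \<open>w' = s * \<sigma>'\<close>, where \<open>\<sigma>\<close> is the first one, and
  \<open>s * \<sigma> = sqrt (s\<^sup>2 + \<delta>\<^sup>2) + w\<close>.
\<close>

lemma smooth_sign_derivatives:
  fixes s \<delta> :: real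
  assumes "0 < \<delta>"
  defines "S \<equiv> sqrt (s\<^sup>2 + \<delta>\<^sup>2)"
  shows "((\<lambda>s. s / sqrt (s\<^sup>2 + \<delta>\<^sup>2)) has_real_derivative \<delta>\<^sup>2 / S ^ 3) (at s)"
    and "((\<lambda>s. - \<delta>\<^sup>2 / sqrt (s\<^sup>2 + \<delta>\<^sup>2)) has_real_derivative s * (\<delta>\<^sup>2 / S ^ 3)) (at s)"
proof -
  have pos: "0 < s\<^sup>2 + \<delta>\<^sup>2" using assms by (simp add: add_nonneg_pos)
  have S: "0 < S" "S\<^sup>2 = s\<^sup>2 + \<delta>\<^sup>2"
    unfolding S_def by (rule real_sqrt_gt_zero[OF pos]) (simp add: less_imp_le[OF pos])
  have dS: "((\<lambda>s. sqrt (s\<^sup>2 + \<delta>\<^sup>2)) has_real_derivative s / S) (at s)"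
  proof -
    have "((\<lambda>s. s\<^sup>2 + \<delta>\<^sup>2) has_real_derivative 2 * s) (at s)" by (auto intro!: derivative_eq_intros)
    from DERIV_chain2[OF DERIV_real_sqrt[OF pos] this] show ?thesis
      by (simp add: S_def field_simps)
  qed
  have S0: "sqrt (s\<^sup>2 + \<delta>\<^sup>2) \<noteq> 0" using S(1) unfolding S_def by (rule less_imp_neq[THEN not_sym])
  have "((\<lambda>s. s / sqrt (s\<^sup>2 + \<delta>\<^sup>2)) has_real_derivative (1 * S - s * (s / S)) / (S * S)) (at s)"
    using DERIV_divide[OF DERIV_ident dS S0] by (simp add: S_def)
  moreover have "(1 * S - s * (s / S)) / (S * S) = \<delta>\<^sup>2 / S ^ 3"
    using S by (simp add: field_simps power2_eq_square power3_eq_cube)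
  ultimately show "((\<lambda>s. s / sqrt (s\<^sup>2 + \<delta>\<^sup>2)) has_real_derivative \<delta>\<^sup>2 / S ^ 3) (at s)" by simp
  have "((\<lambda>s. - \<delta>\<^sup>2 / sqrt (s\<^sup>2 + \<delta>\<^sup>2)) has_real_derivative (0 * S - (- \<delta>\<^sup>2) * (s / S)) / (S * S)) (at s)"
    using DERIV_divide[OF DERIV_const[of "- \<delta>\<^sup>2"] dS S0] unfolding S_def .
  moreover have "(0 * S - (- \<delta>\<^sup>2) * (s / S)) / (S * S) = s * (\<delta>\<^sup>2 / S ^ 3)"
    using S(1) by (simp add: field_simps power3_eq_cube)
  ultimately show "((\<lambda>s. - \<delta>\<^sup>2 / sqrt (s\<^sup>2 + \<delta>\<^sup>2)) has_real_derivative s * (\<delta>\<^sup>2 / S ^ 3)) (at s)" by simp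
qed

text \<open>
  The field \<open>\<psi>\<close> passes from \<open>\<phi>\<^sub>2\<close> to \<open>\<phi>\<^sub>1\<close> where \<open>h\<close> changes from negative to positive. With \<open>\<sigma>\<close>
  a smooth sign of \<open>h\<close>, \<open>S\<close> a smooth absolute value and \<open>\<zeta> = \<phi>\<^sub>1 - \<phi>\<^sub>2\<close>, the identity
  \<open>h * L (\<sigma> \<zeta>) = S * L \<zeta> + L (w \<zeta>)\<close> holds exactly for \<open>w = h * \<sigma> - S\<close>, since the gradients of
  \<open>w\<close> and of \<open>\<sigma>\<close> differ by the factor \<open>h\<close>. The last term integrates to a drift integral, which is small
  because \<open>\<bar>w\<bar> \<le> \<delta>\<close>.
\<close>

lemma switched_field:
  fixes \<phi>\<^sub>1 \<phi>\<^sub>2 :: "real^'d::finite \<Rightarrow> real^('d + 'd)" and h :: "real^'d \<Rightarrow> real"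
  assumes \<alpha>: "1 \<le> \<alpha>" and \<phi>: "\<phi>\<^sub>1 \<in> unit_fields" "\<phi>\<^sub>2 \<in> unit_fields"
    and R: "\<And>x. R < norm x \<Longrightarrow> \<phi>\<^sub>1 x = 0" "\<And>x. R < norm x \<Longrightarrow> \<phi>\<^sub>2 x = 0"
    and h: "\<And>x. (h has_derivative (\<lambda>v. G x \<bullet> v)) (at x)" and G: "continuous_on UNIV G"
    and \<eta>: "0 < \<eta>"
  shows "\<exists>\<psi>\<in>unit_fields. (\<forall>x. R < norm x \<longrightarrow> \<psi> x = 0) \<and> (\<lambda>x. \<phi>\<^sub>1 x + \<phi>\<^sub>2 x - \<psi> x) \<in> unit_fields \<and>
    (LINT x|lborel. max (h x) 0 * hermite_div \<alpha> \<phi>\<^sub>1 x + min (h x) 0 * hermite_div \<alpha> \<phi>\<^sub>2 x)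
      \<le> (LINT x|lborel. h x * hermite_div \<alpha> \<psi> x) + \<eta>"
proof -
  let ?L = "hermite_div \<alpha>"
  have C1: "C1_compact_support \<phi>\<^sub>1" "C1_compact_support \<phi>\<^sub>2" and n1: "norm (\<phi>\<^sub>1 x) \<le> 1" "norm (\<phi>\<^sub>2 x) \<le> 1" for x
    using \<phi> by (auto simp: unit_fields_def)
  have hc: "continuous_on UNIV h"
    by (intro continuous_at_imp_continuous_on ballI has_derivative_continuous[OF h])
  define \<zeta> where "\<zeta> x = 1 *\<^sub>R \<phi>\<^sub>1 x + (-1) *\<^sub>R \<phi>\<^sub>2 x" for x
  have \<zeta>: "C1_compact_support \<zeta>" unfolding \<zeta>_def by (rule C1_compact_support_add[OF C1])
  have L\<zeta>: "?L \<zeta> x = ?L \<phi>\<^sub>1 x - ?L \<phi>\<^sub>2 x" for x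
    unfolding \<zeta>_def hermite_div_add[OF C1] by simp
  have R\<zeta>: "\<zeta> x = 0" if "R < norm x" for x using R that by (simp add: \<zeta>_def)
  define C where "C = (LINT x|lborel. \<bar>?L \<zeta> x\<bar>) + (LINT x|lborel. \<bar>drift \<alpha> x \<bullet> \<zeta> x\<bar>)"
  have C: "0 \<le> C" unfolding C_def by (intro add_nonneg_nonneg integral_nonneg) auto
  \<comment> \<open>All errors are at most \<open>\<delta> * C\<close>; the summand 1 avoids division by zero.\<close>
  define \<delta> where "\<delta> = \<eta> / (C + 1)"
  have \<delta>: "0 < \<delta>" "\<delta> * C \<le> \<eta>" using C \<eta> by (auto simp: \<delta>_def field_simps)
  define S where "S x = sqrt ((h x)\<^sup>2 + \<delta>\<^sup>2)" for x
  define \<sigma> where "\<sigma> x = h x / S x" for x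
  define w where "w x = - \<delta>\<^sup>2 / S x" for x
  have S2: "(S x)\<^sup>2 = (h x)\<^sup>2 + \<delta>\<^sup>2" for x by (simp add: S_def)
  have S\<delta>: "\<delta> \<le> S x" "\<bar>h x\<bar> \<le> S x" "S x \<le> \<bar>h x\<bar> + \<delta>" for x
  proof -
    show "\<delta> \<le> S x" "\<bar>h x\<bar> \<le> S x" unfolding S_def by (auto intro!: real_le_rsqrt)
    show "S x \<le> \<bar>h x\<bar> + \<delta>" unfolding S_def using \<delta> by (intro real_le_lsqrt) (auto simp: power2_sum)
  qed
  have S0: "0 < S x" for x using S\<delta>(1)[of x] \<delta>(1) by linarith
  have Sc: "continuous_on UNIV S" unfolding S_def by (intro continuous_intros hc)
  have d\<sigma>: "(\<sigma> has_derivative (\<lambda>v. ((\<delta>\<^sup>2 / S x ^ 3) *\<^sub>R G x) \<bullet> v)) (at x)" for x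
    using DERIV_compose_FDERIV[OF smooth_sign_derivatives(1)[OF \<delta>(1)] h[of x]]
    unfolding \<sigma>_def S_def by (simp add: mult.commute)
  have dw: "(w has_derivative (\<lambda>v. ((h x * (\<delta>\<^sup>2 / S x ^ 3)) *\<^sub>R G x) \<bullet> v)) (at x)" for x
    using DERIV_compose_FDERIV[OF smooth_sign_derivatives(2)[OF \<delta>(1)] h[of x]]
    unfolding w_def S_def by (simp add: mult.commute)
  have G\<sigma>: "continuous_on UNIV (\<lambda>x. (\<delta>\<^sup>2 / S x ^ 3) *\<^sub>R G x)"
    by (intro continuous_intros Sc G) (use S0 in \<open>simp add: less_imp_neq[THEN not_sym]\<close>)
  have Gw: "continuous_on UNIV (\<lambda>x. (h x * (\<delta>\<^sup>2 / S x ^ 3)) *\<^sub>R G x)"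
    by (intro continuous_intros Sc G hc) (use S0 in \<open>simp add: less_imp_neq[THEN not_sym]\<close>)
  define \<xi> where "\<xi> x = \<sigma> x *\<^sub>R \<zeta> x" for x
  define \<omega> where "\<omega> x = w x *\<^sub>R \<zeta> x" for x
  have \<xi>: "C1_compact_support \<xi>" unfolding \<xi>_def by (rule C1_compact_support_scaleR[OF \<zeta> d\<sigma> G\<sigma>])
  have \<omega>: "C1_compact_support \<omega>" unfolding \<omega>_def by (rule C1_compact_support_scaleR[OF \<zeta> dw Gw])
  have h\<sigma>: "h x * \<sigma> x = S x + w x" for x
    using S0[of x] S2[of x] by (simp add: \<sigma>_def w_def field_simps power2_eq_square)
  have pointwise: "h x * ?L \<xi> x = S x * ?L \<zeta> x + ?L \<omega> x" for x
    unfolding \<xi>_def \<omega>_def hermite_div_scaleR[OF \<zeta> d\<sigma>] hermite_div_scaleR[OF \<zeta> dw]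
    using h\<sigma>[of x] by (simp add: distrib_left mult.assoc[symmetric]) (simp add: algebra_simps)
  have int: "integrable lborel (\<lambda>x. k x * ?L \<phi> x)"
    if k: "continuous_on UNIV k" and f: "C1_compact_support \<phi>" for k \<phi>
  proof -
    obtain R' where "\<And>x. R' < norm x \<Longrightarrow> \<phi> x = 0" using f by (elim C1_compact_supportE) blast
    then show ?thesis
      by (rule integrable_continuous_mult[OF k hermite_div_regular(1)[OF \<alpha> f] hermite_div_regular(2)[OF \<alpha> f]])
  qed
  have habs: "continuous_on UNIV (\<lambda>x. \<bar>h x\<bar>)" by (intro continuous_intros hc)
  have sign: "(LINT x|lborel. \<bar>h x\<bar> * ?L \<zeta> x) \<le> (LINT x|lborel. h x * ?L \<xi> x) + \<delta> * C"
  proof -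
    have "(LINT x|lborel. h x * ?L \<xi> x) = (LINT x|lborel. S x * ?L \<zeta> x) + (LINT x|lborel. ?L \<omega> x)"
      unfolding pointwise
      by (rule Bochner_Integration.integral_add[OF int[OF Sc \<zeta>] hermite_div_integrable(1)[OF \<alpha> \<omega>]])
    moreover have "- \<delta> * (LINT x|lborel. \<bar>drift \<alpha> x \<bullet> \<zeta> x\<bar>) \<le> (LINT x|lborel. ?L \<omega> x)"
      unfolding integral_hermite_div[OF \<alpha> \<omega>] integral_mult_right_zero[symmetric]
    proof (rule integral_mono)
      show "integrable lborel (\<lambda>x. - \<delta> * \<bar>drift \<alpha> x \<bullet> \<zeta> x\<bar>)"
        by (intro integrable_mult_right integrable_abs hermite_div_integrable(2)[OF \<alpha> \<zeta>])
      show "- \<delta> * \<bar>drift \<alpha> x \<bullet> \<zeta> x\<bar> \<le> drift \<alpha> x \<bullet> \<omega> x" for x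
      proof -
        have "\<delta>\<^sup>2 / S x \<le> \<delta>" using S\<delta>(1)[of x] S0[of x] \<delta>(1) by (simp add: field_simps power2_eq_square)
        then have "\<bar>w x\<bar> \<le> \<delta>" using S0[of x] by (simp add: w_def)
        then have "\<bar>w x\<bar> * \<bar>drift \<alpha> x \<bullet> \<zeta> x\<bar> \<le> \<delta> * \<bar>drift \<alpha> x \<bullet> \<zeta> x\<bar>" by (rule mult_right_mono) simp
        then show ?thesis unfolding \<omega>_def by (simp add: abs_mult[symmetric] abs_le_iff)
      qed
    qed (rule hermite_div_integrable(2)[OF \<alpha> \<omega>])
    moreover have "(LINT x|lborel. \<bar>h x\<bar> * ?L \<zeta> x) \<le> (LINT x|lborel. S x * ?L \<zeta> x + \<delta> * \<bar>?L \<zeta> x\<bar>)"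
    proof (rule integral_mono[OF int[OF habs \<zeta>]])
      show "integrable lborel (\<lambda>x. S x * ?L \<zeta> x + \<delta> * \<bar>?L \<zeta> x\<bar>)"
        by (intro Bochner_Integration.integrable_add int Sc \<zeta> integrable_mult_right integrable_abs hermite_div_integrable(1)[OF \<alpha> \<zeta>])
      show "\<bar>h x\<bar> * ?L \<zeta> x \<le> S x * ?L \<zeta> x + \<delta> * \<bar>?L \<zeta> x\<bar>" for x
      proof -
        have "\<bar>(\<bar>h x\<bar> - S x) * ?L \<zeta> x\<bar> \<le> \<delta> * \<bar>?L \<zeta> x\<bar>"
          unfolding abs_mult by (rule mult_right_mono) (use S\<delta>[of x] in auto)
        then show ?thesis by (simp add: left_diff_distrib abs_le_iff)
      qed
    qed
    moreover have "(LINT x|lborel. S x * ?L \<zeta> x + \<delta> * \<bar>?L \<zeta> x\<bar>)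
        = (LINT x|lborel. S x * ?L \<zeta> x) + \<delta> * (LINT x|lborel. \<bar>?L \<zeta> x\<bar>)"
      using int[OF Sc \<zeta>] hermite_div_integrable(1)[OF \<alpha> \<zeta>] by (subst Bochner_Integration.integral_add) auto
    ultimately show ?thesis unfolding C_def by (simp add: distrib_left)
  qed
  define \<mu> where "\<mu> x = (1/2) *\<^sub>R \<phi>\<^sub>1 x + (1/2) *\<^sub>R \<phi>\<^sub>2 x" for x
  define \<psi> where "\<psi> x = 1 *\<^sub>R \<mu> x + (1/2) *\<^sub>R \<xi> x" for x
  have \<mu>: "C1_compact_support \<mu>" unfolding \<mu>_def by (rule C1_compact_support_add[OF C1])
  have \<psi>: "C1_compact_support \<psi>" unfolding \<psi>_def by (rule C1_compact_support_add[OF \<mu> \<xi>])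
  have \<psi>': "C1_compact_support (\<lambda>x. 1 *\<^sub>R \<mu> x + (- 1/2) *\<^sub>R \<xi> x)" by (rule C1_compact_support_add[OF \<mu> \<xi>])
  have L\<psi>: "?L \<psi> x = (?L \<phi>\<^sub>1 x + ?L \<phi>\<^sub>2 x) / 2 + ?L \<xi> x / 2" for x
    unfolding \<psi>_def hermite_div_add[OF \<mu> \<xi>] unfolding \<mu>_def hermite_div_add[OF C1] by simp
  have \<psi>_alt: "\<psi> x = ((1 + \<sigma> x) / 2) *\<^sub>R \<phi>\<^sub>1 x + ((1 - \<sigma> x) / 2) *\<^sub>R \<phi>\<^sub>2 x" for x
    by (simp add: \<psi>_def \<mu>_def \<xi>_def \<zeta>_def algebra_simps add_divide_distrib diff_divide_distrib)
  have \<psi>'_eq: "(\<lambda>x. \<phi>\<^sub>1 x + \<phi>\<^sub>2 x - \<psi> x) = (\<lambda>x. 1 *\<^sub>R \<mu> x + (- 1/2) *\<^sub>R \<xi> x)"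
  proof
    fix x
    have half: "(1/2) *\<^sub>R a + (1/2) *\<^sub>R a = a" for a :: "real^('d+'d)"
      by (simp add: scaleR_left_distrib[symmetric])
    have "\<mu> x + \<mu> x = ((1/2) *\<^sub>R \<phi>\<^sub>1 x + (1/2) *\<^sub>R \<phi>\<^sub>1 x) + ((1/2) *\<^sub>R \<phi>\<^sub>2 x + (1/2) *\<^sub>R \<phi>\<^sub>2 x)"
      by (simp only: \<mu>_def ac_simps)
    then have "\<phi>\<^sub>1 x + \<phi>\<^sub>2 x = \<mu> x + \<mu> x" by (simp only: half)
    then show "\<phi>\<^sub>1 x + \<phi>\<^sub>2 x - \<psi> x = 1 *\<^sub>R \<mu> x + (- 1/2) *\<^sub>R \<xi> x" by (simp add: \<psi>_def)
  qed
  have \<psi>'_alt: "\<phi>\<^sub>1 x + \<phi>\<^sub>2 x - \<psi> x = ((1 - \<sigma> x) / 2) *\<^sub>R \<phi>\<^sub>1 x + ((1 + \<sigma> x) / 2) *\<^sub>R \<phi>\<^sub>2 x" for x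
    unfolding fun_cong[OF \<psi>'_eq]
    by (simp add: \<mu>_def \<xi>_def \<zeta>_def algebra_simps add_divide_distrib diff_divide_distrib)
  have conv: "norm (((1 + t) / 2) *\<^sub>R a + ((1 - t) / 2) *\<^sub>R b) \<le> 1"
    if "\<bar>t\<bar> \<le> 1" "norm a \<le> 1" "norm b \<le> 1" for t :: real and a b :: "real^('d+'d)"
  proof -
    have "norm (((1 + t) / 2) *\<^sub>R a + ((1 - t) / 2) *\<^sub>R b) \<le> (1 + t) / 2 * norm a + (1 - t) / 2 * norm b"
      using norm_triangle_ineq[of "((1 + t) / 2) *\<^sub>R a" "((1 - t) / 2) *\<^sub>R b"] that(1) by simp
    also have "\<dots> \<le> (1 + t) / 2 * 1 + (1 - t) / 2 * 1"
      using that by (intro add_mono mult_left_mono) auto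
    finally show ?thesis by (simp add: field_simps)
  qed
  have \<sigma>1: "\<bar>\<sigma> x\<bar> \<le> 1" for x using S\<delta>(2)[of x] S0[of x] by (simp add: \<sigma>_def)
  have "norm (\<psi> x) \<le> 1" for x unfolding \<psi>_alt by (rule conv[OF \<sigma>1 n1])
  then have A1: "\<psi> \<in> unit_fields" using \<psi> by (simp add: unit_fields_def)
  have "norm (\<phi>\<^sub>1 x + \<phi>\<^sub>2 x - \<psi> x) \<le> 1" for x
    unfolding \<psi>'_alt using conv[of "- \<sigma> x" "\<phi>\<^sub>1 x" "\<phi>\<^sub>2 x"] \<sigma>1[of x] n1 by simp
  moreover have "C1_compact_support (\<lambda>x. \<phi>\<^sub>1 x + \<phi>\<^sub>2 x - \<psi> x)" unfolding \<psi>'_eq by (rule \<psi>')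
  ultimately have A2: "(\<lambda>x. \<phi>\<^sub>1 x + \<phi>\<^sub>2 x - \<psi> x) \<in> unit_fields"
    by (simp add: unit_fields_def)
  have A3: "\<forall>x. R < norm x \<longrightarrow> \<psi> x = 0" using R by (simp add: \<psi>_alt)
  have "(LINT x|lborel. max (h x) 0 * ?L \<phi>\<^sub>1 x + min (h x) 0 * ?L \<phi>\<^sub>2 x)
      = (LINT x|lborel. (h x * ?L \<phi>\<^sub>1 x + h x * ?L \<phi>\<^sub>2 x) / 2 + \<bar>h x\<bar> * ?L \<zeta> x / 2)"
    by (intro Bochner_Integration.integral_cong) (auto simp: L\<zeta> max_def min_def field_simps)
  also have "\<dots> = (LINT x|lborel. (h x * ?L \<phi>\<^sub>1 x + h x * ?L \<phi>\<^sub>2 x) / 2) + (LINT x|lborel. \<bar>h x\<bar> * ?L \<zeta> x) / 2"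
    using int[OF hc C1(1)] int[OF hc C1(2)] int[OF habs \<zeta>] by (subst Bochner_Integration.integral_add) auto
  also have "\<dots> \<le> (LINT x|lborel. (h x * ?L \<phi>\<^sub>1 x + h x * ?L \<phi>\<^sub>2 x) / 2) + ((LINT x|lborel. h x * ?L \<xi> x) + \<eta>) / 2"
    using sign \<delta>(2) by (intro add_left_mono divide_right_mono) auto
  also have "\<dots> = (LINT x|lborel. (h x * ?L \<phi>\<^sub>1 x + h x * ?L \<phi>\<^sub>2 x) / 2 + h x * ?L \<xi> x / 2) + \<eta> / 2"
    using int[OF hc C1(1)] int[OF hc C1(2)] int[OF hc \<xi>] by (subst Bochner_Integration.integral_add) (auto simp: add_divide_distrib)
  also have "(LINT x|lborel. (h x * ?L \<phi>\<^sub>1 x + h x * ?L \<phi>\<^sub>2 x) / 2 + h x * ?L \<xi> x / 2) = (LINT x|lborel. h x * ?L \<psi> x)"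
    by (intro Bochner_Integration.integral_cong) (auto simp: L\<psi> field_simps)
  finally have "(LINT x|lborel. max (h x) 0 * ?L \<phi>\<^sub>1 x + min (h x) 0 * ?L \<phi>\<^sub>2 x)
      \<le> (LINT x|lborel. h x * ?L \<psi> x) + \<eta>" using \<eta> by simp
  then show ?thesis using A1 A2 A3 by blast
qed

text \<open>
  The functions \<open>k\<close> of interest are lattice operations, which turn the indicators of two sets into those of
  their union, intersection and differences.
\<close>

lemma mollified_combination:
  fixes A B :: "(real^'d::finite) set" and k :: "real \<Rightarrow> real \<Rightarrow> real"
  assumes \<alpha>: "1 \<le> \<alpha>" and A [measurable]: "A \<in> sets borel" and B [measurable]: "B \<in> sets borel"
    and \<eta>: "0 < \<eta>" and \<phi>: "C1_compact_support \<phi>"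
    and k: "\<And>a b a' b'. \<bar>k a b - k a' b'\<bar> \<le> \<bar>a - a'\<bar> + \<bar>b - b'\<bar>"
    and kc: "continuous_on UNIV (\<lambda>p. k (fst p) (snd p))"
  shows "\<exists>\<delta>>0. \<forall>e. 0 < e \<and> e \<le> \<delta> \<longrightarrow>
    (LINT x|lborel. k (indicat_real A x) (indicat_real B x) * hermite_div \<alpha> \<phi> x)
      \<le> (LINT x|lborel. k (mollify e A x) (mollify e B x) * hermite_div \<alpha> \<phi> x) + \<eta>"
proof -
  let ?L = "hermite_div \<alpha> \<phi>"
  obtain R where R: "\<And>x. R < norm x \<Longrightarrow> \<phi> x = 0" using \<phi> by (elim C1_compact_supportE) blast
  note Lc = hermite_div_regular(1)[OF \<alpha> \<phi>]
  have L0: "?L x = 0" if "R < norm x" for x by (rule hermite_div_regular(2)[OF \<alpha> \<phi> R that])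
  have Lm [measurable]: "?L \<in> borel_measurable borel" by (rule borel_measurable_continuous_onI[OF Lc])
  obtain M where M: "M > 0" "\<And>x. \<bar>?L x\<bar> \<le> M"
    using bounded_continuous_compact_support[OF Lc L0] by auto
  have \<tau>: "0 < \<eta> / (2 * M)" using \<eta> M by simp
  obtain \<delta>1 where \<delta>1: "\<delta>1 > 0" "\<And>e. 0 < e \<Longrightarrow> e \<le> \<delta>1 \<Longrightarrow>
    (LINT x|lborel. indicat_real (cball 0 R) x * \<bar>mollify e A x - indicat_real A x\<bar>) \<le> \<eta> / (2 * M)"
    using mollify_L1[OF A \<tau>, of R] by metis
  obtain \<delta>2 where \<delta>2: "\<delta>2 > 0" "\<And>e. 0 < e \<Longrightarrow> e \<le> \<delta>2 \<Longrightarrow>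
    (LINT x|lborel. indicat_real (cball 0 R) x * \<bar>mollify e B x - indicat_real B x\<bar>) \<le> \<eta> / (2 * M)"
    using mollify_L1[OF B \<tau>, of R] by metis
  have "(LINT x|lborel. k (indicat_real A x) (indicat_real B x) * ?L x)
      \<le> (LINT x|lborel. k (mollify e A x) (mollify e B x) * ?L x) + \<eta>"
    if e: "0 < e" "e \<le> min \<delta>1 \<delta>2" for e
  proof -
    have [measurable]: "mollify e A \<in> borel_measurable borel" "mollify e B \<in> borel_measurable borel"
      by (rule borel_measurable_continuous_onI[OF mollify_continuous[OF e(1)]], measurable)+
    define \<Delta> where "\<Delta> C x = indicat_real (cball 0 R) x * \<bar>mollify e C x - indicat_real C x\<bar>" for C :: "(real^'d) set" and x
    have mol: "0 \<le> mollify e C x" "mollify e C x \<le> 1" if "C \<in> sets borel" for C and x :: "real^'d"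
      using mollify_nonneg[OF e(1)] mollify_le_1[OF e(1) that] by auto
    have \<Delta>_int: "integrable lborel (\<Delta> C)" if C [measurable]: "C \<in> sets borel" for C
    proof (rule Bochner_Integration.integrable_bound[OF integrable_indicator_cball[of R]])
      have [measurable]: "mollify e C \<in> borel_measurable borel"
        by (rule borel_measurable_continuous_onI[OF mollify_continuous[OF e(1) C]])
      have [measurable]: "cball (0::real^'d) R \<in> sets borel" by simp
      show "\<Delta> C \<in> borel_measurable lborel" unfolding \<Delta>_def by measurable
      have "\<bar>mollify e C x - indicat_real C x\<bar> \<le> 1" for x
        using mol[OF C, of x] by (auto simp: indicator_def)
      then show "AE x in lborel. norm (\<Delta> C x) \<le> norm (indicat_real (cball 0 R) x)"
        by (auto simp: indicator_def \<Delta>_def)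
    qed
    have k_bound: "\<bar>k a b\<bar> \<le> \<bar>k 0 0\<bar> + 2" if "0 \<le> a" "a \<le> 1" "0 \<le> b" "b \<le> 1" for a b
      using k[of a b 0 0] that by linarith
    have k_int: "integrable lborel (\<lambda>x. k (f x) (g x) * ?L x)"
      if [measurable]: "f \<in> borel_measurable borel" "g \<in> borel_measurable borel"
        and fg: "\<And>x. 0 \<le> f x" "\<And>x. f x \<le> 1" "\<And>x. 0 \<le> g x" "\<And>x. g x \<le> 1" for f g
    proof (rule Bochner_Integration.integrable_bound)
      show "integrable lborel (\<lambda>x. (\<bar>k 0 0\<bar> + 2) * ?L x)"
        by (intro integrable_mult_right hermite_div_integrable(1)[OF \<alpha> \<phi>])
      have "(\<lambda>x. k (f x) (g x)) \<in> borel_measurable borel"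
        by (rule borel_measurable_continuous_Pair[OF _ _ kc]) measurable
      then show "(\<lambda>x. k (f x) (g x) * ?L x) \<in> borel_measurable lborel" by measurable
      show "AE x in lborel. norm (k (f x) (g x) * ?L x) \<le> norm ((\<bar>k 0 0\<bar> + 2) * ?L x)"
        by (intro AE_I2) (simp add: abs_mult mult_right_mono k_bound fg)
    qed
    have i1: "integrable lborel (\<lambda>x. k (indicat_real A x) (indicat_real B x) * ?L x)"
      by (rule k_int) auto
    have i2: "integrable lborel (\<lambda>x. k (mollify e A x) (mollify e B x) * ?L x)"
      by (rule k_int) (auto simp: mol)
    have i3: "integrable lborel (\<lambda>x. M * (\<Delta> A x + \<Delta> B x))"
      by (intro integrable_mult_right Bochner_Integration.integrable_add \<Delta>_int A B)
    have "(LINT x|lborel. k (indicat_real A x) (indicat_real B x) * ?L x)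
        \<le> (LINT x|lborel. k (mollify e A x) (mollify e B x) * ?L x + M * (\<Delta> A x + \<Delta> B x))"
    proof (rule integral_mono[OF i1 Bochner_Integration.integrable_add[OF i2 i3]])
      fix x
      show "k (indicat_real A x) (indicat_real B x) * ?L x
          \<le> k (mollify e A x) (mollify e B x) * ?L x + M * (\<Delta> A x + \<Delta> B x)"
      proof (cases "norm x \<le> R")
        case True
        let ?c = "k (indicat_real A x) (indicat_real B x) - k (mollify e A x) (mollify e B x)"
        have "\<bar>?c\<bar> * \<bar>?L x\<bar> \<le> (\<Delta> A x + \<Delta> B x) * M"
          using k[of "indicat_real A x" "indicat_real B x" "mollify e A x" "mollify e B x"] True
          by (intro mult_mono M) (auto simp: \<Delta>_def abs_minus_commute)
        then have "?c * ?L x \<le> M * (\<Delta> A x + \<Delta> B x)"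
          unfolding abs_mult[symmetric] by (simp add: abs_le_iff mult.commute)
        then show ?thesis by (simp add: left_diff_distrib)
      qed (simp add: L0 \<Delta>_def)
    qed
    also have "\<dots> = (LINT x|lborel. k (mollify e A x) (mollify e B x) * ?L x)
        + M * ((LINT x|lborel. \<Delta> A x) + (LINT x|lborel. \<Delta> B x))"
      using i2 i3 \<Delta>_int[OF A] \<Delta>_int[OF B] by (simp add: Bochner_Integration.integral_add)
    also have "M * ((LINT x|lborel. \<Delta> A x) + (LINT x|lborel. \<Delta> B x)) \<le> M * (\<eta> / (2 * M) + \<eta> / (2 * M))"
      using \<delta>1(2)[of e] \<delta>2(2)[of e] e M(1) by (intro mult_left_mono add_mono) (auto simp: \<Delta>_def)
    also have "\<dots> = \<eta>" using M(1) by simp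
    finally show ?thesis by simp
  qed
  moreover have "0 < min \<delta>1 \<delta>2" using \<delta>1 \<delta>2 by simp
  ultimately show ?thesis by blast
qed

lemma unit_fields_common_support:
  assumes "\<phi>\<^sub>1 \<in> unit_fields" "\<phi>\<^sub>2 \<in> unit_fields"
  obtains R where "\<And>x. R < norm x \<Longrightarrow> \<phi>\<^sub>1 x = 0" "\<And>x. R < norm x \<Longrightarrow> \<phi>\<^sub>2 x = 0"
proof -
  obtain R1 where R1: "\<And>x. R1 < norm x \<Longrightarrow> \<phi>\<^sub>1 x = 0"
    using assms(1) unfolding unit_fields_def by (elim CollectE conjE C1_compact_supportE) blast
  obtain R2 where R2: "\<And>x. R2 < norm x \<Longrightarrow> \<phi>\<^sub>2 x = 0"
    using assms(2) unfolding unit_fields_def by (elim CollectE conjE C1_compact_supportE) blast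
  show thesis by (rule that[of "max R1 R2"]) (auto simp: R1 R2)
qed

lemma mollify_diff_C1:
  fixes A B :: "'a::euclidean_space set"
  assumes "0 < e" "A \<in> sets borel" "B \<in> sets borel"
  obtains G where "\<And>x. ((\<lambda>x. mollify e A x - mollify e B x) has_derivative (\<lambda>v. G x \<bullet> v)) (at x)"
    "continuous_on UNIV G"
proof -
  obtain G1 where G1: "\<And>x. (mollify e A has_derivative (\<lambda>v. G1 x \<bullet> v)) (at x)" "continuous_on UNIV G1"
    using mollify_C1[OF assms(1,2)] by blast
  obtain G2 where G2: "\<And>x. (mollify e B has_derivative (\<lambda>v. G2 x \<bullet> v)) (at x)" "continuous_on UNIV G2"
    using mollify_C1[OF assms(1,3)] by blast
  show thesis
  proof (rule that[of "\<lambda>x. G1 x - G2 x"])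
    show "((\<lambda>x. mollify e A x - mollify e B x) has_derivative (\<lambda>v. (G1 x - G2 x) \<bullet> v)) (at x)" for x
      using has_derivative_diff[OF G1(1)[of x] G2(1)[of x]] by (simp add: inner_diff_left)
  qed (intro continuous_intros G1 G2)
qed

lemma mollify_hermite_integrable:
  fixes A :: "(real^'d::finite) set"
  assumes "1 \<le> \<alpha>" "0 < e" "A \<in> sets borel" "\<phi> \<in> unit_fields"
  shows "integrable lborel (\<lambda>x. mollify e A x * hermite_div \<alpha> \<phi> x)"
proof -
  have C1: "C1_compact_support \<phi>" using assms(4) by (simp add: unit_fields_def)
  then obtain R where R: "\<And>x. R < norm x \<Longrightarrow> \<phi> x = 0" by (elim C1_compact_supportE) blast
  show ?thesis
    by (rule integrable_continuous_mult[OF mollify_continuous[OF assms(2,3)]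
          hermite_div_regular(1)[OF assms(1) C1] hermite_div_regular(2)[OF assms(1) C1 R]])
qed

text \<open>
  With \<open>f\<close>, \<open>g\<close> the mollified indicators, \<open>max f g = max (f - g) 0 + g\<close> and
  \<open>min f g = min (f - g) 0 + g\<close>. Hence the left hand side is close to the flux of the switched
  field \<open>\<psi>\<close> against \<open>f - g\<close> plus that of \<open>\<phi>\<^sub>1 + \<phi>\<^sub>2\<close> against \<open>g\<close>, that is, to the flux of
  \<open>\<psi>\<close> against \<open>f\<close> plus that of \<open>\<phi>\<^sub>1 + \<phi>\<^sub>2 - \<psi>\<close> against \<open>g\<close>.
\<close>

lemma field_submodular:
  fixes A B :: "(real^'d::finite) set"
  assumes \<alpha>: "1 \<le> \<alpha>" and A [measurable]: "A \<in> sets borel" and B [measurable]: "B \<in> sets borel"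
    and p: "\<And>\<phi>. \<phi> \<in> unit_fields \<Longrightarrow> (LINT x|lborel. indicat_real A x * hermite_div \<alpha> \<phi> x) \<le> p"
    and q: "\<And>\<phi>. \<phi> \<in> unit_fields \<Longrightarrow> (LINT x|lborel. indicat_real B x * hermite_div \<alpha> \<phi> x) \<le> q"
    and \<phi>: "\<phi>\<^sub>1 \<in> unit_fields" "\<phi>\<^sub>2 \<in> unit_fields"
  shows "(LINT x|lborel. indicat_real (A \<union> B) x * hermite_div \<alpha> \<phi>\<^sub>1 x)
    + (LINT x|lborel. indicat_real (A \<inter> B) x * hermite_div \<alpha> \<phi>\<^sub>2 x) \<le> p + q"
proof (rule field_le_epsilon)
  fix \<epsilon> :: real assume "0 < \<epsilon>"
  then have \<eta>: "0 < \<epsilon> / 5" by simp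
  have C1: "C1_compact_support \<phi>\<^sub>1" "C1_compact_support \<phi>\<^sub>2" using \<phi> by (auto simp: unit_fields_def)
  obtain R where R: "\<And>x. R < norm x \<Longrightarrow> \<phi>\<^sub>1 x = 0" "\<And>x. R < norm x \<Longrightarrow> \<phi>\<^sub>2 x = 0"
    using unit_fields_common_support[OF \<phi>] by blast
  obtain \<delta>1 where \<delta>1: "\<delta>1 > 0" "\<And>e \<phi>. 0 < e \<Longrightarrow> e \<le> \<delta>1 \<Longrightarrow> \<phi> \<in> unit_fields \<Longrightarrow> (\<And>x. R < norm x \<Longrightarrow> \<phi> x = 0) \<Longrightarrow>
      (LINT x|lborel. mollify e A x * hermite_div \<alpha> \<phi> x) \<le> p + \<epsilon> / 5"
    using mollified_bound[OF \<alpha> A \<eta> p, of R] by metis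
  obtain \<delta>2 where \<delta>2: "\<delta>2 > 0" "\<And>e \<phi>. 0 < e \<Longrightarrow> e \<le> \<delta>2 \<Longrightarrow> \<phi> \<in> unit_fields \<Longrightarrow> (\<And>x. R < norm x \<Longrightarrow> \<phi> x = 0) \<Longrightarrow>
      (LINT x|lborel. mollify e B x * hermite_div \<alpha> \<phi> x) \<le> q + \<epsilon> / 5"
    using mollified_bound[OF \<alpha> B \<eta> q, of R] by metis
  obtain \<delta>3 where \<delta>3: "\<delta>3 > 0" "\<And>e. 0 < e \<Longrightarrow> e \<le> \<delta>3 \<Longrightarrow>
    (LINT x|lborel. max (indicat_real A x) (indicat_real B x) * hermite_div \<alpha> \<phi>\<^sub>1 x)
      \<le> (LINT x|lborel. max (mollify e A x) (mollify e B x) * hermite_div \<alpha> \<phi>\<^sub>1 x) + \<epsilon> / 5"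
    using mollified_combination[OF \<alpha> A B \<eta> C1(1), of max] by (force intro!: continuous_intros)
  obtain \<delta>4 where \<delta>4: "\<delta>4 > 0" "\<And>e. 0 < e \<Longrightarrow> e \<le> \<delta>4 \<Longrightarrow>
    (LINT x|lborel. min (indicat_real A x) (indicat_real B x) * hermite_div \<alpha> \<phi>\<^sub>2 x)
      \<le> (LINT x|lborel. min (mollify e A x) (mollify e B x) * hermite_div \<alpha> \<phi>\<^sub>2 x) + \<epsilon> / 5"
    using mollified_combination[OF \<alpha> A B \<eta> C1(2), of min] by (force intro!: continuous_intros)
  define e where "e = min (min \<delta>1 \<delta>2) (min \<delta>3 \<delta>4)"
  have e: "0 < e" "e \<le> \<delta>1" "e \<le> \<delta>2" "e \<le> \<delta>3" "e \<le> \<delta>4"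
    using \<delta>1(1) \<delta>2(1) \<delta>3(1) \<delta>4(1) by (auto simp: e_def)
  let ?f = "mollify e A" and ?g = "mollify e B" and ?L = "hermite_div \<alpha>"
  obtain G where G: "\<And>x. ((\<lambda>x. ?f x - ?g x) has_derivative (\<lambda>v. G x \<bullet> v)) (at x)" "continuous_on UNIV G"
    using mollify_diff_C1[OF e(1) A B] by blast
  obtain \<psi> where \<psi>: "\<psi> \<in> unit_fields" "\<And>x. R < norm x \<Longrightarrow> \<psi> x = 0" "(\<lambda>x. \<phi>\<^sub>1 x + \<phi>\<^sub>2 x - \<psi> x) \<in> unit_fields"
    and sw: "(LINT x|lborel. max (?f x - ?g x) 0 * ?L \<phi>\<^sub>1 x + min (?f x - ?g x) 0 * ?L \<phi>\<^sub>2 x)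
      \<le> (LINT x|lborel. (?f x - ?g x) * ?L \<psi> x) + \<epsilon> / 5"
    using switched_field[OF \<alpha> \<phi> R G \<eta>] by blast
  let ?\<chi> = "\<lambda>x. \<phi>\<^sub>1 x + \<phi>\<^sub>2 x - \<psi> x"
  have \<psi>C1: "C1_compact_support \<psi>" using \<psi>(1) by (simp add: unit_fields_def)
  have L\<chi>: "?L ?\<chi> x = ?L \<phi>\<^sub>1 x + ?L \<phi>\<^sub>2 x - ?L \<psi> x" for x
    using hermite_div_add[OF C1_compact_support_add[OF C1, of 1 1] \<psi>C1, of \<alpha> 1 "-1" x] hermite_div_add[OF C1, of \<alpha> 1 1 x]
    by simp
  note [simp] = mollify_hermite_integrable[OF \<alpha> e(1)] A B \<phi> \<psi>(1,3)
  have fgc: "continuous_on UNIV ?f" "continuous_on UNIV ?g" by (intro mollify_continuous e A B)+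
  have i: "integrable lborel (\<lambda>x. max (?f x) (?g x) * ?L \<phi>\<^sub>1 x)" "integrable lborel (\<lambda>x. min (?f x) (?g x) * ?L \<phi>\<^sub>2 x)"
    "integrable lborel (\<lambda>x. max (?f x - ?g x) 0 * ?L \<phi>\<^sub>1 x)" "integrable lborel (\<lambda>x. min (?f x - ?g x) 0 * ?L \<phi>\<^sub>2 x)"
    by (rule integrable_continuous_mult[OF _ hermite_div_regular(1)[OF \<alpha>] hermite_div_regular(2)[OF \<alpha>], where R=R];
        use R C1 in \<open>auto intro!: continuous_intros fgc\<close>)+
  have "(LINT x|lborel. max (?f x) (?g x) * ?L \<phi>\<^sub>1 x) + (LINT x|lborel. min (?f x) (?g x) * ?L \<phi>\<^sub>2 x)
     = (LINT x|lborel. max (?f x) (?g x) * ?L \<phi>\<^sub>1 x + min (?f x) (?g x) * ?L \<phi>\<^sub>2 x)"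
    using i by simp
  also have "\<dots> = (LINT x|lborel. (max (?f x - ?g x) 0 * ?L \<phi>\<^sub>1 x + min (?f x - ?g x) 0 * ?L \<phi>\<^sub>2 x)
      + (?g x * ?L \<phi>\<^sub>1 x + ?g x * ?L \<phi>\<^sub>2 x))"
    by (intro Bochner_Integration.integral_cong) (auto simp: max_def min_def algebra_simps)
  also have "\<dots> = (LINT x|lborel. max (?f x - ?g x) 0 * ?L \<phi>\<^sub>1 x + min (?f x - ?g x) 0 * ?L \<phi>\<^sub>2 x)
      + (LINT x|lborel. ?g x * ?L \<phi>\<^sub>1 x + ?g x * ?L \<phi>\<^sub>2 x)"
    using i by (intro Bochner_Integration.integral_add Bochner_Integration.integrable_add) simp_all
  also have "\<dots> \<le> (LINT x|lborel. (?f x - ?g x) * ?L \<psi> x) + (LINT x|lborel. ?g x * ?L \<phi>\<^sub>1 x + ?g x * ?L \<phi>\<^sub>2 x) + \<epsilon> / 5"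
    using sw by simp
  also have "(LINT x|lborel. (?f x - ?g x) * ?L \<psi> x) + (LINT x|lborel. ?g x * ?L \<phi>\<^sub>1 x + ?g x * ?L \<phi>\<^sub>2 x)
      = (LINT x|lborel. ?f x * ?L \<psi> x) + (LINT x|lborel. ?g x * ?L ?\<chi> x)"
    unfolding L\<chi> by (simp add: left_diff_distrib right_diff_distrib distrib_left)
  also have "(LINT x|lborel. ?f x * ?L \<psi> x) \<le> p + \<epsilon> / 5"
    by (rule \<delta>1(2)[OF e(1,2) \<psi>(1,2)])
  also have "(LINT x|lborel. ?g x * ?L ?\<chi> x) \<le> q + \<epsilon> / 5"
    by (rule \<delta>2(2)[OF e(1,3) \<psi>(3)]) (simp add: R \<psi>(2))
  finally have mid: "(LINT x|lborel. max (?f x) (?g x) * ?L \<phi>\<^sub>1 x) + (LINT x|lborel. min (?f x) (?g x) * ?L \<phi>\<^sub>2 x)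
      \<le> p + q + 3 * (\<epsilon> / 5)" by simp
  have "indicat_real (A \<union> B) = (\<lambda>x. max (indicat_real A x) (indicat_real B x))"
    "indicat_real (A \<inter> B) = (\<lambda>x. min (indicat_real A x) (indicat_real B x))"
    by (auto simp: indicator_def fun_eq_iff)
  then show "(LINT x|lborel. indicat_real (A \<union> B) x * ?L \<phi>\<^sub>1 x) + (LINT x|lborel. indicat_real (A \<inter> B) x * ?L \<phi>\<^sub>2 x)
      \<le> p + q + \<epsilon>"
    using mid \<delta>3(2)[OF e(1,4)] \<delta>4(2)[OF e(1,5)] by simp
qed

text \<open>
  Here one switches between \<open>\<phi>\<^sub>1\<close> and \<open>- \<phi>\<^sub>2\<close>, and tests \<open>A\<close> with the resulting field and \<open>B\<close>
  with its negative.
\<close>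

lemma field_posimodular:
  fixes A B :: "(real^'d::finite) set"
  assumes \<alpha>: "1 \<le> \<alpha>" and A [measurable]: "A \<in> sets borel" and B [measurable]: "B \<in> sets borel"
    and p: "\<And>\<phi>. \<phi> \<in> unit_fields \<Longrightarrow> (LINT x|lborel. indicat_real A x * hermite_div \<alpha> \<phi> x) \<le> p"
    and q: "\<And>\<phi>. \<phi> \<in> unit_fields \<Longrightarrow> (LINT x|lborel. indicat_real B x * hermite_div \<alpha> \<phi> x) \<le> q"
    and \<phi>: "\<phi>\<^sub>1 \<in> unit_fields" "\<phi>\<^sub>2 \<in> unit_fields"
  shows "(LINT x|lborel. indicat_real (A - B) x * hermite_div \<alpha> \<phi>\<^sub>1 x)
    + (LINT x|lborel. indicat_real (B - A) x * hermite_div \<alpha> \<phi>\<^sub>2 x) \<le> p + q"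
proof (rule field_le_epsilon)
  fix \<epsilon> :: real assume "0 < \<epsilon>"
  then have \<eta>: "0 < \<epsilon> / 5" by simp
  have C1: "C1_compact_support \<phi>\<^sub>1" "C1_compact_support \<phi>\<^sub>2" using \<phi> by (auto simp: unit_fields_def)
  obtain R where R: "\<And>x. R < norm x \<Longrightarrow> \<phi>\<^sub>1 x = 0" "\<And>x. R < norm x \<Longrightarrow> \<phi>\<^sub>2 x = 0"
    using unit_fields_common_support[OF \<phi>] by blast
  obtain \<delta>1 where \<delta>1: "\<delta>1 > 0" "\<And>e \<phi>. 0 < e \<Longrightarrow> e \<le> \<delta>1 \<Longrightarrow> \<phi> \<in> unit_fields \<Longrightarrow> (\<And>x. R < norm x \<Longrightarrow> \<phi> x = 0) \<Longrightarrow>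
      (LINT x|lborel. mollify e A x * hermite_div \<alpha> \<phi> x) \<le> p + \<epsilon> / 5"
    using mollified_bound[OF \<alpha> A \<eta> p, of R] by metis
  obtain \<delta>2 where \<delta>2: "\<delta>2 > 0" "\<And>e \<phi>. 0 < e \<Longrightarrow> e \<le> \<delta>2 \<Longrightarrow> \<phi> \<in> unit_fields \<Longrightarrow> (\<And>x. R < norm x \<Longrightarrow> \<phi> x = 0) \<Longrightarrow>
      (LINT x|lborel. mollify e B x * hermite_div \<alpha> \<phi> x) \<le> q + \<epsilon> / 5"
    using mollified_bound[OF \<alpha> B \<eta> q, of R] by metis
  obtain \<delta>3 where \<delta>3: "\<delta>3 > 0" "\<And>e. 0 < e \<Longrightarrow> e \<le> \<delta>3 \<Longrightarrow>
    (LINT x|lborel. max (indicat_real A x - indicat_real B x) 0 * hermite_div \<alpha> \<phi>\<^sub>1 x)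
      \<le> (LINT x|lborel. max (mollify e A x - mollify e B x) 0 * hermite_div \<alpha> \<phi>\<^sub>1 x) + \<epsilon> / 5"
    using mollified_combination[OF \<alpha> A B \<eta> C1(1), of "\<lambda>a b. max (a - b) 0"] by (force intro!: continuous_intros)
  obtain \<delta>4 where \<delta>4: "\<delta>4 > 0" "\<And>e. 0 < e \<Longrightarrow> e \<le> \<delta>4 \<Longrightarrow>
    (LINT x|lborel. max (indicat_real B x - indicat_real A x) 0 * hermite_div \<alpha> \<phi>\<^sub>2 x)
      \<le> (LINT x|lborel. max (mollify e B x - mollify e A x) 0 * hermite_div \<alpha> \<phi>\<^sub>2 x) + \<epsilon> / 5"
    using mollified_combination[OF \<alpha> A B \<eta> C1(2), of "\<lambda>a b. max (b - a) 0"] by (force intro!: continuous_intros)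
  define e where "e = min (min \<delta>1 \<delta>2) (min \<delta>3 \<delta>4)"
  have e: "0 < e" "e \<le> \<delta>1" "e \<le> \<delta>2" "e \<le> \<delta>3" "e \<le> \<delta>4"
    using \<delta>1(1) \<delta>2(1) \<delta>3(1) \<delta>4(1) by (auto simp: e_def)
  let ?f = "mollify e A" and ?g = "mollify e B" and ?L = "hermite_div \<alpha>"
  obtain G where G: "\<And>x. ((\<lambda>x. ?f x - ?g x) has_derivative (\<lambda>v. G x \<bullet> v)) (at x)" "continuous_on UNIV G"
    using mollify_diff_C1[OF e(1) A B] by blast
  let ?\<phi>\<^sub>2' = "\<lambda>x. - \<phi>\<^sub>2 x"
  have R': "?\<phi>\<^sub>2' x = 0" if "R < norm x" for x using R that by simp
  obtain \<psi> where \<psi>: "\<psi> \<in> unit_fields" "\<And>x. R < norm x \<Longrightarrow> \<psi> x = 0"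
    and sw: "(LINT x|lborel. max (?f x - ?g x) 0 * ?L \<phi>\<^sub>1 x + min (?f x - ?g x) 0 * ?L ?\<phi>\<^sub>2' x)
      \<le> (LINT x|lborel. (?f x - ?g x) * ?L \<psi> x) + \<epsilon> / 5"
    using switched_field[OF \<alpha> \<phi>(1) unit_fields_uminus(1)[OF \<phi>(2)] R(1) R' G \<eta>] by blast
  note L_minus = unit_fields_uminus(2)[OF \<psi>(1)] unit_fields_uminus(2)[OF \<phi>(2)]
  note [simp] = mollify_hermite_integrable[OF \<alpha> e(1)] A B \<phi> \<psi>(1)
  have fgc: "continuous_on UNIV ?f" "continuous_on UNIV ?g" by (intro mollify_continuous e A B)+
  have i: "integrable lborel (\<lambda>x. max (?f x - ?g x) 0 * ?L \<phi>\<^sub>1 x)" "integrable lborel (\<lambda>x. max (?g x - ?f x) 0 * ?L \<phi>\<^sub>2 x)"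
    by (rule integrable_continuous_mult[OF _ hermite_div_regular(1)[OF \<alpha>] hermite_div_regular(2)[OF \<alpha>], where R=R];
        use R C1 in \<open>auto intro!: continuous_intros fgc\<close>)+
  have "(LINT x|lborel. max (?f x - ?g x) 0 * ?L \<phi>\<^sub>1 x) + (LINT x|lborel. max (?g x - ?f x) 0 * ?L \<phi>\<^sub>2 x)
     = (LINT x|lborel. max (?f x - ?g x) 0 * ?L \<phi>\<^sub>1 x + max (?g x - ?f x) 0 * ?L \<phi>\<^sub>2 x)"
    using i by simp
  also have "\<dots> = (LINT x|lborel. max (?f x - ?g x) 0 * ?L \<phi>\<^sub>1 x + min (?f x - ?g x) 0 * ?L ?\<phi>\<^sub>2' x)"
    unfolding L_minus
    by (intro Bochner_Integration.integral_cong) (auto simp: max_def min_def algebra_simps)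
  also note sw
  also have "(LINT x|lborel. (?f x - ?g x) * ?L \<psi> x)
      = (LINT x|lborel. ?f x * ?L \<psi> x) + (LINT x|lborel. ?g x * ?L (\<lambda>x. - \<psi> x) x)"
    unfolding L_minus by (simp add: left_diff_distrib)
  also have "(LINT x|lborel. ?f x * ?L \<psi> x) \<le> p + \<epsilon> / 5"
    by (rule \<delta>1(2)[OF e(1,2) \<psi>(1,2)])
  also have "(LINT x|lborel. ?g x * ?L (\<lambda>x. - \<psi> x) x) \<le> q + \<epsilon> / 5"
    by (rule \<delta>2(2)[OF e(1,3) unit_fields_uminus(1)[OF \<psi>(1)]]) (simp add: \<psi>(2))
  finally have mid: "(LINT x|lborel. max (?f x - ?g x) 0 * ?L \<phi>\<^sub>1 x) + (LINT x|lborel. max (?g x - ?f x) 0 * ?L \<phi>\<^sub>2 x)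
      \<le> p + q + 3 * (\<epsilon> / 5)" by simp
  have "indicat_real (A - B) = (\<lambda>x. max (indicat_real A x - indicat_real B x) 0)"
    "indicat_real (B - A) = (\<lambda>x. max (indicat_real B x - indicat_real A x) 0)"
    by (auto simp: indicator_def fun_eq_iff)
  then show "(LINT x|lborel. indicat_real (A - B) x * ?L \<phi>\<^sub>1 x) + (LINT x|lborel. indicat_real (B - A) x * ?L \<phi>\<^sub>2 x)
      \<le> p + q + \<epsilon>"
    using mid \<delta>3(2)[OF e(1,4)] \<delta>4(2)[OF e(1,5)] by simp
qed

section \<open>Compensating the constraint by a field on an infinite complement\<close>

text \<open>
  The two halves cancel in \<open>fold_halves\<close>, so a scalar multiple of this field by any function has Hermite
  divergence without first order part.
\<close>

definition antidiagonal :: "real^'d::finite \<Rightarrow> real^('d + 'd)" where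
  "antidiagonal x = (\<chi> j. case j of Inl i \<Rightarrow> x $ i / 2 | Inr i \<Rightarrow> - x $ i / 2)"

lemma antidiagonal_component [simp]:
  "antidiagonal x $ Inl i = x $ i / 2" "antidiagonal x $ Inr i = - x $ i / 2"
  by (simp_all add: antidiagonal_def)

lemma antidiagonal_linear: "bounded_linear (antidiagonal :: real^'d::finite \<Rightarrow> _)"
proof -
  have "linear (antidiagonal :: real^'d \<Rightarrow> _)"
  proof (rule linearI)
    fix x y :: "real^'d" and c :: real
    show "antidiagonal (x + y) = antidiagonal x + antidiagonal y"
      unfolding vec_eq_iff antidiagonal_def by (auto simp: field_simps split: sum.split)
    show "antidiagonal (c *\<^sub>R x) = c *\<^sub>R antidiagonal x"
      unfolding vec_eq_iff antidiagonal_def by (auto simp: field_simps split: sum.split)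
  qed
  then show ?thesis by (simp add: linear_conv_bounded_linear)
qed

lemma norm_antidiagonal: "norm (antidiagonal x) \<le> norm x"
proof -
  have "antidiagonal x \<bullet> antidiagonal x = (x \<bullet> x) / 2"
    unfolding inner_vec_def UNIV_Plus_UNIV[symmetric]
    by (subst sum.Plus) (auto simp: sum_divide_distrib sum.distrib[symmetric])
  then have "antidiagonal x \<bullet> antidiagonal x \<le> x \<bullet> x"
    using inner_ge_zero[of x] by linarith
  then show ?thesis unfolding norm_eq_sqrt_inner by (rule real_sqrt_le_mono)
qed

lemma drift_antidiagonal:
  "drift \<alpha> x \<bullet> antidiagonal x = sqrt (\<alpha> - 1) * norm x powr ((\<alpha> - 2) / 2) * (x \<bullet> x)"
  unfolding drift_inner unfolding inner_vec_def
  by (simp add: potential_def sum_distrib_left sum_distrib_right sum_negf[symmetric] sum_subtractf[symmetric] algebra_simps)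

text \<open>
  Multiplication by this factor turns \<open>x\<close> into a smooth vector field of norm at most one that is
  comparable to \<open>x / norm x\<close> away from the origin.
\<close>

definition damping :: "'a::real_inner \<Rightarrow> real" where
  "damping x = inverse (sqrt (1 + x \<bullet> x))"

lemma damping_pos: "0 < damping x"
  by (simp add: damping_def add_pos_nonneg)

lemma damping_derivative:
  "(damping has_derivative (\<lambda>v. (- (damping x ^ 3) *\<^sub>R x) \<bullet> v)) (at x)"
proof -
  have pos: "0 < 1 + x \<bullet> x" by (simp add: add_pos_nonneg)
  have outer: "((\<lambda>t. inverse (sqrt (1 + t))) has_real_derivative - (inverse (sqrt (1 + x \<bullet> x)) ^ 3) / 2) (at (x \<bullet> x))"
  proof -
    have "((\<lambda>t. 1 + t) has_real_derivative 1) (at (x \<bullet> x))" by (auto intro!: derivative_eq_intros)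
    note d = DERIV_inverse_fun[OF DERIV_chain2[OF DERIV_real_sqrt[OF pos] this]]
    have cube: "inverse (sqrt (1 + x \<bullet> x)) ^ 3 = inverse (sqrt (1 + x \<bullet> x)) * inverse (1 + x \<bullet> x)"
    proof -
      have "inverse s ^ 3 = inverse s * inverse (s * s)" for s :: real by (simp add: power3_eq_cube)
      moreover have "sqrt (1 + x \<bullet> x) * sqrt (1 + x \<bullet> x) = 1 + x \<bullet> x" using pos by simp
      ultimately show ?thesis by presburger
    qed
    have "((\<lambda>t. inverse (sqrt (1 + t))) has_real_derivative
        - (inverse (sqrt (1 + x \<bullet> x)) * inverse (1 + x \<bullet> x)) / 2) (at (x \<bullet> x))"
      using d pos by simp
    then show ?thesis unfolding cube .
  qed
  have inner: "((\<lambda>x. x \<bullet> x) has_derivative (\<lambda>v. 2 * (x \<bullet> v))) (at x)"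
    by (auto intro!: derivative_eq_intros simp: inner_commute)
  show ?thesis
    using DERIV_compose_FDERIV[OF outer inner] unfolding damping_def by (simp add: mult.commute)
qed

lemma damping_norm_le: "damping x * norm x \<le> 1"
proof -
  have "norm x \<le> sqrt (1 + x \<bullet> x)" unfolding norm_eq_sqrt_inner by simp
  then show ?thesis by (simp add: damping_def field_simps add_pos_nonneg)
qed

lemma damping_ge:
  assumes "1 \<le> norm x"
  shows "1 / 2 \<le> damping x * norm x"
proof -
  have "1 + x \<bullet> x \<le> (2 * norm x)\<^sup>2"
    using one_le_power[OF assms, of 2] by (simp add: power_mult_distrib dot_square_norm)
  then have "sqrt (1 + x \<bullet> x) \<le> 2 * norm x" using assms by (intro real_le_lsqrt) auto
  then show ?thesis by (simp add: damping_def field_simps add_pos_nonneg)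
qed

lemma damping_continuous: "continuous_on UNIV (damping :: 'a::real_inner \<Rightarrow> real)"
  by (intro continuous_at_imp_continuous_on ballI has_derivative_continuous[OF damping_derivative])

lemma localized_antidiagonal_field:
  fixes k :: "real^'d::finite \<Rightarrow> real"
  assumes k: "\<And>x. (k has_derivative (\<lambda>v. G x \<bullet> v)) (at x)" "continuous_on UNIV G"
    and k01: "\<And>x. 0 \<le> k x" "\<And>x. k x \<le> 1" and supp: "\<And>x. R < norm x \<Longrightarrow> k x = 0"
  defines "\<theta> \<equiv> \<lambda>x. (k x * damping x) *\<^sub>R antidiagonal x"
  shows "\<theta> \<in> unit_fields" "hermite_div \<alpha> \<theta> x = drift \<alpha> x \<bullet> \<theta> x"
proof -
  define H where "H x = k x *\<^sub>R (- (damping x ^ 3) *\<^sub>R x) + damping x *\<^sub>R G x" for x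
  define D where "D x v = (k x * damping x) *\<^sub>R antidiagonal v + (H x \<bullet> v) *\<^sub>R antidiagonal x" for x v
  have "((\<lambda>x. k x * damping x) has_derivative (\<lambda>v. H x \<bullet> v)) (at x)" for x
    using has_derivative_mult[OF k(1)[of x] damping_derivative[of x]]
    by (simp add: H_def inner_add_left algebra_simps)
  from has_derivative_scaleR[OF this bounded_linear.has_derivative[OF antidiagonal_linear has_derivative_ident]]
  have D: "(\<theta> has_derivative D x) (at x)" for x
    unfolding \<theta>_def D_def by simp
  have kc: "continuous_on UNIV k"
    by (intro continuous_at_imp_continuous_on ballI has_derivative_continuous[OF k(1)])
  have C1: "C1_compact_support \<theta>"
  proof (rule C1_compact_supportI[OF D])
    show "continuous_on UNIV (\<lambda>x. D x v)" for v
      unfolding D_def H_def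
      by (intro continuous_intros kc damping_continuous k bounded_linear.continuous_on[OF antidiagonal_linear])
    show "\<theta> x = 0" if "R < norm x" for x using supp[OF that] by (simp add: \<theta>_def)
  qed
  have "norm (\<theta> x) \<le> 1" for x
  proof -
    have "norm (\<theta> x) = k x * (damping x * norm (antidiagonal x))"
      using k01(1)[of x] damping_pos[of x] by (simp add: \<theta>_def abs_mult)
    also have "\<dots> \<le> 1 * (damping x * norm x)"
      using k01[of x] damping_pos[of x] norm_antidiagonal[of x]
      by (intro mult_mono mult_left_mono) auto
    finally show ?thesis using damping_norm_le[of x] by simp
  qed
  with C1 show "\<theta> \<in> unit_fields" by (simp add: unit_fields_def)
  have "divergence (D x) = 0" by (simp add: divergence_def D_def)
  then show "hermite_div \<alpha> \<theta> x = drift \<alpha> x \<bullet> \<theta> x" by (simp add: hermite_div_eq[OF D])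
qed

text \<open>
  The unit ball is left out because the drift degenerates at the origin.
\<close>

lemma infinite_measure_bounded_part:
  fixes C :: "'a::euclidean_space set"
  assumes C [measurable]: "C \<in> sets borel" and inf: "emeasure lborel C = \<infinity>"
  shows "\<exists>K R. K \<in> sets borel \<and> K \<subseteq> C \<and> (\<forall>x\<in>K. 1 \<le> norm x \<and> norm x \<le> R) \<and> m \<le> measure lborel K"
proof -
  define K where "K n = (C - ball 0 1) \<inter> cball 0 (real n)" for n
  have K [measurable]: "K n \<in> sets borel" for n unfolding K_def by simp
  have "incseq K" by (auto simp: K_def incseq_def)
  moreover have UK: "(\<Union>n. K n) = C - ball 0 1"
  proof -
    have "\<exists>n. norm x \<le> real n" for x :: 'a by (rule real_arch_simple)
    then show ?thesis by (auto simp: K_def)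
  qed
  ultimately have lim: "(\<lambda>n. emeasure lborel (K n)) \<longlonglongrightarrow> emeasure lborel (C - ball 0 1)"
    using Lim_emeasure_incseq[of K lborel] by (simp add: image_subset_iff)
  have "emeasure lborel C \<le> emeasure lborel ((C - ball 0 1) \<union> ball 0 1)"
    by (rule emeasure_mono) auto
  also have "\<dots> \<le> emeasure lborel (C - ball 0 1) + emeasure lborel (ball (0::'a) 1)"
    by (rule emeasure_subadditive) auto
  finally have "emeasure lborel (C - ball 0 1) = \<infinity>"
    using inf emeasure_lborel_ball_finite[of "0::'a" 1] by (auto simp: top_unique)
  then have "eventually (\<lambda>n. ennreal \<bar>m\<bar> < emeasure lborel (K n)) sequentially"
    by (intro order_tendstoD(1)[OF lim]) simp
  then obtain n where n: "ennreal \<bar>m\<bar> < emeasure lborel (K n)" by (auto simp: eventually_sequentially)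
  have "emeasure lborel (K n) \<le> emeasure lborel (cball (0::'a) (real n))"
    by (rule emeasure_mono) (auto simp: K_def)
  then have "emeasure lborel (K n) < \<infinity>"
    using emeasure_lborel_cball_finite[of "0::'a" "real n"] by (rule order_le_less_trans)
  then have "ennreal \<bar>m\<bar> < ennreal (measure lborel (K n))"
    using n by (simp add: emeasure_eq_ennreal_measure less_top)
  then have "m \<le> measure lborel (K n)" by (simp add: ennreal_less_iff)
  then show ?thesis
    by (intro exI[of _ "K n"] exI[of _ "real n"]) (auto simp: K_def)
qed

text \<open>
  Outside the unit ball the product \<open>w\<close> of the drift with the damped antidiagonal field is bounded below by a
  positive constant, so its integral over a bounded part \<open>K\<close> of \<open>C\<close> is as large as desired. Multiplying that
  field by a mollified indicator of \<open>K\<close>, close to the indicator in \<open>L\<^sup>1\<close>, makes it admissible and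
  changes integrals against \<open>w\<close> by at most one.
\<close>

lemma large_drift_field:
  fixes C :: "(real^'d::finite) set"
  assumes \<alpha>: "1 < \<alpha>" and C [measurable]: "C \<in> sets borel" and inf: "emeasure lborel C = \<infinity>"
  shows "\<exists>\<theta>\<in>unit_fields. m \<le> (LINT x|lborel. drift \<alpha> x \<bullet> \<theta> x) \<and>
    \<bar>LINT x|lborel. indicat_real (- C) x * hermite_div \<alpha> \<theta> x\<bar> \<le> 1"
proof -
  \<comment> \<open>The factor 1/2 is the lower bound of \<open>damping x * norm x\<close> outside the unit ball.\<close>
  define c where "c = sqrt (\<alpha> - 1) / 2"
  have c: "0 < c" using \<alpha> by (simp add: c_def)
  define w where "w x = damping x * (drift \<alpha> x \<bullet> antidiagonal x)" for x :: "real^'d"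
  have w_eq: "w x = sqrt (\<alpha> - 1) * (norm x powr ((\<alpha> - 2) / 2) * norm x) * (damping x * norm x)" for x
    unfolding w_def drift_antidiagonal dot_square_norm by (simp add: power2_eq_square)
  have w0: "0 \<le> w x" for x
    unfolding w_eq using \<alpha> damping_pos[of x] by (intro mult_nonneg_nonneg) auto
  have wc: "c \<le> w x" if x: "1 \<le> norm x" for x
  proof -
    have "norm x powr ((\<alpha> - 2) / 2) * norm x = norm x powr (\<alpha> / 2)"
      using x powr_add[of "norm x" "(\<alpha> - 2) / 2" 1] by (simp add: field_simps)
    also have "\<dots> \<ge> 1" using x \<alpha> by (intro ge_one_powr_ge_zero) auto
    finally have *: "1 \<le> norm x powr ((\<alpha> - 2) / 2) * norm x" .
    have "c = sqrt (\<alpha> - 1) * 1 * (1 / 2)" by (simp add: c_def)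
    also have "\<dots> \<le> w x"
      unfolding w_eq using \<alpha> damping_ge[OF x] * by (intro mult_mono) auto
    finally show ?thesis .
  qed
  have wcont: "continuous_on UNIV w"
    unfolding w_def using \<alpha>
    by (intro continuous_on_mult continuous_on_inner damping_continuous drift_continuous
        bounded_linear.continuous_on[OF antidiagonal_linear] continuous_on_id) simp
  have [measurable]: "w \<in> borel_measurable borel" by (rule borel_measurable_continuous_onI[OF wcont])
  obtain K R where K [measurable]: "K \<in> sets borel" and KC: "K \<subseteq> C"
    and KR: "\<And>x. x \<in> K \<Longrightarrow> 1 \<le> norm x" "\<And>x. x \<in> K \<Longrightarrow> norm x \<le> R" and Km: "(m + 1) / c \<le> measure lborel K"
    using infinite_measure_bounded_part[OF C inf, of "(m + 1) / c"] by blast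
  have "bounded (w ` cball 0 (R + 1))"
    by (intro compact_imp_bounded compact_continuous_image continuous_on_subset[OF wcont]) auto
  then obtain W where W: "W > 0" "\<And>x. norm x \<le> R + 1 \<Longrightarrow> w x \<le> W"
    unfolding bounded_pos by (auto simp: abs_le_iff)
  obtain \<delta> where \<delta>: "\<delta> > 0" "\<And>e. 0 < e \<Longrightarrow> e \<le> \<delta> \<Longrightarrow>
      (LINT x|lborel. indicat_real (cball 0 (R + 1)) x * \<bar>mollify e K x - indicat_real K x\<bar>) \<le> 1 / W"
    using mollify_L1[OF K, of "1 / W" "R + 1"] W(1) by auto
  define e where "e = min 1 \<delta>"
  have e: "0 < e" "e \<le> 1" "e \<le> \<delta>" using \<delta>(1) by (auto simp: e_def)
  define k where "k = mollify e K"
  obtain G where G: "\<And>x. (k has_derivative (\<lambda>v. G x \<bullet> v)) (at x)" "continuous_on UNIV G"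
    unfolding k_def using mollify_C1[OF e(1) K] by blast
  have k01: "0 \<le> k x" "k x \<le> 1" for x
    unfolding k_def by (rule mollify_nonneg[OF e(1)] mollify_le_1[OF e(1) K])+
  have k_supp: "k x = 0" if "R + 1 < norm x" for x
    unfolding k_def by (rule mollify_zero_outside[OF e(1) KR(2)]) (use that e in auto)
  have kc: "continuous_on UNIV k" unfolding k_def by (rule mollify_continuous[OF e(1) K])
  have [measurable]: "k \<in> borel_measurable borel" by (rule borel_measurable_continuous_onI[OF kc])
  define \<theta> where "\<theta> x = (k x * damping x) *\<^sub>R antidiagonal x" for x
  have \<theta>: "\<theta> \<in> unit_fields" "\<And>x. hermite_div \<alpha> \<theta> x = drift \<alpha> x \<bullet> \<theta> x"
    unfolding \<theta>_def using localized_antidiagonal_field[OF G k01 k_supp] by blast+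
  have drift_\<theta>: "drift \<alpha> x \<bullet> \<theta> x = w x * k x" for x by (simp add: \<theta>_def w_def)
  define \<Delta> where "\<Delta> x = indicat_real (cball 0 (R + 1)) x * \<bar>k x - indicat_real K x\<bar>" for x
  have \<Delta>_int: "integrable lborel \<Delta>"
  proof (rule Bochner_Integration.integrable_bound[OF integrable_indicator_cball[of "R + 1"]])
    have [measurable]: "cball (0::real^'d) (R + 1) \<in> sets borel" by simp
    show "\<Delta> \<in> borel_measurable lborel" unfolding \<Delta>_def by measurable
    have "\<bar>k x - indicat_real K x\<bar> \<le> 1" for x using k01[of x] by (auto simp: indicator_def)
    then show "AE x in lborel. norm (\<Delta> x) \<le> norm (indicat_real (cball 0 (R + 1)) x)"
      by (auto simp: indicator_def \<Delta>_def)
  qed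
  have \<Delta>_le: "(LINT x|lborel. W * \<Delta> x) \<le> 1"
    using \<delta>(2)[OF e(1,3)] W(1) by (simp add: \<Delta>_def k_def field_simps)
  have close: "w x * \<bar>k x - indicat_real K x\<bar> \<le> W * \<Delta> x" for x
  proof (cases "norm x \<le> R + 1")
    case True
    then show ?thesis using W(2)[OF True] by (simp add: \<Delta>_def mult_right_mono)
  next
    case False
    then have "x \<notin> K" using KR(2)[of x] by auto
    then show ?thesis using False k_supp[of x] by (simp add: \<Delta>_def)
  qed
  have wk_int: "integrable lborel (\<lambda>x. w x * k x)"
    by (rule integrable_continuous_mult[OF wcont kc k_supp])
  have K_fin: "emeasure lborel K < \<infinity>"
  proof -
    have "emeasure lborel K \<le> emeasure lborel (cball (0::real^'d) R)"
      by (rule emeasure_mono) (auto simp: KR)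
    then show ?thesis using emeasure_lborel_cball_finite[of "0::real^'d" R] by (rule order_le_less_trans)
  qed
  have K_int: "integrable lborel (\<lambda>x. c * indicat_real K x)"
    using K_fin by (intro integrable_mult_right integrable_real_indicator) auto
  have "m + 1 \<le> c * measure lborel K" using Km c by (simp add: field_simps)
  also have "\<dots> = (LINT x|lborel. c * indicat_real K x)" by simp
  also have "\<dots> \<le> (LINT x|lborel. w x * k x + W * \<Delta> x)"
  proof (rule integral_mono[OF K_int])
    show "integrable lborel (\<lambda>x. w x * k x + W * \<Delta> x)"
      by (intro Bochner_Integration.integrable_add wk_int integrable_mult_right \<Delta>_int)
    show "c * indicat_real K x \<le> w x * k x + W * \<Delta> x" for x
    proof -
      have "c * indicat_real K x \<le> w x * indicat_real K x"
        using wc[of x] KR(1)[of x] by (auto simp: indicator_def)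
      also have "\<dots> = w x * k x + w x * (indicat_real K x - k x)" by (simp add: algebra_simps)
      also have "\<dots> \<le> w x * k x + w x * \<bar>k x - indicat_real K x\<bar>"
        using w0[of x] by (intro add_left_mono mult_left_mono) auto
      finally show ?thesis using close[of x] by linarith
    qed
  qed
  also have "\<dots> = (LINT x|lborel. w x * k x) + (LINT x|lborel. W * \<Delta> x)"
    by (intro Bochner_Integration.integral_add wk_int integrable_mult_right \<Delta>_int)
  finally have m: "m \<le> (LINT x|lborel. w x * k x)" using \<Delta>_le by linarith
  have "0 \<le> (LINT x|lborel. indicat_real (- C) x * (w x * k x))"
    using w0 k01 by (intro Bochner_Integration.integral_nonneg mult_nonneg_nonneg) auto
  moreover have "(LINT x|lborel. indicat_real (- C) x * (w x * k x)) \<le> (LINT x|lborel. W * \<Delta> x)"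
  proof (rule integral_mono)
    show "integrable lborel (\<lambda>x. indicat_real (- C) x * (w x * k x))"
      using integrable_indicator_mult[OF wk_int, of "- C"] C by simp
    show "integrable lborel (\<lambda>x. W * \<Delta> x)" by (intro integrable_mult_right \<Delta>_int)
    show "indicat_real (- C) x * (w x * k x) \<le> W * \<Delta> x" for x
    proof (cases "x \<in> C")
      case True
      then show ?thesis using W(1) by (simp add: \<Delta>_def)
    next
      case False
      then have "x \<notin> K" using KC by auto
      then show ?thesis using close[of x] k01(1)[of x] False by simp
    qed
  qed
  ultimately have "\<bar>LINT x|lborel. indicat_real (- C) x * hermite_div \<alpha> \<theta> x\<bar> \<le> 1"
    unfolding \<theta>(2) drift_\<theta> using \<Delta>_le by linarith
  then show ?thesis using \<theta>(1) m unfolding drift_\<theta>[symmetric] by blast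
qed

section \<open>The restricted perimeter\<close>

definition flux :: "real \<Rightarrow> (real^'d::finite) set \<Rightarrow> (real^'d \<Rightarrow> real^('d + 'd)) \<Rightarrow> real" where
  "flux \<alpha> A \<phi> = (LINT x:A|lebesgue. hermite_div \<alpha> \<phi> x)"

lemma flux_borel:
  fixes A :: "(real^'d::finite) set"
  assumes \<alpha>: "1 \<le> \<alpha>" and \<phi>: "C1_compact_support \<phi>" and A [measurable]: "A \<in> sets borel"
  shows "flux \<alpha> A \<phi> = (LINT x|lborel. indicat_real A x * hermite_div \<alpha> \<phi> x)"
proof -
  have [measurable]: "hermite_div \<alpha> \<phi> \<in> borel_measurable borel"
    by (rule borel_measurable_continuous_onI[OF hermite_div_regular(1)[OF \<alpha> \<phi>]])
  show ?thesis unfolding flux_def set_lebesgue_integral_def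
    by (subst integral_completion) (auto intro!: measurable)
qed

text \<open>
  Iterated integrals require sets that are measurable for the product of the Borel structures, whereas
  perimeters are defined for Lebesgue measurable sets.
\<close>

lemma borel_version:
  fixes A :: "(real^'d::finite) set"
  assumes "A \<in> sets lebesgue"
  obtains A' where "A' \<in> sets borel" "AE x in lebesgue. x \<in> A \<longleftrightarrow> x \<in> A'"
proof -
  obtain S N N' where S: "A = S \<union> N" "N \<subseteq> N'" "N' \<in> null_sets lborel" "S \<in> sets lborel"
    using sets_completionE[OF assms] by metis
  have "N' \<in> null_sets lebesgue" using S(3) by (rule null_sets_completionI)
  then have "AE x in lebesgue. x \<notin> N'" by (rule AE_not_in)
  then have "AE x in lebesgue. x \<in> A \<longleftrightarrow> x \<in> S"
    by eventually_elim (use S in auto)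
  then show thesis using S(4) by (intro that[of S]) auto
qed

lemma hermite_div_lebesgue_integrable:
  fixes \<phi> :: "real^'d::finite \<Rightarrow> real^('d + 'd)"
  assumes "1 \<le> \<alpha>" "C1_compact_support \<phi>"
  shows "integrable lebesgue (hermite_div \<alpha> \<phi>)"
  using hermite_div_integrable(1)[OF assms]
  by (subst integrable_completion) auto

lemma flux_cong_AE:
  fixes A B :: "(real^'d::finite) set"
  assumes "1 \<le> \<alpha>" "C1_compact_support \<phi>" and [measurable]: "A \<in> sets lebesgue" "B \<in> sets lebesgue"
    and AE: "AE x in lebesgue. x \<in> A \<longleftrightarrow> x \<in> B"
  shows "flux \<alpha> A \<phi> = flux \<alpha> B \<phi>"
  unfolding flux_def set_lebesgue_integral_def
proof (rule integral_cong_AE)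
  have [measurable]: "hermite_div \<alpha> \<phi> \<in> borel_measurable lebesgue"
    using hermite_div_lebesgue_integrable[OF assms(1,2)] by simp
  show "(\<lambda>x. indicat_real A x *\<^sub>R hermite_div \<alpha> \<phi> x) \<in> borel_measurable lebesgue" by measurable
  show "(\<lambda>x. indicat_real B x *\<^sub>R hermite_div \<alpha> \<phi> x) \<in> borel_measurable lebesgue" by measurable
  show "AE x in lebesgue. indicat_real A x *\<^sub>R hermite_div \<alpha> \<phi> x = indicat_real B x *\<^sub>R hermite_div \<alpha> \<phi> x"
    using AE by eventually_elim (auto simp: indicator_def)
qed

lemma flux_Compl:
  fixes A :: "(real^'d::finite) set"
  assumes "1 \<le> \<alpha>" "C1_compact_support \<phi>" and A: "A \<in> sets lebesgue"
  shows "flux \<alpha> A \<phi> + flux \<alpha> (- A) \<phi> = (LINT x|lborel. drift \<alpha> x \<bullet> \<phi> x)"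
proof -
  have int: "set_integrable lebesgue C (hermite_div \<alpha> \<phi>)" if "C \<in> sets lebesgue" for C
    unfolding set_integrable_def
    by (rule integrable_mult_indicator[OF that hermite_div_lebesgue_integrable[OF assms(1,2)]])
  have "- A \<in> sets lebesgue" using A by (simp add: Compl_in_sets_lebesgue)
  then have "flux \<alpha> A \<phi> + flux \<alpha> (- A) \<phi> = (LINT x:A \<union> - A|lebesgue. hermite_div \<alpha> \<phi> x)"
    unfolding flux_def by (intro set_integral_Un[symmetric] int A) auto
  also have "\<dots> = flux \<alpha> UNIV \<phi>" by (simp add: flux_def)
  also have "\<dots> = (LINT x|lborel. hermite_div \<alpha> \<phi> x)" by (simp add: flux_borel[OF assms(1,2)])
  finally show ?thesis by (simp add: integral_hermite_div[OF assms(1,2)])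
qed

lemma flux_uminus:
  assumes "\<phi> \<in> unit_fields"
  shows "flux \<alpha> A (\<lambda>x. - \<phi> x) = - flux \<alpha> A \<phi>"
  unfolding flux_def set_lebesgue_integral_def using unit_fields_uminus(2)[OF assms] by simp

lemma restricted_fields_eq:
  assumes \<alpha>: "1 \<le> \<alpha>"
  shows "(restricted_fields \<alpha> :: (real^'d::finite \<Rightarrow> _) set) = {\<phi> \<in> unit_fields. (LINT x|lborel. drift \<alpha> x \<bullet> \<phi> x) = 0}"
proof -
  have "(LINT x|lebesgue. (\<Sum>k\<in>UNIV. potential \<alpha> k x * \<phi> x $ Inl k) - (\<Sum>k\<in>UNIV. potential \<alpha> k x * \<phi> x $ Inr k))
      = (LINT x|lborel. drift \<alpha> x \<bullet> \<phi> x)" if "C1_compact_support \<phi>" for \<phi> :: "real^'d \<Rightarrow> real^('d + 'd)"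
    unfolding drift_inner[symmetric]
    by (rule integral_completion) (use hermite_div_integrable(2)[OF \<alpha> that] in simp)
  then show ?thesis unfolding restricted_fields_def unit_fields_def by auto
qed

lemma restricted_fields_uminus:
  fixes \<phi> :: "real^'d::finite \<Rightarrow> _"
  assumes "1 \<le> \<alpha>" "\<phi> \<in> restricted_fields \<alpha>"
  shows "(\<lambda>x. - \<phi> x) \<in> restricted_fields \<alpha>"
  using assms(2) unfolding restricted_fields_eq[OF assms(1)] by (auto intro: unit_fields_uminus)

lemma zero_restricted_field:
  fixes A :: "(real^'d::finite) set"
  assumes "1 \<le> \<alpha>"
  shows "(\<lambda>x. 0) \<in> (restricted_fields \<alpha> :: (real^'d \<Rightarrow> _) set)" "flux \<alpha> A (\<lambda>x. 0) = 0"
proof -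
  have C1: "C1_compact_support (\<lambda>x::real^'d. 0 :: real^('d + 'd))"
    by (rule C1_compact_supportI[where R=0 and D="\<lambda>_ _. 0"]) auto
  then show "(\<lambda>x. 0) \<in> (restricted_fields \<alpha> :: (real^'d \<Rightarrow> _) set)"
    unfolding restricted_fields_eq[OF assms] unit_fields_def by simp
  have "hermite_div \<alpha> (\<lambda>x::real^'d. 0) x = 0" for x
    using hermite_div_eq[OF has_derivative_const, of \<alpha> 0 x] by (simp add: divergence_def)
  then show "flux \<alpha> A (\<lambda>x. 0) = 0"
    by (simp add: flux_def set_lebesgue_integral_def)
qed

lemma restricted_flux_Compl:
  fixes A :: "(real^'d::finite) set"
  assumes \<alpha>: "1 \<le> \<alpha>" and \<phi>: "\<phi> \<in> restricted_fields \<alpha>" and A: "A \<in> sets lebesgue"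
  shows "flux \<alpha> (- A) \<phi> = flux \<alpha> A (\<lambda>x. - \<phi> x)"
  using flux_Compl[OF \<alpha> _ A, of \<phi>] flux_uminus[of \<phi> \<alpha> A] \<phi>
  unfolding restricted_fields_eq[OF \<alpha>] by (auto simp: unit_fields_def)

definition flux_bounded :: "real \<Rightarrow> (real^'d::finite) set \<Rightarrow> real \<Rightarrow> bool" where
  "flux_bounded \<alpha> A p \<longleftrightarrow> (\<forall>\<phi>\<in>unit_fields. flux \<alpha> A \<phi> \<le> p)"

definition restricted_flux_bounded :: "real \<Rightarrow> (real^'d::finite) set \<Rightarrow> real \<Rightarrow> bool" where
  "restricted_flux_bounded \<alpha> A p \<longleftrightarrow> (\<forall>\<phi>\<in>restricted_fields \<alpha>. flux \<alpha> A \<phi> \<le> p)"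

lemma restricted_flux_bounded_Compl:
  fixes A :: "(real^'d::finite) set"
  assumes \<alpha>: "1 \<le> \<alpha>" and A: "A \<in> sets lebesgue" and p: "restricted_flux_bounded \<alpha> A p"
  shows "restricted_flux_bounded \<alpha> (- A) p"
  unfolding restricted_flux_bounded_def
proof
  fix \<phi> :: "real^'d \<Rightarrow> real^('d + 'd)" assume \<phi>: "\<phi> \<in> restricted_fields \<alpha>"
  show "flux \<alpha> (- A) \<phi> \<le> p"
    unfolding restricted_flux_Compl[OF \<alpha> \<phi> A]
    using p restricted_fields_uminus[OF \<alpha> \<phi>] by (simp add: restricted_flux_bounded_def)
qed

text \<open>
  Shrink \<open>\<phi>\<close> by the factor \<open>1 - \<epsilon>\<close> and add a multiple \<open>- s\<close>, \<open>\<bar>s\<bar> \<le> \<epsilon>\<close>, of a field \<open>\<theta>\<close>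
  concentrated outside \<open>A\<close>, so that the constraint holds. The flux of \<open>\<theta>\<close> through \<open>A\<close> is at most one,
  so the flux changes by \<open>O(\<epsilon>)\<close>.
\<close>

lemma flux_bounded_of_infinite_Compl:
  fixes A :: "(real^'d::finite) set"
  assumes \<alpha>: "1 < \<alpha>" and A: "A \<in> sets lebesgue" and inf: "emeasure lebesgue (- A) = \<infinity>"
    and p: "restricted_flux_bounded \<alpha> A p"
  shows "flux_bounded \<alpha> A p"
  unfolding flux_bounded_def
proof
  fix \<phi> :: "real^'d \<Rightarrow> real^('d + 'd)" assume \<phi>: "\<phi> \<in> unit_fields"
  have \<alpha>1: "1 \<le> \<alpha>" using \<alpha> by simp
  obtain A' where A': "A' \<in> sets borel" and AE: "AE x in lebesgue. x \<in> A \<longleftrightarrow> x \<in> A'"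
    using borel_version[OF A] by blast
  have flux_A: "flux \<alpha> A \<psi> = (LINT x|lborel. indicat_real A' x * hermite_div \<alpha> \<psi> x)" if "\<psi> \<in> unit_fields" for \<psi>
    using flux_cong_AE[OF \<alpha>1 _ A _ AE] flux_borel[OF \<alpha>1 _ A'] that A' by (auto simp: unit_fields_def)
  have "emeasure lborel (- A') = emeasure lebesgue (- A')" using A' by simp
  also have "\<dots> = emeasure lebesgue (- A)"
  proof (rule emeasure_eq_AE)
    show "AE x in lebesgue. x \<in> - A' \<longleftrightarrow> x \<in> - A" using AE by eventually_elim auto
  qed (use A A' in \<open>auto simp: Compl_in_sets_lebesgue\<close>)
  finally have inf': "emeasure lborel (- A') = \<infinity>" using inf by simp
  define c where "c = (LINT x|lborel. drift \<alpha> x \<bullet> \<phi> x)"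
  have \<phi>C1: "C1_compact_support \<phi>" using \<phi> by (simp add: unit_fields_def)
  have key: "(1 - \<epsilon>) * flux \<alpha> A \<phi> \<le> p + \<epsilon>" if \<epsilon>: "0 < \<epsilon>" "\<epsilon> < 1" for \<epsilon>
  proof -
    \<comment> \<open>The integral of \<open>\<theta>\<close> is chosen so large that the correcting coefficient is at most \<open>\<epsilon>\<close>.\<close>
    obtain \<theta> where \<theta>: "\<theta> \<in> unit_fields" and I: "\<bar>c\<bar> / \<epsilon> + 1 \<le> (LINT x|lborel. drift \<alpha> x \<bullet> \<theta> x)"
      and small: "\<bar>LINT x|lborel. indicat_real (- (- A')) x * hermite_div \<alpha> \<theta> x\<bar> \<le> 1"
      using large_drift_field[OF \<alpha> _ inf', of "\<bar>c\<bar> / \<epsilon> + 1"] A' by auto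
    have \<theta>C1: "C1_compact_support \<theta>" using \<theta> by (simp add: unit_fields_def)
    define J where "J = (LINT x|lborel. drift \<alpha> x \<bullet> \<theta> x)"
    have "0 \<le> \<bar>c\<bar> / \<epsilon>" using \<epsilon> by simp
    then have J: "0 < J" "\<bar>c\<bar> / \<epsilon> \<le> J" using I unfolding J_def by linarith+
    define s where "s = (1 - \<epsilon>) * c / J"
    have "\<bar>s\<bar> \<le> \<bar>c\<bar> / J"
      using \<epsilon> J(1) unfolding s_def by (simp add: abs_mult divide_right_mono mult_left_le_one_le)
    also have "\<dots> \<le> \<epsilon>" using J \<epsilon> by (simp add: field_simps)
    finally have s: "\<bar>s\<bar> \<le> \<epsilon>" .
    define \<psi> where "\<psi> x = (1 - \<epsilon>) *\<^sub>R \<phi> x + (- s) *\<^sub>R \<theta> x" for x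
    have \<psi>: "\<psi> \<in> unit_fields"
      unfolding \<psi>_def by (rule unit_fields_combine[OF \<phi> \<theta>]) (use s \<epsilon> in auto)
    have "(LINT x|lborel. drift \<alpha> x \<bullet> \<psi> x) = (1 - \<epsilon>) * c + (- s) * J"
      unfolding \<psi>_def c_def J_def inner_add_right inner_scaleR_right
      using hermite_div_integrable(2)[OF \<alpha>1 \<phi>C1] hermite_div_integrable(2)[OF \<alpha>1 \<theta>C1] by simp
    also have "\<dots> = 0" using J by (simp add: s_def)
    finally have "\<psi> \<in> restricted_fields \<alpha>" using \<psi> by (simp add: restricted_fields_eq[OF \<alpha>1])
    then have "flux \<alpha> A \<psi> \<le> p" using p by (simp add: restricted_flux_bounded_def)
    moreover have "flux \<alpha> A \<psi> = (1 - \<epsilon>) * flux \<alpha> A \<phi> - s * flux \<alpha> A \<theta>"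
    proof -
      have i: "integrable lborel (\<lambda>x. indicat_real A' x * hermite_div \<alpha> \<phi> x)"
        "integrable lborel (\<lambda>x. indicat_real A' x * hermite_div \<alpha> \<theta> x)"
        using integrable_indicator_mult[OF hermite_div_integrable(1)[OF \<alpha>1 \<phi>C1] A']
          integrable_indicator_mult[OF hermite_div_integrable(1)[OF \<alpha>1 \<theta>C1] A'] by simp_all
      have "flux \<alpha> A \<psi> = (LINT x|lborel. (1 - \<epsilon>) * (indicat_real A' x * hermite_div \<alpha> \<phi> x)
          - s * (indicat_real A' x * hermite_div \<alpha> \<theta> x))"
        unfolding flux_A[OF \<psi>] unfolding \<psi>_def hermite_div_add[OF \<phi>C1 \<theta>C1]
        by (intro Bochner_Integration.integral_cong) (auto simp: algebra_simps)
      then show ?thesis using i by (simp add: flux_A \<phi> \<theta>)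
    qed
    moreover have "\<bar>s * flux \<alpha> A \<theta>\<bar> \<le> \<epsilon> * 1"
      unfolding abs_mult by (rule mult_mono[OF s]) (use small \<epsilon> in \<open>auto simp: flux_A[OF \<theta>]\<close>)
    ultimately show ?thesis by linarith
  qed
  show "flux \<alpha> A \<phi> \<le> p"
  proof (rule tendsto_lowerbound)
    show "((\<lambda>\<epsilon>. p + \<epsilon> + \<epsilon> * flux \<alpha> A \<phi>) \<longlongrightarrow> p) (at_right 0)"
      by (auto intro!: tendsto_eq_intros)
    have "eventually (\<lambda>\<epsilon>::real. \<epsilon> \<in> {0<..<1}) (at_right 0)" by (rule eventually_at_right_real) simp
    then show "\<forall>\<^sub>F \<epsilon> in at_right 0. flux \<alpha> A \<phi> \<le> p + \<epsilon> + \<epsilon> * flux \<alpha> A \<phi>"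
      by eventually_elim (use key in \<open>force simp: left_diff_distrib\<close>)
  qed simp
qed

text \<open>
  For \<open>\<alpha> = 1\<close> the drift vanishes and every field satisfies the constraint; otherwise one of \<open>A\<close>, \<open>- A\<close>
  has infinite measure.
\<close>

lemma flux_bounded_either:
  fixes A :: "(real^'d::finite) set"
  assumes \<alpha>: "1 \<le> \<alpha>" and A: "A \<in> sets lebesgue" and p: "restricted_flux_bounded \<alpha> A p"
  shows "flux_bounded \<alpha> A p \<or> flux_bounded \<alpha> (- A) p"
proof (cases "\<alpha> = 1")
  case True
  have "drift \<alpha> x = 0" for x :: "real^'d"
    unfolding vec_eq_iff drift_def True by (auto simp: potential_def split: sum.split)
  then have "restricted_fields \<alpha> = (unit_fields :: (real^'d \<Rightarrow> real^('d + 'd)) set)"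
    unfolding restricted_fields_eq[OF \<alpha>] by simp
  then show ?thesis using p by (simp add: restricted_flux_bounded_def flux_bounded_def)
next
  case False
  then have \<alpha>': "1 < \<alpha>" using \<alpha> by simp
  have cA: "- A \<in> sets lebesgue" using A by (simp add: Compl_in_sets_lebesgue)
  have "emeasure lebesgue A + emeasure lebesgue (- A) = emeasure lebesgue (A \<union> - A)"
    by (rule plus_emeasure) (use A cA in auto)
  also have "\<dots> = \<infinity>" by simp
  finally have "emeasure lebesgue A = \<infinity> \<or> emeasure lebesgue (- A) = \<infinity>" by simp
  then show ?thesis
  proof
    assume "emeasure lebesgue (- A) = \<infinity>"
    then show ?thesis using flux_bounded_of_infinite_Compl[OF \<alpha>' A _ p] by blast
  next
    assume "emeasure lebesgue A = \<infinity>"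
    then have "emeasure lebesgue (- (- A)) = \<infinity>" by simp
    then show ?thesis
      using flux_bounded_of_infinite_Compl[OF \<alpha>' cA _ restricted_flux_bounded_Compl[OF \<alpha> A p]] by blast
  qed
qed

lemma flux_submodular_posimodular:
  fixes A B :: "(real^'d::finite) set"
  assumes \<alpha>: "1 \<le> \<alpha>" and A: "A \<in> sets lebesgue" and B: "B \<in> sets lebesgue"
    and p: "flux_bounded \<alpha> A p" and q: "flux_bounded \<alpha> B q"
    and \<phi>: "\<phi>\<^sub>1 \<in> unit_fields" "\<phi>\<^sub>2 \<in> unit_fields"
  shows "flux \<alpha> (A \<union> B) \<phi>\<^sub>1 + flux \<alpha> (A \<inter> B) \<phi>\<^sub>2 \<le> p + q"
    and "flux \<alpha> (A - B) \<phi>\<^sub>1 + flux \<alpha> (B - A) \<phi>\<^sub>2 \<le> p + q"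
proof -
  obtain A' where A': "A' \<in> sets borel" and AEA: "AE x in lebesgue. x \<in> A \<longleftrightarrow> x \<in> A'"
    using borel_version[OF A] by blast
  obtain B' where B': "B' \<in> sets borel" and AEB: "AE x in lebesgue. x \<in> B \<longleftrightarrow> x \<in> B'"
    using borel_version[OF B] by blast
  have transfer: "flux \<alpha> C \<psi> = (LINT x|lborel. indicat_real C' x * hermite_div \<alpha> \<psi> x)"
    if "\<psi> \<in> unit_fields" "C \<in> sets lebesgue" "C' \<in> sets borel" "AE x in lebesgue. x \<in> C \<longleftrightarrow> x \<in> C'" for \<psi> C C'
    using flux_cong_AE[OF \<alpha> _ that(2) _ that(4)] flux_borel[OF \<alpha> _ that(3)] that(1,3) by (auto simp: unit_fields_def)
  have p': "(LINT x|lborel. indicat_real A' x * hermite_div \<alpha> \<psi> x) \<le> p" if "\<psi> \<in> unit_fields" for \<psi>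
    using p that transfer[OF that A A' AEA] by (auto simp: flux_bounded_def)
  have q': "(LINT x|lborel. indicat_real B' x * hermite_div \<alpha> \<psi> x) \<le> q" if "\<psi> \<in> unit_fields" for \<psi>
    using q that transfer[OF that B B' AEB] by (auto simp: flux_bounded_def)
  have AE: "AE x in lebesgue. x \<in> A \<union> B \<longleftrightarrow> x \<in> A' \<union> B'" "AE x in lebesgue. x \<in> A \<inter> B \<longleftrightarrow> x \<in> A' \<inter> B'"
    "AE x in lebesgue. x \<in> A - B \<longleftrightarrow> x \<in> A' - B'" "AE x in lebesgue. x \<in> B - A \<longleftrightarrow> x \<in> B' - A'"
    by (use AEA AEB in eventually_elim, auto)+
  show "flux \<alpha> (A \<union> B) \<phi>\<^sub>1 + flux \<alpha> (A \<inter> B) \<phi>\<^sub>2 \<le> p + q"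
    using field_submodular[OF \<alpha> A' B' p' q' \<phi>] transfer[OF \<phi>(1) _ _ AE(1)] transfer[OF \<phi>(2) _ _ AE(2)] A B A' B'
    by simp
  show "flux \<alpha> (A - B) \<phi>\<^sub>1 + flux \<alpha> (B - A) \<phi>\<^sub>2 \<le> p + q"
    using field_posimodular[OF \<alpha> A' B' p' q' \<phi>] transfer[OF \<phi>(1) _ _ AE(3)] transfer[OF \<phi>(2) _ _ AE(4)] A B A' B'
    by simp
qed

text \<open>
  Constrained fluxes through a set and through its complement are opposite. So if both bounds
  hold for the sets themselves, or both for the complements, submodularity for unconstrained
  fields applies; in the mixed cases \<open>A \<inter> B\<close> and \<open>- (A \<union> B)\<close> are the two differences of \<open>A\<close> and \<open>- B\<close>
  (or of \<open>- A\<close> and \<open>B\<close>).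
\<close>

lemma restricted_flux_submodular:
  fixes A B :: "(real^'d::finite) set"
  assumes \<alpha>: "1 \<le> \<alpha>" and A: "A \<in> sets lebesgue" and B: "B \<in> sets lebesgue"
    and p: "restricted_flux_bounded \<alpha> A p" and q: "restricted_flux_bounded \<alpha> B q"
    and \<phi>: "\<phi>\<^sub>1 \<in> restricted_fields \<alpha>" "\<phi>\<^sub>2 \<in> restricted_fields \<alpha>"
  shows "flux \<alpha> (A \<union> B) \<phi>\<^sub>1 + flux \<alpha> (A \<inter> B) \<phi>\<^sub>2 \<le> p + q"
proof -
  have u: "\<phi>\<^sub>1 \<in> unit_fields" "\<phi>\<^sub>2 \<in> unit_fields" "(\<lambda>x. - \<phi>\<^sub>1 x) \<in> unit_fields" "(\<lambda>x. - \<phi>\<^sub>2 x) \<in> unit_fields"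
    using \<phi> restricted_fields_uminus[OF \<alpha> \<phi>(1)] restricted_fields_uminus[OF \<alpha> \<phi>(2)]
    by (auto simp: restricted_fields_eq[OF \<alpha>])
  have c: "- A \<in> sets lebesgue" "- B \<in> sets lebesgue" using A B by (auto simp: Compl_in_sets_lebesgue)
  have compl: "flux \<alpha> (A \<union> B) \<phi>\<^sub>1 = flux \<alpha> (- (A \<union> B)) (\<lambda>x. - \<phi>\<^sub>1 x)"
    "flux \<alpha> (A \<inter> B) \<phi>\<^sub>2 = flux \<alpha> (- (A \<inter> B)) (\<lambda>x. - \<phi>\<^sub>2 x)"
    using restricted_flux_Compl[OF \<alpha> restricted_fields_uminus[OF \<alpha> \<phi>(1)], of "A \<union> B"]
      restricted_flux_Compl[OF \<alpha> restricted_fields_uminus[OF \<alpha> \<phi>(2)], of "A \<inter> B"] A B by simp_all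
  consider "flux_bounded \<alpha> A p" "flux_bounded \<alpha> B q" | "flux_bounded \<alpha> (- A) p" "flux_bounded \<alpha> (- B) q"
    | "flux_bounded \<alpha> A p" "flux_bounded \<alpha> (- B) q" | "flux_bounded \<alpha> (- A) p" "flux_bounded \<alpha> B q"
    using flux_bounded_either[OF \<alpha> A p] flux_bounded_either[OF \<alpha> B q] by blast
  then show ?thesis
  proof cases
    case 1
    then show ?thesis using flux_submodular_posimodular(1)[OF \<alpha> A B _ _ u(1,2)] by blast
  next
    case 2
    have "- A \<union> - B = - (A \<inter> B)" "- A \<inter> - B = - (A \<union> B)" by auto
    then show ?thesis using flux_submodular_posimodular(1)[OF \<alpha> c 2 u(4,3)] compl by simp
  next
    case 3
    have "A - - B = A \<inter> B" "- B - A = - (A \<union> B)" by auto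
    then show ?thesis using flux_submodular_posimodular(2)[OF \<alpha> A c(2) 3 u(2,3)] compl by simp
  next
    case 4
    have "- A - B = - (A \<union> B)" "B - - A = A \<inter> B" by auto
    then show ?thesis using flux_submodular_posimodular(2)[OF \<alpha> c(1) B 4 u(3,2)] compl by simp
  qed
qed

definition real_perimeter :: "real \<Rightarrow> (real^'d::finite) set \<Rightarrow> real" where
  "real_perimeter \<alpha> A = real_of_ereal (restricted_perimeter \<alpha> A)"

lemma restricted_perimeter_le_iff:
  "restricted_perimeter \<alpha> A \<le> ereal p \<longleftrightarrow> restricted_flux_bounded \<alpha> A p"
  unfolding restricted_perimeter_def restricted_flux_bounded_def flux_def by (simp add: SUP_le_iff)

lemma restricted_perimeter_nonneg:
  assumes "1 \<le> \<alpha>"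
  shows "0 \<le> restricted_perimeter \<alpha> A"
  unfolding restricted_perimeter_def
  by (rule SUP_upper2[OF zero_restricted_field(1)[OF assms]])
    (use zero_restricted_field(2)[OF assms, of A] in \<open>simp add: flux_def\<close>)

lemma finite_perimeter_iff:
  fixes A :: "(real^'d::finite) set"
  assumes \<alpha>: "1 \<le> \<alpha>"
  shows "finite_restricted_perimeter \<alpha> A \<and> real_perimeter \<alpha> A \<le> p
    \<longleftrightarrow> A \<in> sets lebesgue \<and> restricted_flux_bounded \<alpha> A p"
proof -
  have "restricted_perimeter \<alpha> A < \<infinity> \<and> real_perimeter \<alpha> A \<le> p \<longleftrightarrow> restricted_perimeter \<alpha> A \<le> ereal p"
    using restricted_perimeter_nonneg[OF \<alpha>, of A] unfolding real_perimeter_def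
    by (cases "restricted_perimeter \<alpha> A") auto
  then show ?thesis by (auto simp: finite_restricted_perimeter_def restricted_perimeter_le_iff)
qed

lemma finite_perimeterD:
  fixes A :: "(real^'d::finite) set"
  assumes "1 \<le> \<alpha>" "finite_restricted_perimeter \<alpha> A"
  shows "A \<in> sets lebesgue" "restricted_flux_bounded \<alpha> A (real_perimeter \<alpha> A)"
    "ereal (real_perimeter \<alpha> A) = restricted_perimeter \<alpha> A"
proof -
  show "A \<in> sets lebesgue" "restricted_flux_bounded \<alpha> A (real_perimeter \<alpha> A)"
    using finite_perimeter_iff[OF assms(1), of A "real_perimeter \<alpha> A"] assms(2) by auto
  show "ereal (real_perimeter \<alpha> A) = restricted_perimeter \<alpha> A"
    using restricted_perimeter_nonneg[OF assms(1), of A] assms(2)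
    unfolding real_perimeter_def finite_restricted_perimeter_def
    by (cases "restricted_perimeter \<alpha> A") auto
qed

lemma flux_tendsto:
  fixes B :: "(real^'d::finite) set"
  assumes \<alpha>: "1 \<le> \<alpha>" and \<phi>: "C1_compact_support \<phi>"
    and A: "\<And>n::nat. A n \<in> sets lebesgue" and B: "B \<in> sets lebesgue"
    and lim: "AE x in lebesgue. (\<lambda>n. indicat_real (A n) x) \<longlonglongrightarrow> indicat_real B x"
  shows "(\<lambda>n. flux \<alpha> (A n) \<phi>) \<longlonglongrightarrow> flux \<alpha> B \<phi>"
  unfolding flux_def set_lebesgue_integral_def
proof (rule integral_dominated_convergence[where w="\<lambda>x. norm (hermite_div \<alpha> \<phi> x)"])
  note int = hermite_div_lebesgue_integrable[OF \<alpha> \<phi>]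
  have [measurable]: "hermite_div \<alpha> \<phi> \<in> borel_measurable lebesgue" using int by simp
  note [measurable] = A B
  show "integrable lebesgue (\<lambda>x. norm (hermite_div \<alpha> \<phi> x))" using int by simp
  show "(\<lambda>x. indicat_real B x *\<^sub>R hermite_div \<alpha> \<phi> x) \<in> borel_measurable lebesgue" by measurable
  show "(\<lambda>x. indicat_real (A n) x *\<^sub>R hermite_div \<alpha> \<phi> x) \<in> borel_measurable lebesgue" for n by measurable
  show "AE x in lebesgue. (\<lambda>n. indicat_real (A n) x *\<^sub>R hermite_div \<alpha> \<phi> x) \<longlonglongrightarrow> indicat_real B x *\<^sub>R hermite_div \<alpha> \<phi> x"
    using lim by eventually_elim (intro tendsto_intros)
  show "AE x in lebesgue. norm (indicat_real (A n) x *\<^sub>R hermite_div \<alpha> \<phi> x) \<le> norm (hermite_div \<alpha> \<phi> x)" for n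
    by (auto simp: indicator_def)
qed

text \<open>
  The zero field on \<open>A \<inter> B\<close> first shows that \<open>A \<union> B\<close> has finite perimeter; then the supremum can be taken
  over one field after the other.
\<close>

lemma real_perimeter_submodular:
  fixes A B :: "(real^'d::finite) set"
  assumes \<alpha>: "1 \<le> \<alpha>" and A: "finite_restricted_perimeter \<alpha> A" and B: "finite_restricted_perimeter \<alpha> B"
  shows "finite_restricted_perimeter \<alpha> (A \<union> B)" "finite_restricted_perimeter \<alpha> (A \<inter> B)"
    "real_perimeter \<alpha> (A \<union> B) + real_perimeter \<alpha> (A \<inter> B) \<le> real_perimeter \<alpha> A + real_perimeter \<alpha> B"
proof -
  define s where "s = real_perimeter \<alpha> A + real_perimeter \<alpha> B"
  note A' = finite_perimeterD[OF \<alpha> A] and B' = finite_perimeterD[OF \<alpha> B]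
  have sub: "flux \<alpha> (A \<union> B) \<phi>\<^sub>1 + flux \<alpha> (A \<inter> B) \<phi>\<^sub>2 \<le> s"
    if "\<phi>\<^sub>1 \<in> restricted_fields \<alpha>" "\<phi>\<^sub>2 \<in> restricted_fields \<alpha>" for \<phi>\<^sub>1 \<phi>\<^sub>2
    unfolding s_def by (rule restricted_flux_submodular[OF \<alpha> A'(1) B'(1) A'(2) B'(2) that])
  have "finite_restricted_perimeter \<alpha> (A \<union> B) \<and> real_perimeter \<alpha> (A \<union> B) \<le> s - flux \<alpha> (A \<inter> B) \<phi>"
    if "\<phi> \<in> restricted_fields \<alpha>" for \<phi>
    unfolding finite_perimeter_iff[OF \<alpha>] restricted_flux_bounded_def
    using sub[OF _ that] A' B' by (auto simp: algebra_simps)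
  then have U: "finite_restricted_perimeter \<alpha> (A \<union> B)"
    and U_le: "\<And>\<phi>. \<phi> \<in> restricted_fields \<alpha> \<Longrightarrow> real_perimeter \<alpha> (A \<union> B) \<le> s - flux \<alpha> (A \<inter> B) \<phi>"
    using zero_restricted_field(1)[OF \<alpha>] by blast+
  have "finite_restricted_perimeter \<alpha> (A \<inter> B) \<and> real_perimeter \<alpha> (A \<inter> B) \<le> s - real_perimeter \<alpha> (A \<union> B)"
    unfolding finite_perimeter_iff[OF \<alpha>] restricted_flux_bounded_def
    using U_le A' B' by (auto simp: algebra_simps)
  then show "finite_restricted_perimeter \<alpha> (A \<union> B)" "finite_restricted_perimeter \<alpha> (A \<inter> B)"
    "real_perimeter \<alpha> (A \<union> B) + real_perimeter \<alpha> (A \<inter> B) \<le> real_perimeter \<alpha> A + real_perimeter \<alpha> B"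
    using U by (auto simp: s_def)
qed

lemma real_perimeter_Compl:
  fixes A :: "(real^'d::finite) set"
  assumes \<alpha>: "1 \<le> \<alpha>" and A: "finite_restricted_perimeter \<alpha> A"
  shows "finite_restricted_perimeter \<alpha> (- A)" "real_perimeter \<alpha> (- A) = real_perimeter \<alpha> A"
proof -
  have *: "finite_restricted_perimeter \<alpha> (- C) \<and> real_perimeter \<alpha> (- C) \<le> real_perimeter \<alpha> C"
    if "finite_restricted_perimeter \<alpha> C" for C :: "(real^'d) set"
    unfolding finite_perimeter_iff[OF \<alpha>]
    using restricted_flux_bounded_Compl[OF \<alpha> finite_perimeterD(1,2)[OF \<alpha> that]] finite_perimeterD(1)[OF \<alpha> that]
    by (simp add: Compl_in_sets_lebesgue)
  from *[OF A] *[of "- A"] show "finite_restricted_perimeter \<alpha> (- A)" "real_perimeter \<alpha> (- A) = real_perimeter \<alpha> A"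
    by auto
qed

theorem theorem3p1:
  fixes \<alpha> :: real and E :: "(real^'d::finite) set"
  assumes "CARD('d) \<ge> 2"
    and "\<alpha> \<ge> 1"
    and "finite_restricted_perimeter \<alpha> E"
  shows "\<exists>u :: real^'d \<Rightarrow> real. integrable lebesgue u \<and>
    (\<forall>F. finite_restricted_perimeter \<alpha> F \<longrightarrow>
       hermite_functional \<alpha> u E \<le> hermite_functional \<alpha> u F)"
proof -
  note \<alpha> = \<open>\<alpha> \<ge> 1\<close>
  obtain h :: "real^'d \<Rightarrow> real" where h: "\<And>x. 0 < h x" "integrable lborel h"
    by (rule sigma_finite_measure.obtain_positive_integrable_function[OF sigma_finite_lborel]) (rule that)
  have h': "integrable lebesgue h" using h(2) by (subst integrable_completion) auto
  interpret submodular_perimeter lebesgue "Collect (finite_restricted_perimeter \<alpha>)" "real_perimeter \<alpha>" h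
  proof
    show "A \<in> sets lebesgue" if "A \<in> Collect (finite_restricted_perimeter \<alpha>)" for A :: "(real^'d) set"
      using that finite_perimeterD(1)[OF \<alpha>] by simp
    show "({} :: (real^'d) set) \<in> Collect (finite_restricted_perimeter \<alpha>)"
      using finite_perimeter_iff[OF \<alpha>, of "{} :: (real^'d) set" 0]
      by (simp add: restricted_flux_bounded_def flux_def set_lebesgue_integral_def)
    show "0 \<le> real_perimeter \<alpha> A" for A :: "(real^'d) set"
      unfolding real_perimeter_def by (rule real_of_ereal_pos[OF restricted_perimeter_nonneg[OF \<alpha>]])
    fix A :: "nat \<Rightarrow> (real^'d) set" and B c l
    assume A: "\<And>n. A n \<in> Collect (finite_restricted_perimeter \<alpha>)" and B: "B \<in> sets lebesgue"
      and lim: "AE x in lebesgue. (\<lambda>n. indicat_real (A n) x) \<longlonglongrightarrow> indicat_real B x"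
      and le: "\<And>n. real_perimeter \<alpha> (A n) \<le> c n" and c: "c \<longlonglongrightarrow> l"
    have "flux \<alpha> B \<phi> \<le> l" if \<phi>: "\<phi> \<in> restricted_fields \<alpha>" for \<phi>
    proof (rule LIMSEQ_le[OF flux_tendsto[OF \<alpha> _ _ B lim] c])
      have "flux \<alpha> (A n) \<phi> \<le> c n" for n
        using finite_perimeterD(2)[OF \<alpha>, of "A n"] A[of n] le[of n] \<phi>
        by (auto simp: restricted_flux_bounded_def intro: order_trans)
      then show "\<exists>N. \<forall>n\<ge>N. flux \<alpha> (A n) \<phi> \<le> c n" by blast
    qed (use \<phi> A finite_perimeterD(1)[OF \<alpha>] in \<open>auto simp: restricted_fields_def\<close>)
    then show "B \<in> Collect (finite_restricted_perimeter \<alpha>) \<and> real_perimeter \<alpha> B \<le> l"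
      using finite_perimeter_iff[OF \<alpha>, of B l] B by (simp add: restricted_flux_bounded_def)
  qed (use h(1) h' real_perimeter_submodular[OF \<alpha>] real_perimeter_Compl[OF \<alpha>] in \<open>auto simp: Compl_eq_Diff_UNIV[symmetric]\<close>)
  obtain u where u: "integrable lebesgue u"
    and min: "\<And>F. finite_restricted_perimeter \<alpha> F \<Longrightarrow>
      real_perimeter \<alpha> E + (LINT x:E|lebesgue. u x) \<le> real_perimeter \<alpha> F + (LINT x:F|lebesgue. u x)"
    using variational_curvature[of E] assms(3) by auto
  have "hermite_functional \<alpha> u E \<le> hermite_functional \<alpha> u F" if F: "finite_restricted_perimeter \<alpha> F" for F
    using min[OF F] unfolding hermite_functional_def
      finite_perimeterD(3)[OF \<alpha> assms(3), symmetric] finite_perimeterD(3)[OF \<alpha> F, symmetric] by simp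
  then show ?thesis using u by blast
qed

end
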